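(* For $n\geqslant3$, the semigroup $\mathcal{POPI}_n$ has exactly $$2n+n\varphi(n)+3^n+ \sum_{k=2}^n\binom{n}{k}\varepsilon(n,k)$$ (semigroup) endomorphisms, and the semigroup $\mathcal{POP}_n$ has exactly $$1+2n+n\varphi(n) + n2^{n-1} + \sum_{k=1}^{n}\binom{n}{k}(\tau^{2k}+\theta^{2k}-k^{2}+k-2) + \sum_{k=2}^n \left( \sum_{i=k}^{n}\binom{n}{i}\sum_{j=1}^{i-k+1}j^{2}\binom{i-j+k-2}{2k-3}\left(\varepsilon(n,k)+\sum_{\ell=1}^{k}\binom{k}{\ell}(\tau^{2\ell}+\theta^{2\ell}-\ell^{2}+\ell-2)\right)\right)$$ (semigroup) endomorphisms.
   Context: Let $\Omega_n=\{1<2<\cdots<n\}$. A sequence $(a_1,\ldots,a_t)$ ($t\geqslant0$) in $\Omega_n$ is cyclic if there is at most one index $i\in\{1,\ldots,t\}$ with $a_i>a_{i+1}$, where $a_{t+1}=a_1$. A partial transformation $\alpha$ of $\Omega_n$ with domain $\{a_1<\cdots<a_t\}$ is orientation-preserving if $(a_1\alpha,\ldots,a_t\alpha)$ is cyclic. $\mathcal{POP}_n$ is the monoid (under composition) of all orientation-preserving partial transformations of $\Omega_n$ and $\mathcal{POPI}_n$ is its submonoid of all injective elements (partial permutations); both contain the empty map. $\varphi$ is Euler's totient function, $\tau=\frac{1+\sqrt5}{2}$, $\theta=\frac{1-\sqrt5}{2}$, and $$\varepsilon(n,k)=\left|\left\{t\in\{1,2,\ldots,k-1\}\;:\; \tfrac{k}{\gcd(t,k)}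 \text{ divides } n\right\}\right|.$$ *)

theory Defs
  imports Complex_Main "HOL-Algebra.Group" "HOL-Number_Theory.Totient"
begin

(* A partial transformation of {1..n} is a map on nat with domain and range inside {1..n}. *)
definition partial_transformations :: "nat \<Rightarrow> (nat \<rightharpoonup> nat) set" where
  "partial_transformations n = {\<alpha>. dom \<alpha> \<subseteq> {1..n} \<and> ran \<alpha> \<subseteq> {1..n}}"

(* The sequence (a_1, ..., a_t) is the 0-indexed list xs; the index successor wraps around. *)
definition cyclic_seq :: "nat list \<Rightarrow> bool" where
  "cyclic_seq xs \<longleftrightarrow> card {i. i < length xs \<and> xs ! i > xs ! (Suc i mod length xs)} \<le> 1"

definition orientation_preserving :: "(nat \<rightharpoonup> nat) \<Rightarrow> bool" where
  "orientation_preserving \<alpha> \<longleftrightarrow>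
     cyclic_seq (map (\<lambda>a. the (\<alpha> a)) (sorted_list_of_set (dom \<alpha>)))"

(* Transformations act on the right: the product of \<alpha> and \<beta> applies \<alpha> first. *)
definition POP :: "nat \<Rightarrow> (nat \<rightharpoonup> nat) monoid" where
  "POP n = \<lparr>carrier = {\<alpha> \<in> partial_transformations n. orientation_preserving \<alpha>},
            monoid.mult = (\<lambda>\<alpha> \<beta>. \<beta> \<circ>\<^sub>m \<alpha>),
            one = (\<lambda>x. if x \<in> {1..n} then Some x else None)\<rparr>"

definition POPI :: "nat \<Rightarrow> (nat \<rightharpoonup> nat) monoid" where
  "POPI n = (POP n)\<lparr>carrier := {\<alpha> \<in> carrier (POP n). inj_on \<alpha> (dom \<alpha>)}\<rparr>"

(* Elements of hom preserve products but need not preserve the identity. Restricting to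
   extensional functions represents each endomorphism of the carrier exactly once. *)
definition semigroup_endos :: "('a, 'b) monoid_scheme \<Rightarrow> ('a \<Rightarrow> 'a) set" where
  "semigroup_endos S = hom S S \<inter> extensional (carrier S)"

definition eps :: "nat \<Rightarrow> nat \<Rightarrow> nat" where
  "eps n k = card {t \<in> {1..<k}. (k div gcd t k) dvd n}"

definition tau :: real where
  "tau = (1 + sqrt 5) / 2"

definition theta :: real where
  "theta = (1 - sqrt 5) / 2"

end

(*
  Let phi be an endomorphism and k the largest rank such that phi is constant on the elements of
  rank at most k.  If k < n - 1, the (n choose k+1) idempotents of rank k + 1 in POPI_n are sent to
  pairwise orthogonal idempotents modulo phi(0), which live on disjoint nonempty parts of the n
  points; so k + 1 is 1 or n - 1 and these idempotents go bijectively to the one-point identities.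
  Then phi is the conjugation by a permutation s of either alpha itself (k = 0) or of the action of
  alpha on complements of points (k = n - 2).  Since the rotation g must go to a rotation, s is
  affine modulo n; in the first case preservation of orientation forces s to be dihedral.

  If k >= n - 1, phi is determined by u = phi(g) and f = phi(0), subject to u^(n+1) = u, f^2 = f
  and uf = fu = f.  With e = u^n, either u = e and f is any idempotent below e, or u is a nontrivial
  rotation of im e, which has no fixed point, and f = 0.

  It remains to count idempotents.  An orientation-preserving idempotent of rank at least 2 on a
  chain is determined by its fixed points together with a cut in each cyclic gap between them, so
  their number is a sum of products of cyclic gaps.
*)
theory Submission
  imports Defs "HOL-Library.Infinite_Set"
begin

text \<open>The two monoids share what the argument uses: partial identities, rotations, increasing
  bijections between subsets, and the inverses of their injective members. Elements of equal rank
  are two-sided multiples of one another, so if one element of rank \<open>k + 1\<close> is not sent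
  to phi(0), then none is; hence the nonempty parts. The two conjugation families differ in size
  because the complement action of a non-unit has at most one value: only the units constrain it,
  and conjugating a rotation by an invertible affine map gives a rotation. The equation u^(n+1) = u
  replaces u^n = 1 because endomorphisms need not preserve the unit. A rotation by t of k points has
  order k / gcd(t, k), the source of \<open>eps\<close>. In the count of idempotents the inner gaps
  contribute binomial coefficients, while the gap passing through the ends of the chain contributes,
  through its position and its cut, the squares. Sums of these binomials over the rank are Fibonacci
  numbers of even index; weighting them by squares gives the Lucas numbers written with
  \<open>tau\<close> and \<open>theta\<close>, up to a quadratic correction.\<close>

section \<open>Cyclic sequences and cut-monotone maps\<close>

text \<open>The sorted reading starts just after the unique descent. Without a descent the sequence
  is constant and any starting point works, so \<open>d\<close> may be arbitrary.\<close>

lemma cyclic_seq_iff_sorted_rotation: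
  "cyclic_seq xs \<longleftrightarrow> (\<exists>us vs. xs = us @ vs \<and> sorted (vs @ us))"
proof
  let ?l = "length xs"
  let ?D = "{i. i < ?l \<and> xs ! i > xs ! (Suc i mod ?l)}"
  {
    assume "cyclic_seq xs"
    then have c: "card ?D \<le> 1" by (simp add: cyclic_seq_def)
    have fin: "finite ?D" by simp
    have "\<exists>d. ?D \<subseteq> {d}" using c fin
      unfolding One_nat_def card_le_Suc0_iff_eq[OF fin] by blast
    then obtain d where d: "?D \<subseteq> {d}" by blast
    have "sorted (rotate (Suc d) xs)"
      unfolding sorted_iff_nth_Suc
    proof (intro allI impI)
      fix j assume j: "Suc j < length (rotate (Suc d) xs)"
      define i where "i = (Suc d + j) mod ?l"
      have il: "i < ?l" using j by (auto simp: i_def intro: mod_less_divisor)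
      have "i \<noteq> d"
      proof
        assume "i = d"
        then have "(d + Suc j) mod ?l = d mod ?l" using il by (simp add: i_def)
        then have "?l dvd Suc j" by (metis add_diff_cancel_left' le_add1 mod_eq_dvd_iff_nat)
        then show False using j by (simp add: nat_dvd_not_less)
      qed
      then have "xs ! i \<le> xs ! (Suc i mod ?l)" using d il by force
      moreover have "Suc i mod ?l = (Suc d + Suc j) mod ?l" by (simp add: i_def mod_Suc_eq)
      ultimately show "rotate (Suc d) xs ! j \<le> rotate (Suc d) xs ! Suc j"
        using j by (simp add: nth_rotate i_def del: rotate_Suc)
    qed
    then have "sorted (drop (Suc d mod ?l) xs @ take (Suc d mod ?l) xs)"
      by (simp only: rotate_drop_take)
    then show "\<exists>us vs. xs = us @ vs \<and> sorted (vs @ us)"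
      by (metis append_take_drop_id)
  next
    assume "\<exists>us vs. xs = us @ vs \<and> sorted (vs @ us)"
    then obtain us vs where xs: "xs = us @ vs" and s: "sorted (vs @ us)" by blast
    have "i = (if us = [] then ?l - 1 else length us - 1)" if i: "i \<in> ?D" for i
    proof (rule ccontr)
      assume ni: "i \<noteq> (if us = [] then ?l - 1 else length us - 1)"
      have il: "i < ?l" and gt: "xs ! i > xs ! (Suc i mod ?l)" using i by auto
      have su: "sorted us" "sorted vs" and vu: "\<And>x y. x \<in> set vs \<Longrightarrow> y \<in> set us \<Longrightarrow> x \<le> y"
        using s by (auto simp: sorted_append)
      consider "Suc i < length us" | "length us \<le> i" "Suc i < ?l" | "Suc i = ?l" "us \<noteq> []" "vs \<noteq> []"
        using ni il xs by (cases "us = []"; cases "vs = []"; simp; linarith)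
      then show False
      proof cases
        case 1
        then have "us ! i \<le> us ! Suc i" using su(1) by (simp add: sorted_nth_mono)
        then show False using 1 gt xs by (simp add: nth_append)
      next
        case 2
        then have "vs ! (i - length us) \<le> vs ! Suc (i - length us)" using su(2) xs by (simp add: sorted_nth_mono)
        then show False using 2 gt xs by (simp add: nth_append Suc_diff_le)
      next
        case 3
        then have "i = length us + (length vs - 1)" using xs by (cases vs) auto
        then have "xs ! i = vs ! (length vs - 1)" "xs ! 0 = us ! 0" using xs 3 by (simp_all add: nth_append)
        then have "xs ! i \<in> set vs" "xs ! 0 \<in> set us" using 3 by auto
        then have "xs ! i \<le> xs ! 0" using vu by blast
        then show False using gt 3(1) by simp
      qed
    qed
    then have "?D \<subseteq> {if us = [] then ?l - 1 else length us - 1}" by blast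
    then have "card ?D \<le> 1" by (metis card.empty card_mono finite.emptyI finite_insert is_singletonI is_singleton_altdef)
    then show "cyclic_seq xs" by (simp add: cyclic_seq_def)
  }
qed

lemma cyclic_seq_swap:
  assumes "cyclic_seq (vs @ us)" shows "cyclic_seq (us @ vs)"
proof -
  obtain a b where ab: "vs @ us = a @ b" "sorted (b @ a)"
    using assms cyclic_seq_iff_sorted_rotation by blast
  then obtain c where "vs = a @ c \<and> c @ us = b \<or> vs @ c = a \<and> us = c @ b"
    by (auto simp: append_eq_append_conv2)
  then show ?thesis
  proof (elim disjE conjE)
    assume "vs = a @ c" "c @ us = b"
    then have "us @ vs = (us @ a) @ c" "sorted (c @ (us @ a))"
      using ab(2) by (simp_all flip: append_assoc)
    then show ?thesis unfolding cyclic_seq_iff_sorted_rotation by blast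
  next
    assume "vs @ c = a" "us = c @ b"
    then have "us @ vs = c @ (b @ vs)" "sorted ((b @ vs) @ c)" using ab by simp_all
    then show ?thesis unfolding cyclic_seq_iff_sorted_rotation by blast
  qed
qed

lemma sorted_split_at:
  "sorted (xs :: nat list) \<Longrightarrow> xs = filter (\<lambda>x. x < t) xs @ filter (\<lambda>x. t \<le> x) xs"
proof (induction xs)
  case (Cons a xs)
  then have "\<not> a < t \<Longrightarrow> filter (\<lambda>x. x < t) xs = []" by (auto simp: filter_empty_conv)
  then show ?case using Cons by (cases "a < t") simp_all
qed simp

type_synonym pmap = "nat \<rightharpoonup> nat"

text \<open>The threshold \<open>t\<close> marks the descent: reading the domain cyclically from \<open>t\<close>, the values increase.\<close>

definition cut_mono :: "nat \<Rightarrow> pmap \<Rightarrow> bool" where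
  "cut_mono t \<alpha> \<longleftrightarrow> (\<forall>x y a b. \<alpha> x = Some a \<longrightarrow> \<alpha> y = Some b \<longrightarrow> x < y \<longrightarrow>
      (if x < t \<and> t \<le> y then b \<le> a else a \<le> b))"

lemma cut_monoD:
  assumes "cut_mono t \<alpha>" "\<alpha> x = Some a" "\<alpha> y = Some b" "x < y"
  shows "x < t \<Longrightarrow> t \<le> y \<Longrightarrow> b \<le> a" and "\<not> (x < t \<and> t \<le> y) \<Longrightarrow> a \<le> b"
  using assms unfolding cut_mono_def by (metis, metis)

lemma sorted_map_iff_pairs:
  assumes "sorted (xs :: nat list)" "distinct xs"
  shows "sorted (map f xs) \<longleftrightarrow> (\<forall>x\<in>set xs. \<forall>y\<in>set xs. x < y \<longrightarrow> f x \<le> (f y :: nat))"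
  using assms
proof (induction xs)
  case (Cons a xs)
  then have "\<forall>y\<in>set xs. a < y" by (simp add: order_less_le) blast
  then have "\<forall>y\<in>set xs. a < y \<and> \<not> y < a" by auto
  moreover have "\<not> a < a" by simp
  moreover have "sorted (map f xs) \<longleftrightarrow> (\<forall>x\<in>set xs. \<forall>y\<in>set xs. x < y \<longrightarrow> f x \<le> f y)"
    using Cons by simp
  ultimately show ?case by (simp del: sorted_map)
qed simp

lemma orientation_preserving_iff_rotated:
  assumes "finite (dom \<alpha>)"
  shows "orientation_preserving \<alpha> \<longleftrightarrow>
    (\<exists>us vs. sorted_list_of_set (dom \<alpha>) = us @ vs \<and> sorted (map (\<lambda>x. the (\<alpha> x)) (vs @ us)))"
  unfolding orientation_preserving_def cyclic_seq_iff_sorted_rotation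
  unfolding map_eq_append_conv map_append by blast

text \<open>Replaces the enumeration of the domain by a pointwise condition, the form suited to
  conjugates and to counting. The threshold separates the two pieces of the enumeration: the head of
  \<open>vs\<close>, or any bound above \<open>us\<close> if \<open>vs\<close> is empty.\<close>

lemma orientation_preserving_iff_cut_mono:
  assumes fin: "finite (dom \<alpha>)"
  shows "orientation_preserving \<alpha> \<longleftrightarrow> (\<exists>t. cut_mono t \<alpha>)"
proof
  let ?L = "sorted_list_of_set (dom \<alpha>)" and ?f = "\<lambda>x. the (\<alpha> x)"
  have L: "set ?L = dom \<alpha>" "sorted ?L" "distinct ?L" using fin by auto
  {
    assume "orientation_preserving \<alpha>"
    then obtain us vs where uv: "?L = us @ vs" and s: "sorted (map ?f (vs @ us))"
      using orientation_preserving_iff_rotated[OF fin] by blast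
    have d: "set us \<inter> set vs = {}" "set us \<union> set vs = dom \<alpha>" "distinct us" "distinct vs" "sorted us" "sorted vs"
      and lt: "\<And>x y. x \<in> set us \<Longrightarrow> y \<in> set vs \<Longrightarrow> x \<le> y"
      using L unfolding uv by (auto simp: sorted_append)
    obtain t where t: "\<And>x. x \<in> set us \<Longrightarrow> x < t" "\<And>x. x \<in> set vs \<Longrightarrow> t \<le> x"
    proof (cases "vs = []")
      case True
      then show ?thesis using that[of "Suc (Max (insert 0 (set us)))"] by (simp add: less_Suc_eq_le)
    next
      case False
      have "x < hd vs" if "x \<in> set us" for x
        using lt[OF that, of "hd vs"] False d(1) that by (metis disjoint_iff hd_in_set le_neq_implies_less)
      moreover have "hd vs \<le> x" if "x \<in> set vs" for x
        using that d(6) by (metis False list.collapse order.refl set_ConsD sorted_simps(2))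
      ultimately show ?thesis using that by blast
    qed
    have su: "sorted (map ?f us)" "sorted (map ?f vs)"
      and vu: "\<And>x y. x \<in> set vs \<Longrightarrow> y \<in> set us \<Longrightarrow> ?f x \<le> ?f y" using s by (auto simp: sorted_append)
    have "cut_mono t \<alpha>" unfolding cut_mono_def
    proof (intro allI impI)
      fix x y a b assume xy: "\<alpha> x = Some a" "\<alpha> y = Some b" "x < y"
      then have dm: "x \<in> set us \<union> set vs" "y \<in> set us \<union> set vs" using d(2) by auto
      show "if x < t \<and> t \<le> y then b \<le> a else a \<le> b"
      proof (cases "x < t \<and> t \<le> y")
        case True
        then have "x \<in> set us" "y \<in> set vs" using dm t by (auto simp: not_le[symmetric])
        then show ?thesis using vu[of y x] True xy by simp
      next
        case False
        then have "x \<in> set us \<and> y \<in> set us \<or> x \<in> set vs \<and> y \<in> set vs"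
          using dm t xy(3) by (meson Un_iff order.strict_trans order.trans not_le less_imp_le)
        then have "?f x \<le> ?f y" using su sorted_map_iff_pairs[of us ?f] sorted_map_iff_pairs[of vs ?f] d xy(3) by blast
        then have "a \<le> b" using xy by simp
        then show ?thesis using False by (simp only: if_False)
      qed
    qed
    then show "\<exists>t. cut_mono t \<alpha>" by blast
  next
    assume "\<exists>t. cut_mono t \<alpha>"
    then obtain t where t: "cut_mono t \<alpha>" by blast
    define us where "us = filter (\<lambda>x. x < t) ?L"
    define vs where "vs = filter (\<lambda>x. t \<le> x) ?L"
    have uv: "?L = us @ vs" using sorted_split_at[OF L(2)] by (simp add: us_def vs_def)
    have sv: "sorted us" "sorted vs" "distinct us" "distinct vs" using L sorted_filter[of id ?L] by (simp_all add: us_def vs_def)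
    have us: "x \<in> set us \<longleftrightarrow> x \<in> dom \<alpha> \<and> x < t" and vs: "x \<in> set vs \<longleftrightarrow> x \<in> dom \<alpha> \<and> t \<le> x" for x
      using L(1) by (auto simp: us_def vs_def)
    have le: "?f x \<le> ?f y" if xd: "x \<in> dom \<alpha>" "y \<in> dom \<alpha>" and xy: "x < y \<and> \<not> (x < t \<and> t \<le> y) \<or> y < t \<and> t \<le> x" for x y
    proof -
      obtain a b where ab: "\<alpha> x = Some a" "\<alpha> y = Some b" using xd by blast
      show ?thesis using xy cut_monoD(2)[OF t ab] cut_monoD(1)[OF t ab(2,1)] ab by auto
    qed
    have 1: "sorted (map ?f us)" unfolding sorted_map_iff_pairs[OF sv(1,3)] using us le by auto
    have 2: "sorted (map ?f vs)" unfolding sorted_map_iff_pairs[OF sv(2,4)] using vs le by auto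
    have 3: "?f x \<le> ?f y" if "x \<in> set vs" "y \<in> set us" for x y
      using that us vs le by blast
    have "sorted (map ?f (vs @ us))" using 1 2 3 by (auto simp: sorted_append)
    then show "orientation_preserving \<alpha>" using orientation_preserving_iff_rotated[OF fin] uv by blast
  }
qed

lemma dom_map_comp_subset: "dom (\<beta> \<circ>\<^sub>m \<alpha>) \<subseteq> dom \<alpha>"
  by (auto simp: map_comp_Some_iff)

lemma ran_map_comp_subset: "ran (\<beta> \<circ>\<^sub>m \<alpha>) \<subseteq> ran \<beta>"
  by (auto simp: ran_def map_comp_Some_iff)

text \<open>Read from its cut, \<alpha> takes increasing values. The threshold of \<beta> splits
  these values into two blocks on each of which \<beta> increases, with the images of the second
  block below those of the first, so the composite again reads as a rotated sorted list.\<close>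

lemma orientation_preserving_map_comp:
  assumes fa: "finite (dom \<alpha>)" and fb: "finite (dom \<beta>)"
    and a: "orientation_preserving \<alpha>" and b: "orientation_preserving \<beta>"
  shows "orientation_preserving (\<beta> \<circ>\<^sub>m \<alpha>)"
proof -
  let ?c = "\<beta> \<circ>\<^sub>m \<alpha>"
  have fc: "finite (dom ?c)" using fa dom_map_comp_subset finite_subset by metis
  obtain us vs where uv: "sorted_list_of_set (dom \<alpha>) = us @ vs"
    and s: "sorted (map (\<lambda>x. the (\<alpha> x)) (vs @ us))"
    using a orientation_preserving_iff_rotated[OF fa] by blast
  obtain t where t: "cut_mono t \<beta>" using b orientation_preserving_iff_cut_mono[OF fb] by blast
  define P where "P = (\<lambda>x. the (\<alpha> x) \<in> dom \<beta>)"
  have "sorted_list_of_set (dom ?c) = filter P (us @ vs)"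
  proof (rule sorted_distinct_set_unique)
    show "sorted (filter P (us @ vs))" "distinct (filter P (us @ vs))"
      unfolding uv[symmetric] using fa by (auto intro: sorted_filter[of id, simplified])
    have "set (filter P (us @ vs)) = {x \<in> dom \<alpha>. P x}" unfolding uv[symmetric] using fa by auto
    also have "\<dots> = dom ?c" by (force simp: P_def map_comp_Some_iff)
    finally show "set (sorted_list_of_set (dom ?c)) = set (filter P (us @ vs))" using fc by simp
  qed (use fc in auto)
  moreover have "cyclic_seq (map (\<lambda>x. the (?c x)) (filter P vs @ filter P us))"
  proof -
    define zs where "zs = filter P (vs @ us)"
    have zd: "the (?c x) = the (\<beta> (the (\<alpha> x)))" if "x \<in> set zs" for x
    proof -
      have "x \<in> set (sorted_list_of_set (dom \<alpha>))" using that uv by (auto simp: zs_def)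
      then obtain y where "\<alpha> x = Some y" using fa by auto
      then show ?thesis by simp
    qed
    define ys where "ys = map (\<lambda>x. the (\<alpha> x)) zs"
    have ys: "sorted ys" "set ys \<subseteq> dom \<beta>"
      using sorted_filter[OF s, of P] by (auto simp: ys_def zs_def P_def)
    have eq: "map (\<lambda>x. the (?c x)) zs = map (\<lambda>y. the (\<beta> y)) ys" using zd by (simp add: ys_def)
    let ?g = "\<lambda>y. the (\<beta> y)"
    have split: "ys = filter (\<lambda>y. y < t) ys @ filter (\<lambda>y. t \<le> y) ys" by (rule sorted_split_at[OF ys(1)])
    have mono: "sorted (map ?g zs)" if "sorted zs" "set zs \<subseteq> dom \<beta>" "\<forall>x\<in>set zs. \<forall>y\<in>set zs. \<not> (x < t \<and> t \<le> y)" for zs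
      using that
    proof (induction zs)
      case (Cons x zs)
      have "?g x \<le> ?g y" if "y \<in> set zs" for y
      proof (cases "x = y")
        case False
        then have "x < y" using Cons.prems(1) that by (simp add: le_neq_implies_less)
        then show ?thesis using cut_monoD(2)[OF t, of x _ y] Cons.prems that
          by (metis (no_types, lifting) domD list.set_intros option.sel subsetD)
      qed simp
      then show ?case using Cons by simp
    qed simp
    have "sorted (map ?g (filter (\<lambda>y. t \<le> y) ys @ filter (\<lambda>y. y < t) ys))"
    proof -
      have "sorted (map ?g (filter (\<lambda>y. t \<le> y) ys))" "sorted (map ?g (filter (\<lambda>y. y < t) ys))"
        using ys by (auto intro!: mono sorted_filter[of id, simplified])
      moreover have "?g x \<le> ?g y" if xy: "x \<in> set (filter (\<lambda>y. t \<le> y) ys)" "y \<in> set (filter (\<lambda>y. y < t) ys)" for x y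
      proof -
        have "x \<in> dom \<beta>" "y \<in> dom \<beta>" using xy ys(2) by auto
        then obtain p q where "\<beta> x = Some p" "\<beta> y = Some q" by blast
        then show ?thesis using cut_monoD(1)[OF t, of y q x p] xy by simp
      qed
      ultimately show ?thesis by (auto simp: sorted_append)
    qed
    then have "cyclic_seq (map ?g ys)"
      unfolding cyclic_seq_iff_sorted_rotation using split by (metis map_append)
    then show ?thesis using eq by (simp add: zs_def)
  qed
  ultimately show ?thesis unfolding orientation_preserving_def
    by (simp add: cyclic_seq_swap)
qed

section \<open>Partial identities, inverses and rotations\<close>

text \<open>The threshold \<open>0\<close> serves: no point lies below it, so no pair is
  reversed.\<close>

lemma orientation_preserving_mono:
  assumes "finite (dom \<alpha>)" "\<And>x y a b. \<alpha> x = Some a \<Longrightarrow> \<alpha> y = Some b \<Longrightarrow> x < y \<Longrightarrow> a \<le> b"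
  shows "orientation_preserving \<alpha>"
  using assms unfolding orientation_preserving_iff_cut_mono[OF assms(1)] cut_mono_def
  by (metis not_less_zero)

definition idp :: "nat set \<Rightarrow> pmap" where
  "idp A = (\<lambda>x. if x \<in> A then Some x else None)"

lemma idp_simps [simp]:
  "idp A x = Some y \<longleftrightarrow> x \<in> A \<and> y = x" "dom (idp A) = A" "ran (idp A) = A"
  by (auto simp: idp_def ran_def dom_def)

lemma inj_pmap_iff:
  "inj_on \<alpha> (dom \<alpha>) \<longleftrightarrow> (\<forall>x x' y. \<alpha> x = Some y \<longrightarrow> \<alpha> x' = Some y \<longrightarrow> x = x')"
  unfolding inj_on_def dom_def by (auto; metis option.distinct(1))

lemma inj_idp: "inj_on (idp A) (dom (idp A))"
  by (auto simp: inj_on_def idp_def)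

lemma finite_ran_card_le:
  assumes "finite (dom \<alpha>)" shows "finite (ran \<alpha>)" "card (ran \<alpha>) \<le> card (dom \<alpha>)"
proof -
  have r: "ran \<alpha> = (\<lambda>x. the (\<alpha> x)) ` dom \<alpha>" by (force simp: ran_def dom_def)
  show "finite (ran \<alpha>)" "card (ran \<alpha>) \<le> card (dom \<alpha>)" unfolding r using assms by (auto intro: card_image_le)
qed

lemma orientation_preserving_idp: "finite A \<Longrightarrow> orientation_preserving (idp A)"
  by (rule orientation_preserving_mono) auto

lemma orientation_preserving_card_ran_le_1:
  assumes "finite (dom \<alpha>)" "card (ran \<alpha>) \<le> 1"
  shows "orientation_preserving \<alpha>"
proof (rule orientation_preserving_mono[OF assms(1)])
  fix x y a b assume "\<alpha> x = Some a" "\<alpha> y = Some b"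
  then have "a \<in> ran \<alpha>" "b \<in> ran \<alpha>" by (auto simp: ran_def)
  then show "a \<le> b" using card_le_Suc0_iff_eq[OF finite_ran_card_le(1)[OF assms(1)]] assms(2) by auto
qed

lemma ran_eq_image: "ran \<alpha> = (\<lambda>x. the (\<alpha> x)) ` dom \<alpha>"
  by (force simp: ran_def dom_def)

text \<open>Matches the increasing enumerations of the two sets. These bijections transport elements
  between subsets of equal size without leaving either monoid.\<close>

lemma ex_order_iso:
  fixes A B :: "nat set"
  assumes "finite A" "finite B" "card A = card B"
  obtains \<gamma> :: pmap where "dom \<gamma> = A" "ran \<gamma> = B" "inj_on \<gamma> (dom \<gamma>)"
    "\<And>x y a b. \<gamma> x = Some a \<Longrightarrow> \<gamma> y = Some b \<Longrightarrow> x < y \<longleftrightarrow> a < b"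
proof -
  obtain h where h: "bij_betw h {..<card A} A" "strict_mono_on {..<card A} h"
    by (rule ex_bij_betw_strict_mono_card[OF assms(1)])
  obtain g where g: "bij_betw g {..<card A} B" "strict_mono_on {..<card A} g"
    unfolding assms(3) by (rule ex_bij_betw_strict_mono_card[OF assms(2)])
  let ?i = "the_inv_into {..<card A} h"
  define \<gamma> where "\<gamma> = (\<lambda>x. if x \<in> A then Some (g (?i x)) else None)"
  have i: "bij_betw ?i A {..<card A}" by (rule bij_betw_the_inv_into[OF h(1)])
  have c: "bij_betw (g \<circ> ?i) A B" using bij_betw_trans[OF i g(1)] .
  have hi: "h (?i x) = x" if "x \<in> A" for x using h(1) that by (simp add: bij_betw_def f_the_inv_into_f)
  have il: "?i x < card A" if "x \<in> A" for x using i that by (auto simp: bij_betw_def)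
  have lt: "x < y \<longleftrightarrow> g (?i x) < g (?i y)" if "x \<in> A" "y \<in> A" for x y
    using strict_mono_on_less[OF h(2), of "?i x" "?i y"] strict_mono_on_less[OF g(2), of "?i x" "?i y"] hi il that
    by auto
  show ?thesis
  proof (rule that[of \<gamma>])
    show "dom \<gamma> = A" by (auto simp: \<gamma>_def split: if_splits)
    show "ran \<gamma> = B" using c by (auto simp: \<gamma>_def ran_def bij_betw_def image_def)
    show "inj_on \<gamma> (dom \<gamma>)" using c by (auto simp: inj_pmap_iff \<gamma>_def bij_betw_def inj_on_def split: if_splits)
  qed (auto simp: \<gamma>_def lt split: if_splits)
qed

lemma pmap_eqI: "(\<And>x y. f x = Some y \<longleftrightarrow> g x = Some y) \<Longrightarrow> f = (g :: nat \<rightharpoonup> nat)"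
  by (intro ext) (metis option.exhaust)

definition pinv :: "pmap \<Rightarrow> pmap" where
  "pinv \<alpha> = (\<lambda>y. if \<exists>x. \<alpha> x = Some y then Some (THE x. \<alpha> x = Some y) else None)"

lemma pinv_iff:
  assumes "inj_on \<alpha> (dom \<alpha>)" shows "pinv \<alpha> y = Some x \<longleftrightarrow> \<alpha> x = Some y"
proof -
  have "(THE x. \<alpha> x = Some y) = x" if "\<alpha> x = Some y" for x
    using that assms by (intro the_equality) (auto simp: inj_pmap_iff)
  then show ?thesis by (auto simp: pinv_def split: if_splits)
qed

lemma pinv_props:
  assumes "inj_on \<alpha> (dom \<alpha>)"
  shows "dom (pinv \<alpha>) = ran \<alpha>" "ran (pinv \<alpha>) = dom \<alpha>" "inj_on (pinv \<alpha>) (dom (pinv \<alpha>))"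
    "pinv \<alpha> \<circ>\<^sub>m \<alpha> = idp (dom \<alpha>)" "\<alpha> \<circ>\<^sub>m pinv \<alpha> = idp (ran \<alpha>)"
proof -
  note p = pinv_iff[OF assms]
  show "dom (pinv \<alpha>) = ran \<alpha>" "ran (pinv \<alpha>) = dom \<alpha>" using p by (auto simp: ran_def dom_def)
  show "inj_on (pinv \<alpha>) (dom (pinv \<alpha>))" using p unfolding inj_pmap_iff by auto
  show "pinv \<alpha> \<circ>\<^sub>m \<alpha> = idp (dom \<alpha>)" 
    by (rule pmap_eqI) (use assms p in \<open>auto simp: map_comp_Some_iff inj_pmap_iff\<close>)
  show "\<alpha> \<circ>\<^sub>m pinv \<alpha> = idp (ran \<alpha>)"
    by (rule pmap_eqI) (use assms p in \<open>auto simp: map_comp_Some_iff ran_def\<close>)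
qed

lemma map_comp_assoc: "(f \<circ>\<^sub>m g) \<circ>\<^sub>m h = f \<circ>\<^sub>m (g \<circ>\<^sub>m h)"
  by (rule ext) (auto simp: map_comp_def split: option.splits)

text \<open>The increasing enumeration of the range is the list of values of \<alpha> along
  \<open>vs @ us\<close>. Hence the inverse, read in increasing order, lists \<open>vs @ us\<close>,
  a rotation of the sorted list \<open>us @ vs\<close>.\<close>

lemma orientation_preserving_pinv:
  assumes fin: "finite (dom \<alpha>)" and inj: "inj_on \<alpha> (dom \<alpha>)" and op: "orientation_preserving \<alpha>"
  shows "orientation_preserving (pinv \<alpha>)"
proof -
  let ?f = "\<lambda>x. the (\<alpha> x)"
  obtain us vs where uv: "sorted_list_of_set (dom \<alpha>) = us @ vs" and s: "sorted (map ?f (vs @ us))"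
    using op orientation_preserving_iff_rotated[OF fin] by blast
  have set: "set us \<union> set vs = dom \<alpha>" and d: "distinct (us @ vs)" and so: "sorted (us @ vs)"
    unfolding uv[symmetric] using fin by (simp_all flip: set_append uv)
  have fr: "finite (ran \<alpha>)" by (rule finite_ran_card_le[OF fin])
  have injf: "inj_on ?f (dom \<alpha>)" using inj by (auto simp: inj_on_def dom_def)
  have "sorted_list_of_set (ran \<alpha>) = map ?f (vs @ us)"
  proof (rule sorted_distinct_set_unique)
    show "distinct (map ?f (vs @ us))" using d set injf by (simp only: distinct_map set_append Un_commute distinct_append Int_commute simp_thms)
    have "set (map ?f (vs @ us)) = ran \<alpha>" unfolding ran_eq_image set[symmetric] by auto
    then show "set (sorted_list_of_set (ran \<alpha>)) = set (map ?f (vs @ us))" using fr by simp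
  qed (use s fr in auto)
  moreover have "map (\<lambda>x. the (pinv \<alpha> x)) (map ?f us @ map ?f vs) = us @ vs"
  proof -
    have "the (pinv \<alpha> (?f x)) = x" if "x \<in> dom \<alpha>" for x
    proof -
      obtain y where "\<alpha> x = Some y" using \<open>x \<in> dom \<alpha>\<close> by blast
      then show ?thesis using pinv_iff[OF inj, of y x] by simp
    qed
    then have "map (\<lambda>x. the (pinv \<alpha> x)) (map ?f us) = us" "map (\<lambda>x. the (pinv \<alpha> x)) (map ?f vs) = vs"
      unfolding map_map using set by (intro map_idI; simp; blast)+
    then show ?thesis by simp
  qed
  moreover have "finite (dom (pinv \<alpha>))" using pinv_props(1)[OF inj] fr by simp
  ultimately show ?thesis using orientation_preserving_iff_rotated[of "pinv \<alpha>"] so pinv_props(1)[OF inj]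
    by (metis map_append)
qed

section \<open>Rotations of a finite chain\<close>

definition rot :: "nat set \<Rightarrow> nat \<Rightarrow> pmap" where
  "rot A t = map_of (zip (sorted_list_of_set A) (rotate t (sorted_list_of_set A)))"

lemma rot_nth:
  assumes "finite A" "i < card A"
  shows "rot A t (sorted_list_of_set A ! i) = Some (sorted_list_of_set A ! ((t + i) mod card A))"
  using assms by (simp add: rot_def map_of_zip_nth nth_rotate)

lemma sorted_list_of_set_nth_in:
  "finite A \<Longrightarrow> i < card A \<Longrightarrow> sorted_list_of_set A ! i \<in> A"
  by (metis length_sorted_list_of_set nth_mem set_sorted_list_of_set)

lemma sorted_list_of_set_nth_cases:
  assumes "finite A" "x \<in> A" obtains i where "i < card A" "x = sorted_list_of_set A ! i"
  using assms by (metis in_set_conv_nth length_sorted_list_of_set set_sorted_list_of_set)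

lemma dom_rot: "finite A \<Longrightarrow> dom (rot A t) = A"
  by (simp add: rot_def)

lemma pmap_eq_rotI:
  assumes "finite A" "dom \<alpha> = A"
    and "\<And>i. i < card A \<Longrightarrow> \<alpha> (sorted_list_of_set A ! i) = Some (sorted_list_of_set A ! ((t + i) mod card A))"
  shows "\<alpha> = rot A t"
proof
  fix x show "\<alpha> x = rot A t x"
  proof (cases "x \<in> A")
    case True
    then show ?thesis using sorted_list_of_set_nth_cases[OF assms(1)] assms(1,3) rot_nth by metis
  next
    case False
    then show ?thesis using assms(2) dom_rot[OF assms(1), of t] by (metis domIff)
  qed
qed

lemma rot_mod_card: "finite A \<Longrightarrow> rot A (t mod card A) = rot A t"
  by (rule pmap_eq_rotI) (auto simp: dom_rot rot_nth mod_simps)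

lemma rot_0: "finite A \<Longrightarrow> rot A 0 = idp A"
  by (rule pmap_eq_rotI[symmetric]) (simp_all add: sorted_list_of_set_nth_in)

lemma rot_cases:
  assumes "finite A" "rot A t x = Some y"
  obtains i where "i < card A" "x = sorted_list_of_set A ! i" "y = sorted_list_of_set A ! ((t + i) mod card A)"
  using assms by (metis domI dom_rot option.inject rot_nth sorted_list_of_set_nth_cases)

lemma rot_in:
  assumes A: "finite A" and "rot A t x = Some y" shows "x \<in> A \<and> y \<in> A"
  using assms(2)
proof (rule rot_cases[OF A])
  fix i assume i: "i < card A" "x = sorted_list_of_set A ! i" 
    "y = sorted_list_of_set A ! ((t + i) mod card A)"
  then have "(t + i) mod card A < card A" by simp
  then show ?thesis using A i by (simp add: sorted_list_of_set_nth_in)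
qed

lemma rot_map_comp: assumes A: "finite A" shows "rot A s \<circ>\<^sub>m rot A t = rot A (t + s)"
proof (rule pmap_eq_rotI[OF A])
  show "dom (rot A s \<circ>\<^sub>m rot A t) = A"
  proof (rule Set.set_eqI)
    fix x
    have "x \<in> A \<longleftrightarrow> (\<exists>y. rot A t x = Some y)" for x t using dom_rot[OF A, of t] by blast
    then show "x \<in> dom (rot A s \<circ>\<^sub>m rot A t) \<longleftrightarrow> x \<in> A"
      using rot_in[OF A] unfolding dom_def mem_Collect_eq by (metis map_comp_simps not_None_eq)
  qed
  fix i assume i: "i < card A"
  then have "(t + i) mod card A < card A" by simp
  then show "(rot A s \<circ>\<^sub>m rot A t) (sorted_list_of_set A ! i) = Some (sorted_list_of_set A ! ((t + s + i) mod card A))"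
    using i by (simp add: rot_nth[OF A] mod_simps ac_simps)
qed

lemma rot_eq_iff:
  assumes A: "finite A" and "s < card A" "t < card A" shows "rot A s = rot A t \<longleftrightarrow> s = t"
proof
  assume "rot A s = rot A t"
  then have "sorted_list_of_set A ! s = sorted_list_of_set A ! t"
    using rot_nth[OF A, of 0 s] rot_nth[OF A, of 0 t] assms by auto
  then show "s = t" using assms by (simp add: nth_eq_iff_index_eq)
qed simp

lemma rot_fixed_point:
  assumes A: "finite A" and "t < card A" "rot A t x = Some x" shows "t = 0"
proof -
  obtain i where i: "i < card A" "sorted_list_of_set A ! i = sorted_list_of_set A ! ((t + i) mod card A)"
    using rot_cases[OF A assms(3)] by metis
  moreover have "(t + i) mod card A < card A" using i(1) by simp
  ultimately have e: "(t + i) mod card A = i" using nth_eq_iff_index_eq[of "sorted_list_of_set A" i "(t + i) mod card A"] by simp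
  show ?thesis
  proof (cases "t + i < card A")
    case False
    then have "t + i - card A < card A" using i(1) assms(2) by simp
    then have "(t + i) mod card A = t + i - card A" using False by (simp add: le_mod_geq)
    then show ?thesis using e False assms(2) by simp
  qed (use e in simp)
qed

lemma ran_rot: assumes A: "finite A" shows "ran (rot A t) = A"
proof -
  have "y \<in> ran (rot A t)" if y: "y \<in> A" for y
  proof -
    define s where "s = card A - t mod card A"
    have "card A > 0" using A y card_gt_0_iff by blast
    then have "s + t mod card A = card A" by (simp add: s_def less_imp_le)
    then have s: "(s + t) mod card A = 0" by (metis mod_add_right_eq mod_self)
    have "rot A (s + t) y = Some y" using rot_mod_card[OF A, of "s + t"] unfolding s rot_0[OF A]
      using y by (metis idp_simps(1))
    then show ?thesis unfolding rot_map_comp[OF A, symmetric] map_comp_Some_iff ran_def by blast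
  qed
  then show ?thesis using rot_in[OF A] by (auto simp: ran_def)
qed

lemma inj_rot: assumes A: "finite A" shows "inj_on (rot A t) (dom (rot A t))"
proof -
  have "card ((\<lambda>x. the (rot A t x)) ` A) = card A"
  proof -
    have "(\<lambda>x. the (rot A t x)) ` A = A" using ran_rot[OF A, of t] dom_rot[OF A, of t] by (simp add: ran_eq_image)
    then show ?thesis by simp
  qed
  then have "inj_on (\<lambda>x. the (rot A t x)) A" by (rule eq_card_imp_inj_on[OF A])
  then show ?thesis using dom_rot[OF A] by (metis (mono_tags, lifting) inj_on_def)
qed

lemma orientation_preserving_rot: assumes A: "finite A" shows "orientation_preserving (rot A t)"
proof -
  let ?L = "sorted_list_of_set A"
  have "map (\<lambda>x. the (rot A t x)) ?L = rotate t ?L"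
    by (rule nth_equalityI) (use A in \<open>auto simp: rot_nth nth_rotate\<close>)
  moreover have "cyclic_seq (rotate t ?L)"
  proof -
    have "?L = [] @ ?L" "sorted (?L @ [])" by simp_all
    then have "cyclic_seq ?L" unfolding cyclic_seq_iff_sorted_rotation by blast
    then show ?thesis unfolding rotate_drop_take by (metis append_take_drop_id cyclic_seq_swap)
  qed
  ultimately show ?thesis by (simp add: orientation_preserving_def dom_rot[OF A])
qed

text \<open>Read from the cut, the values of a permutation of \<open>A\<close> are sorted, distinct
  and exhaust \<open>A\<close>, so they form the increasing enumeration of \<open>A\<close>. Thus
  \<alpha> undoes the shift by \<open>length us\<close>.\<close>

lemma orientation_preserving_perm_is_rot:
  assumes A: "finite A" and d: "dom \<alpha> = A" and r: "ran \<alpha> = A" and op: "orientation_preserving \<alpha>"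
  obtains t where "\<alpha> = rot A t"
proof -
  let ?f = "\<lambda>x. the (\<alpha> x)" and ?L = "sorted_list_of_set A" and ?l = "card A"
  obtain us vs where uv: "?L = us @ vs" and s: "sorted (map ?f (vs @ us))"
    using op orientation_preserving_iff_rotated[of \<alpha>] A d by auto
  have set: "set (vs @ us) = A" using uv A by (metis Un_commute set_append set_sorted_list_of_set)
  have len: "length (vs @ us) = ?l" using uv A by (metis add.commute length_append length_sorted_list_of_set)
  have fA: "?f ` A = A" using d r by (simp add: ran_eq_image)
  have st: "set (map ?f (vs @ us)) = A" using set fA by (simp only: set_map)
  then have "distinct (map ?f (vs @ us))" using len by (metis card_distinct length_map)
  then have L: "map ?f (vs @ us) = ?L" using s st A
    by (intro sorted_distinct_set_unique) simp_all
  have rL: "vs @ us = rotate (length us) ?L" by (simp add: uv rotate_append)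
  have lu: "length us \<le> ?l" using len by simp
  have "\<alpha> = rot A (?l - length us)"
  proof (rule pmap_eq_rotI[OF A d])
    fix j assume j: "j < ?l"
    define i where "i = (?l - length us + j) mod ?l"
    have i: "i < ?l" using j by (auto simp: i_def intro: mod_less_divisor)
    have "(length us + i) mod ?l = (length us + (?l - length us + j)) mod ?l" by (simp add: i_def mod_simps)
    also have "\<dots> = j" using lu j by (simp flip: add.assoc)
    finally have "(length us + i) mod ?l = j" .
    then have "(vs @ us) ! i = ?L ! j" using i A by (simp add: rL nth_rotate)
    then have "?f (?L ! j) = ?L ! i" using L i len by (metis nth_map)
    moreover have "?L ! j \<in> dom \<alpha>" using j d sorted_list_of_set_nth_in[OF A] by simp
    ultimately show "\<alpha> (?L ! j) = Some (?L ! ((?l - length us + j) mod ?l))" unfolding i_def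
      by (metis domD option.sel)
  qed
  then show ?thesis using that by blast
qed

section \<open>The action of an endomorphism on partial identities\<close>

lemma choose_ge: "1 \<le> r \<Longrightarrow> r < n \<Longrightarrow> n \<le> n choose r"
proof (induction n arbitrary: r)
  case (Suc n)
  show ?case
  proof (cases "r = n")
    case False
    then obtain r' where r: "r = Suc r'" "r < n" using Suc.prems by (cases r) auto
    have "n \<le> n choose r" using Suc.IH[of r] r by simp
    moreover have "1 \<le> n choose r'" using r by (simp add: Suc_le_eq)
    ultimately show ?thesis using r by simp
  qed simp
qed simp

text \<open>With \<open>choose_ge\<close>, this leaves \<open>r = 1\<close> and
  \<open>r = n - 1\<close> as the only ranks with 1 \<le> r < n at which \<open>n choose r\<close>
  does not exceed \<open>n\<close>.\<close>

lemma choose_gt: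
  assumes "2 \<le> r" "r + 2 \<le> n" shows "n < n choose r"
proof -
  obtain m s where ms: "n = Suc m" "r = Suc s" using assms by (metis Suc_le_D add_2_eq_Suc' numeral_2_eq_2)
  have "m \<le> m choose s" "m \<le> m choose r" using choose_ge[of s m] choose_ge[of r m] assms ms by auto
  then show ?thesis using assms ms by simp
qed

lemma idempotent_fixes_ran:
  fixes e :: pmap
  assumes "e \<circ>\<^sub>m e = e" "y \<in> ran e" shows "e y = Some y"
proof -
  have "\<exists>x. e x = Some y" using assms(2) by (auto simp: ran_def)
  then show ?thesis using assms(1) by (metis map_comp_simps(2))
qed

text \<open>One context for both monoids. Constructed maps enter through \<open>C_inj\<close> when
  they are injective, and otherwise through \<open>C_transfer\<close>, which asks for injectivity
  exactly when the map they are derived from is injective.\<close>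

locale orientation_monoid =
  fixes n :: nat and C :: "pmap set"
  assumes n3: "3 \<le> n" and C_cases: "C = carrier (POP n) \<or> C = carrier (POPI n)"
begin

abbreviation "N \<equiv> {1..n}"

lemma C_D:
  assumes "\<alpha> \<in> C"
  shows "dom \<alpha> \<subseteq> N" "ran \<alpha> \<subseteq> N" "orientation_preserving \<alpha>" "finite (dom \<alpha>)" "finite (ran \<alpha>)"
proof -
  show "dom \<alpha> \<subseteq> N" "ran \<alpha> \<subseteq> N" "orientation_preserving \<alpha>"
    using assms C_cases by (auto simp: POP_def POPI_def partial_transformations_def)
  then show "finite (dom \<alpha>)" "finite (ran \<alpha>)" by (meson finite_atLeastAtMost finite_subset)+
qed

lemma C_D_pt: "\<alpha> \<in> C \<Longrightarrow> \<alpha> x = Some y \<Longrightarrow> x \<in> N \<and> y \<in> N"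
  using C_D(1,2) by (fastforce simp: ran_def)

lemma C_transfer:
  assumes "\<alpha> \<in> C" "dom \<beta> \<subseteq> N" "ran \<beta> \<subseteq> N" "orientation_preserving \<beta>"
    and "inj_on \<alpha> (dom \<alpha>) \<Longrightarrow> inj_on \<beta> (dom \<beta>)"
  shows "\<beta> \<in> C"
  using assms C_cases by (auto simp: POP_def POPI_def partial_transformations_def)

lemma C_inj:
  assumes "dom \<beta> \<subseteq> N" "ran \<beta> \<subseteq> N" "orientation_preserving \<beta>" "inj_on \<beta> (dom \<beta>)"
  shows "\<beta> \<in> C"
  using assms C_cases by (auto simp: POP_def POPI_def partial_transformations_def)

lemma inj_map_comp:
  fixes \<alpha> \<beta> :: pmap
  assumes "inj_on \<alpha> (dom \<alpha>)" "inj_on \<beta> (dom \<beta>)" shows "inj_on (\<beta> \<circ>\<^sub>m \<alpha>) (dom (\<beta> \<circ>\<^sub>m \<alpha>))"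
  unfolding inj_pmap_iff map_comp_Some_iff
proof (intro allI impI, elim exE conjE)
  fix x x' y k k' assume h: "\<alpha> x = Some k" "\<beta> k = Some y" "\<alpha> x' = Some k'" "\<beta> k' = Some y"
  then have "k = k'" using assms(2) unfolding inj_pmap_iff by blast
  then show "x = x'" using assms(1) h unfolding inj_pmap_iff by blast
qed

lemma C_comp: assumes "\<alpha> \<in> C" "\<beta> \<in> C" shows "\<beta> \<circ>\<^sub>m \<alpha> \<in> C"
proof -
  have o: "orientation_preserving (\<beta> \<circ>\<^sub>m \<alpha>)"
    by (rule orientation_preserving_map_comp) (use C_D[OF assms(1)] C_D[OF assms(2)] in auto)
  have d: "dom (\<beta> \<circ>\<^sub>m \<alpha>) \<subseteq> N" "ran (\<beta> \<circ>\<^sub>m \<alpha>) \<subseteq> N"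
    using C_D(1)[OF assms(1)] C_D(2)[OF assms(2)] dom_map_comp_subset[of \<beta> \<alpha>] ran_map_comp_subset[of \<beta> \<alpha>] by blast+
  from C_cases show ?thesis
  proof
    assume "C = carrier (POP n)"
    then show ?thesis using o d by (simp add: POP_def partial_transformations_def)
  next
    assume c: "C = carrier (POPI n)"
    then have "inj_on \<alpha> (dom \<alpha>)" "inj_on \<beta> (dom \<beta>)" using assms by (auto simp: POPI_def)
    then show ?thesis by (intro C_inj d o inj_map_comp)
  qed
qed

lemma idp_C: "A \<subseteq> N \<Longrightarrow> idp A \<in> C"
  using inj_idp[of A] by (intro C_inj) (auto simp: orientation_preserving_idp finite_subset)

lemma empty_C: "Map.empty \<in> C"
  by (intro C_inj) (auto intro: orientation_preserving_mono)

lemma pinv_C: "\<alpha> \<in> C \<Longrightarrow> inj_on \<alpha> (dom \<alpha>) \<Longrightarrow> pinv \<alpha> \<in> C"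
  using C_D[of \<alpha>] pinv_props(1-3)[of \<alpha>] by (intro C_inj) (auto simp: orientation_preserving_pinv)

lemma rot_C: "rot N t \<in> C"
  using inj_rot[of N t] by (intro C_inj) (auto simp: dom_rot ran_rot orientation_preserving_rot)

section \<open>Rank and divisibility\<close>

definition rk :: "pmap \<Rightarrow> nat" where "rk \<alpha> = card (ran \<alpha>)"

lemma ran_comp_image: "ran (\<beta> \<circ>\<^sub>m \<alpha>) \<subseteq> (\<lambda>y. the (\<beta> y)) ` ran \<alpha>"
  by (force simp: ran_def map_comp_Some_iff)

lemma rk_comp_le:
  assumes "\<alpha> \<in> C" "\<beta> \<in> C" shows "rk (\<beta> \<circ>\<^sub>m \<alpha>) \<le> rk \<alpha>" "rk (\<beta> \<circ>\<^sub>m \<alpha>) \<le> rk \<beta>"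
  unfolding rk_def
  using C_D(5)[OF assms(1)] C_D(5)[OF assms(2)] ran_map_comp_subset[of \<beta> \<alpha>] ran_comp_image[of \<beta> \<alpha>]
  by (meson card_image_le card_mono finite_imageI le_trans)+

lemma rk_le: "\<alpha> \<in> C \<Longrightarrow> rk \<alpha> \<le> n"
  unfolding rk_def using C_D(2)[of \<alpha>] card_mono[of N "ran \<alpha>"] by simp

lemma rk_0: "\<alpha> \<in> C \<Longrightarrow> rk \<alpha> = 0 \<Longrightarrow> \<alpha> = Map.empty"
proof -
  assume "\<alpha> \<in> C" "rk \<alpha> = 0"
  then have "ran \<alpha> = {}" using C_D(5)[of \<alpha>] by (simp add: rk_def)
  then have "\<alpha> x = None" for x by (cases "\<alpha> x") (auto simp: ran_def)
  then show ?thesis by blast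
qed

lemma idp_ran_comp:
  fixes \<alpha> :: pmap shows "idp (ran \<alpha>) \<circ>\<^sub>m \<alpha> = \<alpha>"
  by (rule pmap_eqI) (auto simp: map_comp_Some_iff ran_def)

lemma idp_comp: "idp A \<circ>\<^sub>m idp B = idp (A \<inter> B)"
  by (rule pmap_eqI) (auto simp: map_comp_Some_iff)

text \<open>The increasing bijection \<gamma> from \<open>A\<close> onto the range of \<alpha> is
  invertible inside the monoid, and \<alpha> is \<gamma> after its inverse after \<alpha>.
  Consequently an endomorphism that collapses one partial identity collapses every element of that
  rank.\<close>

lemma factor_through_idp:
  assumes a: "\<alpha> \<in> C" and A: "A \<subseteq> N" "card A = rk \<alpha>"
  obtains \<beta> \<gamma> where "\<beta> \<in> C" "\<gamma> \<in> C" "\<alpha> = \<gamma> \<circ>\<^sub>m (idp A \<circ>\<^sub>m \<beta>)"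
proof -
  have fA: "finite A" using A(1) finite_subset by blast
  obtain \<gamma> where g: "dom \<gamma> = A" "ran \<gamma> = ran \<alpha>" "inj_on \<gamma> (dom \<gamma>)"
    and m: "\<And>x y a b. \<gamma> x = Some a \<Longrightarrow> \<gamma> y = Some b \<Longrightarrow> x < y \<longleftrightarrow> a < b"
    using ex_order_iso[OF fA C_D(5)[OF a] A(2)[unfolded rk_def]] by blast
  have "\<gamma> \<in> C"
  proof (rule C_inj)
    show "orientation_preserving \<gamma>"
      by (rule orientation_preserving_mono) (use g(1) fA m less_imp_le in auto)
  qed (use g A C_D[OF a] in auto)
  moreover from this have "pinv \<gamma> \<circ>\<^sub>m \<alpha> \<in> C" using pinv_C g a C_comp by blast
  moreover have "\<alpha> = \<gamma> \<circ>\<^sub>m (idp A \<circ>\<^sub>m (pinv \<gamma> \<circ>\<^sub>m \<alpha>))"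
  proof -
    have "idp A \<circ>\<^sub>m pinv \<gamma> = pinv \<gamma>" using pinv_props(2)[OF g(3)] g(1) idp_ran_comp by metis
    then have "\<gamma> \<circ>\<^sub>m (idp A \<circ>\<^sub>m (pinv \<gamma> \<circ>\<^sub>m \<alpha>)) = (\<gamma> \<circ>\<^sub>m pinv \<gamma>) \<circ>\<^sub>m \<alpha>" by (metis map_comp_assoc)
    also have "\<dots> = \<alpha>" using pinv_props(5)[OF g(3)] g(2) idp_ran_comp by simp
    finally show ?thesis by simp
  qed
  ultimately show ?thesis using that by blast
qed

text \<open>A transversal \<open>T\<close> of the kernel makes \<alpha> injective. Preceded by the
  increasing bijection from \<open>A\<close> onto \<open>T\<close>, it becomes an injective map with
  domain \<open>A\<close>, which its inverse turns into the identity on \<open>A\<close>.\<close>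

lemma idp_factor_through:
  assumes a: "\<alpha> \<in> C" and A: "A \<subseteq> N" "card A = rk \<alpha>"
  obtains \<beta> \<gamma> where "\<beta> \<in> C" "\<gamma> \<in> C" "idp A = \<gamma> \<circ>\<^sub>m (\<alpha> \<circ>\<^sub>m \<beta>)"
proof -
  have fA: "finite A" using A(1) finite_subset by blast
  obtain T where T: "T \<subseteq> dom \<alpha>" "inj_on (\<lambda>x. the (\<alpha> x)) T" "ran \<alpha> = (\<lambda>x. the (\<alpha> x)) ` T"
    using subset_image_inj[of "ran \<alpha>" "\<lambda>x. the (\<alpha> x)" "dom \<alpha>"] ran_eq_image[of \<alpha>] by auto
  have fT: "finite T" using T(1) C_D(4)[OF a] finite_subset by blast
  have cT: "card T = card A" using T A(2) by (simp add: rk_def card_image)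
  obtain \<delta> where d: "dom \<delta> = A" "ran \<delta> = T" "inj_on \<delta> (dom \<delta>)"
    and m: "\<And>x y a b. \<delta> x = Some a \<Longrightarrow> \<delta> y = Some b \<Longrightarrow> x < y \<longleftrightarrow> a < b"
    using ex_order_iso[OF fA fT cT[symmetric]] by blast
  have dC: "\<delta> \<in> C"
  proof (rule C_inj)
    show "orientation_preserving \<delta>"
      by (rule orientation_preserving_mono) (use d(1) fA m less_imp_le in auto)
  qed (use d A T C_D[OF a] in auto)
  define \<mu> where "\<mu> = \<alpha> \<circ>\<^sub>m \<delta>"
  have mC: "\<mu> \<in> C" using C_comp dC a by (simp add: \<mu>_def)
  have Tp: "x \<in> T" if "\<delta> y = Some x" for x y using d(2) that by (auto simp: ran_def)
  have im: "inj_on \<mu> (dom \<mu>)"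
    unfolding inj_pmap_iff \<mu>_def map_comp_Some_iff
  proof (intro allI impI, elim exE conjE)
    fix x x' y k k' assume h: "\<delta> x = Some k" "\<alpha> k = Some y" "\<delta> x' = Some k'" "\<alpha> k' = Some y"
    then have "k = k'" using T(2) Tp[OF h(1)] Tp[OF h(3)] by (metis inj_onD option.sel)
    then show "x = x'" using d(3) h by (auto simp: inj_pmap_iff)
  qed
  have dm: "dom \<mu> = A"
  proof (rule Set.set_eqI)
    fix x
    have "x \<in> A \<longleftrightarrow> (\<exists>y. \<delta> x = Some y)" using d(1) by blast
    moreover have "\<exists>z. \<alpha> y = Some z" if "\<delta> x = Some y" for y using Tp[OF that] T(1) by blast
    ultimately show "x \<in> dom \<mu> \<longleftrightarrow> x \<in> A"
      unfolding \<mu>_def dom_def mem_Collect_eq not_None_eq map_comp_Some_iff by blast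
  qed
  have "idp A = pinv \<mu> \<circ>\<^sub>m (\<alpha> \<circ>\<^sub>m \<delta>)" using pinv_props(4)[OF im] dm by (simp add: \<mu>_def)
  then show ?thesis using that dC pinv_C[OF mC im] by blast
qed

definition endos :: "(pmap \<Rightarrow> pmap) set" where
  "endos = {\<phi> \<in> extensional C. (\<forall>\<alpha>\<in>C. \<phi> \<alpha> \<in> C) \<and> (\<forall>\<alpha>\<in>C. \<forall>\<beta>\<in>C. \<phi> (\<beta> \<circ>\<^sub>m \<alpha>) = \<phi> \<beta> \<circ>\<^sub>m \<phi> \<alpha>)}"

lemma endosD:
  assumes "\<phi> \<in> endos" "\<alpha> \<in> C"
  shows "\<phi> \<alpha> \<in> C" "\<beta> \<in> C \<Longrightarrow> \<phi> (\<beta> \<circ>\<^sub>m \<alpha>) = \<phi> \<beta> \<circ>\<^sub>m \<phi> \<alpha>"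
  using assms by (auto simp: endos_def)

text \<open>The sets of size \<open>r\<close>, indexed by points, for both ranks that survive the
  counting argument; this lets the cases \<open>r = 1\<close> and \<open>r = n - 1\<close> run in
  parallel.\<close>

definition test_set :: "nat \<Rightarrow> nat \<Rightarrow> nat set" where
  "test_set r x = (if r = 1 then {x} else N - {x})"

text \<open>The idempotents of rank \<open>r\<close> become orthogonal modulo \<open>\<phi> Map.empty\<close>, so their images have ranges that
  are disjoint and nonempty outside the range of \<open>\<phi> Map.empty\<close>. Hence \<open>n choose r \<le> n\<close>, which leaves only
  \<open>r = 1\<close> and \<open>r = n - 1\<close>.\<close>

lemma endo_image_idp:
  assumes ph: "\<phi> \<in> endos" and r: "r < n"
    and const: "\<forall>\<alpha>\<in>C. rk \<alpha> < r \<longrightarrow> \<phi> \<alpha> = \<phi> Map.empty"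
    and a0: "\<alpha>\<^sub>0 \<in> C" "rk \<alpha>\<^sub>0 = r" "\<phi> \<alpha>\<^sub>0 \<noteq> \<phi> Map.empty"
  obtains \<sigma> where "bij_betw \<sigma> N N" "\<phi> Map.empty = Map.empty" "r = 1 \<or> r = n - 1"
    "\<And>x. x \<in> N \<Longrightarrow> \<phi> (idp (test_set r x)) = idp {\<sigma> x}"
proof -
  let ?z = "\<phi> Map.empty"
  let ?f = "\<lambda>A. \<phi> (idp A)"
  define AA where "AA = {A. A \<subseteq> N \<and> card A = r}"
  have r1: "1 \<le> r" using a0 rk_0 by (metis One_nat_def Suc_leI gr0I)
  have AC: "idp A \<in> C" if "A \<in> AA" for A using that idp_C by (auto simp: AA_def)
  \<comment> \<open>If one partial identity of rank \<open>r\<close> collapsed, then so would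
    \<open>\<alpha>\<^sub>0\<close>, which factors through it.\<close>
  have nz: "?f A \<noteq> ?z" if A: "A \<in> AA" for A
  proof
    assume e: "?f A = ?z"
    have A': "A \<subseteq> N" "card A = rk \<alpha>\<^sub>0" using A a0(2) by (auto simp: AA_def)
    obtain \<beta> \<gamma> where bg: "\<beta> \<in> C" "\<gamma> \<in> C" "\<alpha>\<^sub>0 = \<gamma> \<circ>\<^sub>m (idp A \<circ>\<^sub>m \<beta>)"
      by (rule factor_through_idp[OF a0(1) A'])
    have "\<phi> \<alpha>\<^sub>0 = \<phi> \<gamma> \<circ>\<^sub>m (?f A \<circ>\<^sub>m \<phi> \<beta>)"
      unfolding bg(3) using endosD(2)[OF ph] bg AC[OF A] C_comp by metis
    also have "\<dots> = \<phi> (\<gamma> \<circ>\<^sub>m (Map.empty \<circ>\<^sub>m \<beta>))"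
      unfolding e using endosD(2)[OF ph] bg empty_C C_comp by metis
    finally show False using a0(3) by simp
  qed
  have idem: "?f A \<circ>\<^sub>m ?f A = ?f A" if "A \<in> AA" for A
    using endosD(2)[OF ph AC[OF that] AC[OF that]] by (simp add: idp_comp)
  have orth: "?f A \<circ>\<^sub>m ?f B = ?z" if "A \<in> AA" "B \<in> AA" "A \<noteq> B" for A B
  proof -
    have fin: "finite A" "finite B" "card A = r" "card B = r" using that by (auto simp: AA_def intro: finite_subset)
    have "A \<inter> B \<noteq> A" using that fin by (metis card_subset_eq inf.cobounded2)
    then have "card (A \<inter> B) < r" using fin by (metis inf.cobounded1 psubsetI psubset_card_mono)
    then have "rk (idp (A \<inter> B)) < r" by (simp add: rk_def)
    moreover have "idp (A \<inter> B) \<in> C" using that by (intro idp_C) (auto simp: AA_def)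
    ultimately show ?thesis using const endosD(2)[OF ph AC[OF that(2)] AC[OF that(1)]] by (simp add: idp_comp)
  qed
  have zz: "?z \<circ>\<^sub>m ?z = ?z" using endosD(2)[OF ph empty_C empty_C] by simp
  have zf: "?z \<circ>\<^sub>m ?f A = ?z" "?f A \<circ>\<^sub>m ?z = ?z" if "A \<in> AA" for A
    using endosD(2)[OF ph AC[OF that] empty_C] endosD(2)[OF ph empty_C AC[OF that]] by simp_all
  note fixed = idempotent_fixes_ran
  \<comment> \<open>If the range of \<open>?f A\<close> lay inside that of \<open>?z\<close>, the
    idempotent \<open>?z\<close> would fix it pointwise; then \<open>?f A\<close> would equal its
    product with \<open>?z\<close>, which is \<open>?z\<close>.\<close>
  have "\<exists>y. y \<in> ran (?f A) - ran ?z" if A: "A \<in> AA" for A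
  proof (rule ccontr)
    assume "\<nexists>y. y \<in> ran (?f A) - ran ?z"
    then have s: "ran (?f A) \<subseteq> ran ?z" by blast
    have "?z y = Some y" if "?f A x = Some y" for x y using fixed[OF zz] s ranI[of "?f A", OF that] by blast
    then have "?z \<circ>\<^sub>m ?f A = ?f A"
      by (intro pmap_eqI) (unfold map_comp_Some_iff, metis option.inject)
    then show False using nz[OF A] zf(1)[OF A] by simp
  qed
  then have "\<forall>A\<in>AA. \<exists>y. y \<in> ran (?f A) - ran ?z" by blast
  then obtain p where pp: "\<forall>A\<in>AA. p A \<in> ran (?f A) - ran ?z" by (rule bchoice[THEN exE])
  then have p: "p A \<in> ran (?f A)" "p A \<notin> ran ?z" if "A \<in> AA" for A using that by blast+
  have meet: "y \<in> ran ?z" if "A \<in> AA" "B \<in> AA" "A \<noteq> B" "y \<in> ran (?f A)" "y \<in> ran (?f B)" for A B y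
  proof -
    have "?f A y = Some y" "?f B y = Some y"
      using fixed[OF idem[OF that(1)] that(4)] fixed[OF idem[OF that(2)] that(5)] .
    then have "(?f A \<circ>\<^sub>m ?f B) y = Some y" by simp
    then show ?thesis using orth[OF that(1-3)] by (auto simp: ran_def)
  qed
  have pin: "inj_on p AA"
  proof (rule inj_onI, rule ccontr)
    fix A B assume "A \<in> AA" "B \<in> AA" "p A = p B" "A \<noteq> B"
    then show False using meet[of A B "p A"] p[of A] p[of B] by simp
  qed
  have finA: "finite AA" unfolding AA_def by simp
  have cA: "card AA = n choose r" using n_subsets[of N r] by (simp add: AA_def)
  have pN: "p ` AA \<subseteq> N - ran ?z" 
  proof
    fix y assume "y \<in> p ` AA"
    then obtain A where "A \<in> AA" "y = p A" by blast
    then show "y \<in> N - ran ?z" using p[of A] C_D(2)[OF endosD(1)[OF ph AC[of A]]] by blast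
  qed
  have "n choose r \<le> card (N - ran ?z)" using card_inj_on_le[OF pin pN] cA by simp
  also have cz: "\<dots> = n - card (ran ?z)" using C_D(2)[OF endosD(1)[OF ph empty_C]] C_D(5)[OF endosD(1)[OF ph empty_C]]
    by (simp add: card_Diff_subset)
  finally have le: "n choose r \<le> n - card (ran ?z)" .
  \<comment> \<open>Since \<open>n choose r\<close> is at least \<open>n\<close>, the bound is
    attained: \<open>?z\<close> has empty range, and the chosen points exhaust
    \<open>N\<close>.\<close>
  then have c0: "card (ran ?z) = 0" "n choose r = n" using choose_ge[OF r1 r] n3 by auto
  then have z0: "?z = Map.empty" using rk_0[OF endosD(1)[OF ph empty_C]] by (simp add: rk_def)
  have rr: "r = 1 \<or> r = n - 1" using choose_gt[of r n] c0(2) r1 r by linarith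
  have "p ` AA = N" using pN card_image[OF pin] cA c0 by (intro card_subset_eq) auto
  then have pbij: "bij_betw p AA N" using pin by (simp add: bij_betw_def)
  \<comment> \<open>Every point of \<open>N\<close> represents some set, so an entry of
    \<open>?f A\<close> joins the points of two sets \<open>X\<close> and \<open>Y\<close>.
    Orthogonality forces both sets to be \<open>A\<close>.\<close>
  have fp: "?f A = idp {p A}" if A: "A \<in> AA" for A
  proof (rule pmap_eqI)
    fix x y
    show "?f A x = Some y \<longleftrightarrow> idp {p A} x = Some y"
    proof
      assume h: "?f A x = Some y"
      then have xy: "x \<in> N" "y \<in> N" using C_D_pt[OF endosD(1)[OF ph AC[OF A]]] by auto
      obtain X Y where X: "X \<in> AA" "x = p X" and Y: "Y \<in> AA" "y = p Y" using pbij xy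
        by (metis bij_betw_imp_surj_on imageE)
      have "y \<in> ran (?f A)" "y \<in> ran (?f Y)" using h p(1) Y by (auto simp: ran_def)
      then have yA: "Y = A" using meet[OF Y(1) A] p(2) Y by blast
      have fX: "?f X x = Some x" using fixed[OF idem[OF X(1)] p(1)[OF X(1)]] X(2) by simp
      have "X = A"
      proof (rule ccontr)
        assume "X \<noteq> A"
        then have "?f A \<circ>\<^sub>m ?f X = Map.empty" using orth[OF A X(1)] z0 by auto
        moreover have "(?f A \<circ>\<^sub>m ?f X) x = Some y" using fX h by simp
        ultimately show False by simp
      qed
      then show "idp {p A} x = Some y" using X Y yA by simp
    next
      assume "idp {p A} x = Some y"
      then show "?f A x = Some y" using fixed[OF idem[OF A] p(1)[OF A]] by simp
    qed
  qed
  have sm: "bij_betw (test_set r) N AA"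
  proof -
    have inj: "inj_on (test_set r) N" by (auto simp: inj_on_def test_set_def)
    have "test_set r ` N \<subseteq> AA" using rr n3 by (auto simp: test_set_def AA_def)
    then have "test_set r ` N = AA" using finA cA c0 card_image[OF inj] by (intro card_subset_eq) auto
    then show ?thesis using inj by (simp add: bij_betw_def)
  qed
  show ?thesis
  proof (rule that[of "p \<circ> test_set r"])
    show "bij_betw (p \<circ> test_set r) N N" using bij_betw_trans[OF sm pbij] .
    fix x assume "x \<in> N"
    then show "\<phi> (idp (test_set r x)) = idp {(p \<circ> test_set r) x}" using fp sm by (auto simp: bij_betw_def)
  qed (use z0 rr in auto)
qed

section \<open>Endomorphisms as twisted conjugations\<close>

definition img :: "pmap \<Rightarrow> nat set \<Rightarrow> nat set" where
  "img \<alpha> S = {y. \<exists>x\<in>S. \<alpha> x = Some y}"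

text \<open>The partial action of \<open>\<alpha>\<close> on complements of points. It is trivial on rank below \<open>n - 1\<close>, which
  makes it an endomorphism collapsing these ranks.\<close>

definition compl_map :: "pmap \<Rightarrow> pmap" where
  "compl_map \<alpha> = (\<lambda>x. if x \<in> N \<and> (\<exists>y\<in>N. img \<alpha> (N - {x}) = N - {y})
     then Some (THE y. y \<in> N \<and> img \<alpha> (N - {x}) = N - {y}) else None)"

lemma compl_map_iff: "compl_map \<alpha> x = Some y \<longleftrightarrow> x \<in> N \<and> y \<in> N \<and> img \<alpha> (N - {x}) = N - {y}"
proof -
  have "(THE y. y \<in> N \<and> img \<alpha> (N - {x}) = N - {y}) = y" if "y \<in> N" "img \<alpha> (N - {x}) = N - {y}" for y
    using that by (intro the_equality) blast+
  then show ?thesis unfolding compl_map_def by (metis (no_types, lifting) option.distinct(1) option.inject)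
qed

lemma card_img_le: "finite S \<Longrightarrow> finite (img \<alpha> S) \<and> card (img \<alpha> S) \<le> card S"
proof -
  assume S: "finite S"
  have s: "img \<alpha> S \<subseteq> (\<lambda>x. the (\<alpha> x)) ` S" by (force simp: img_def)
  then have "card (img \<alpha> S) \<le> card ((\<lambda>x. the (\<alpha> x)) ` S)" using S by (intro card_mono) auto
  also have "\<dots> \<le> card S" by (rule card_image_le[OF S])
  finally show ?thesis using s S finite_subset by blast
qed

definition core_map :: "nat \<Rightarrow> pmap \<Rightarrow> pmap" where
  "core_map r \<alpha> = (if r = 1 then \<alpha> else compl_map \<alpha>)"

text \<open>The conjugation lemmas range over all partial transformations, because they are applied
  to \<open>compl_map \<alpha>\<close> before it is known to preserve orientation.\<close>

definition PT :: "pmap set" where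
  "PT = {\<alpha>. \<forall>x y. \<alpha> x = Some y \<longrightarrow> x \<in> N \<and> y \<in> N}"

lemma PT_D: "\<alpha> \<in> PT \<Longrightarrow> \<alpha> x = Some y \<Longrightarrow> x \<in> N \<and> y \<in> N"
  by (simp add: PT_def)

lemma PT_subset:
  assumes "\<alpha> \<in> PT" shows "dom \<alpha> \<subseteq> N" "ran \<alpha> \<subseteq> N"
proof -
  show "dom \<alpha> \<subseteq> N"
  proof
    fix x assume "x \<in> dom \<alpha>"
    then obtain y where "\<alpha> x = Some y" by blast
    then show "x \<in> N" using PT_D[OF assms, of x y] by simp
  qed
  show "ran \<alpha> \<subseteq> N"
  proof
    fix y assume "y \<in> ran \<alpha>"
    then obtain x where "\<alpha> x = Some y" unfolding ran_def by blast
    then show "y \<in> N" using PT_D[OF assms, of x y] by simp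
  qed
qed

lemma C_PT: "\<alpha> \<in> C \<Longrightarrow> \<alpha> \<in> PT"
  using C_D_pt[of \<alpha>] by (simp add: PT_def)

lemma compl_map_PT: "compl_map \<alpha> \<in> PT"
  by (simp add: PT_def compl_map_iff)

lemma core_map_PT: "\<alpha> \<in> C \<Longrightarrow> core_map r \<alpha> \<in> PT"
  by (simp add: core_map_def C_PT compl_map_PT)

lemma test_set_props:
  assumes "r = 1 \<or> r = n - 1" "x \<in> N"
  shows "test_set r x \<subseteq> N" "card (test_set r x) = r" "idp (test_set r x) \<in> C"
  using assms n3 by (auto simp: test_set_def intro!: idp_C)

text \<open>Makes a single entry of \<open>core_map r \<alpha>\<close> visible to products. For
  \<open>r = n - 1\<close>, full rank of the sandwich forces the image of \<open>N - {x}\<close> to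
  be all of \<open>N - {y}\<close>, by comparing cardinalities.\<close>

lemma rk_between_test_sets:
  assumes a: "\<alpha> \<in> C" and r: "r = 1 \<or> r = n - 1" and xy: "x \<in> N" "y \<in> N"
  shows "rk (idp (test_set r y) \<circ>\<^sub>m (\<alpha> \<circ>\<^sub>m idp (test_set r x))) = r \<longleftrightarrow> core_map r \<alpha> x = Some y"
proof -
  have ran: "ran (idp (test_set r y) \<circ>\<^sub>m (\<alpha> \<circ>\<^sub>m idp (test_set r x))) = img \<alpha> (test_set r x) \<inter> test_set r y"
    unfolding ran_def img_def map_comp_Some_iff by auto
  show ?thesis
  proof (cases "r = 1")
    case True
    then have "img \<alpha> (test_set r x) \<inter> test_set r y = (if \<alpha> x = Some y then {y} else {})"
      by (auto simp: img_def test_set_def)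
    then show ?thesis unfolding rk_def ran using True by (simp add: core_map_def)
  next
    case False
    then have r': "r = n - 1" using r by simp
    let ?I = "img \<alpha> (N - {x})"
    have sx: "test_set r z = N - {z}" for z using False by (simp add: test_set_def)
    have c: "card (N - {y}) = n - 1" "card (N - {x}) = n - 1" using xy by simp_all
    have I: "finite ?I" "card ?I \<le> n - 1" using card_img_le[of "N - {x}" \<alpha>] c by auto
    have "card (?I \<inter> (N - {y})) = n - 1 \<longleftrightarrow> ?I = N - {y}"
    proof
      assume h: "card (?I \<inter> (N - {y})) = n - 1"
      then have "?I \<inter> (N - {y}) = N - {y}" using c by (intro card_subset_eq) auto
      moreover have "?I \<inter> (N - {y}) = ?I"
      proof (rule card_seteq[OF I(1)])
        show "card ?I \<le> card (?I \<inter> (N - {y}))" using h I(2) by simp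
      qed simp
      ultimately show "?I = N - {y}" by simp
    next
      assume "?I = N - {y}"
      then show "card (?I \<inter> (N - {y})) = n - 1" using c by simp
    qed
    then show ?thesis unfolding rk_def ran unfolding sx using r' False xy by (simp add: core_map_def compl_map_iff)
  qed
qed

section \<open>Conjugation by a permutation\<close>

definition conj_by :: "(nat \<Rightarrow> nat) \<Rightarrow> pmap \<Rightarrow> pmap" where
  "conj_by \<sigma> \<alpha> = (\<lambda>z. if z \<in> N then map_option \<sigma> (\<alpha> (inv_into N \<sigma> z)) else None)"

lemma conj_by_at:
  assumes b: "bij_betw \<sigma> N N" and "x \<in> N"
  shows "conj_by \<sigma> \<alpha> (\<sigma> x) = map_option \<sigma> (\<alpha> x)"
  using assms bij_betw_inv_into_left[OF b, of x] by (auto simp: conj_by_def bij_betw_def)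

lemma conj_by_iff:
  assumes b: "bij_betw \<sigma> N N" and p: "\<alpha> \<in> PT"
  shows "conj_by \<sigma> \<alpha> z = Some w \<longleftrightarrow> (\<exists>x\<in>N. \<exists>y\<in>N. z = \<sigma> x \<and> w = \<sigma> y \<and> \<alpha> x = Some y)"
proof
  assume h: "conj_by \<sigma> \<alpha> z = Some w"
  then have "z \<in> N" by (auto simp: conj_by_def split: if_splits)
  then obtain x where x: "x \<in> N" "z = \<sigma> x" using b by (metis bij_betw_imp_surj_on imageE)
  then obtain y where "\<alpha> x = Some y" "w = \<sigma> y" using h conj_by_at[OF b x(1), of \<alpha>] by auto
  then show "\<exists>x\<in>N. \<exists>y\<in>N. z = \<sigma> x \<and> w = \<sigma> y \<and> \<alpha> x = Some y" using x PT_D[OF p] by blast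
next
  assume "\<exists>x\<in>N. \<exists>y\<in>N. z = \<sigma> x \<and> w = \<sigma> y \<and> \<alpha> x = Some y"
  then show "conj_by \<sigma> \<alpha> z = Some w" using conj_by_at[OF b] by auto
qed

lemma conj_by_range:
  assumes b: "bij_betw \<sigma> N N" and p: "\<alpha> \<in> PT"
  shows "dom (conj_by \<sigma> \<alpha>) \<subseteq> N" "ran (conj_by \<sigma> \<alpha>) \<subseteq> N" "dom (conj_by \<sigma> \<alpha>) = \<sigma> ` dom \<alpha>" "ran (conj_by \<sigma> \<alpha>) = \<sigma> ` ran \<alpha>"
proof -
  note c = conj_by_iff[OF b p]
  show 1: "dom (conj_by \<sigma> \<alpha>) = \<sigma> ` dom \<alpha>"
  proof (rule Set.set_eqI)
    fix z show "z \<in> dom (conj_by \<sigma> \<alpha>) \<longleftrightarrow> z \<in> \<sigma> ` dom \<alpha>"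
      unfolding dom_def mem_Collect_eq not_None_eq c image_iff using PT_D[OF p] by blast
  qed
  show 2: "ran (conj_by \<sigma> \<alpha>) = \<sigma> ` ran \<alpha>"
  proof (rule Set.set_eqI)
    fix z show "z \<in> ran (conj_by \<sigma> \<alpha>) \<longleftrightarrow> z \<in> \<sigma> ` ran \<alpha>"
    proof
      assume "z \<in> ran (conj_by \<sigma> \<alpha>)"
      then obtain w where "conj_by \<sigma> \<alpha> w = Some z" unfolding ran_def by blast
      then obtain x y where "\<alpha> x = Some y" "z = \<sigma> y" using c[of w z] by blast
      then show "z \<in> \<sigma> ` ran \<alpha>" by (simp add: ranI)
    next
      assume "z \<in> \<sigma> ` ran \<alpha>"
      then obtain x y where xy: "\<alpha> x = Some y" "z = \<sigma> y" unfolding ran_def by blast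
      then have "conj_by \<sigma> \<alpha> (\<sigma> x) = Some z" using c[of "\<sigma> x" z] PT_D[OF p xy(1)] by blast
      then show "z \<in> ran (conj_by \<sigma> \<alpha>)" by (rule ranI)
    qed
  qed
  have "dom \<alpha> \<subseteq> N" "ran \<alpha> \<subseteq> N" using PT_subset[OF p] by auto
  then show "dom (conj_by \<sigma> \<alpha>) \<subseteq> N" "ran (conj_by \<sigma> \<alpha>) \<subseteq> N" unfolding 1 2 using bij_betw_imp_surj_on[OF b] image_mono[of _ N \<sigma>] by simp_all
qed

lemma conj_by_inj:
  assumes b: "bij_betw \<sigma> N N" and p: "\<alpha> \<in> PT"
    and i: "inj_on \<alpha> (dom \<alpha>)"
  shows "inj_on (conj_by \<sigma> \<alpha>) (dom (conj_by \<sigma> \<alpha>))"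
  unfolding inj_pmap_iff
proof (intro allI impI)
  fix z z' w assume "conj_by \<sigma> \<alpha> z = Some w" "conj_by \<sigma> \<alpha> z' = Some w"
  then obtain x y x' y' where h: "x \<in> N" "y \<in> N" "x' \<in> N" "y' \<in> N" "z = \<sigma> x" "z' = \<sigma> x'" "\<sigma> y = \<sigma> y'"
    "\<alpha> x = Some y" "\<alpha> x' = Some y'" unfolding conj_by_iff[OF b p] by blast
  then have "y = y'" using inj_onD[OF bij_betw_imp_inj_on[OF b]] by blast
  then have "x = x'" using h(8,9) i unfolding inj_pmap_iff by blast
  then show "z = z'" using h by simp
qed

lemma conj_by_comp:
  assumes b: "bij_betw \<sigma> N N" and p: "\<alpha> \<in> PT" 
    and q: "\<beta> \<in> PT"
  shows "conj_by \<sigma> (\<beta> \<circ>\<^sub>m \<alpha>) = conj_by \<sigma> \<beta> \<circ>\<^sub>m conj_by \<sigma> \<alpha>"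
proof (rule ext)
  fix z
  show "conj_by \<sigma> (\<beta> \<circ>\<^sub>m \<alpha>) z = (conj_by \<sigma> \<beta> \<circ>\<^sub>m conj_by \<sigma> \<alpha>) z"
  proof (cases "z \<in> N")
    case True
    then obtain x where x: "x \<in> N" "z = \<sigma> x" using b by (metis bij_betw_imp_surj_on imageE)
    show ?thesis
    proof (cases "\<alpha> x")
      case None
      then show ?thesis using x conj_by_at[OF b] by simp
    next
      case (Some y)
      then have "y \<in> N" using PT_D[OF p] by blast
      then show ?thesis using Some x conj_by_at[OF b] by simp
    qed
  next
    case False
    then have "conj_by \<sigma> \<gamma> z = None" for \<gamma> by (simp only: conj_by_def if_False)
    then show ?thesis by (simp only: map_comp_simps(1))
  qed
qed

text \<open>An entry of \<open>\<phi> \<alpha>\<close> is detected by sandwiching between two point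
  identities. The sandwich is the image of an element \<open>?b\<close> of rank at most
  \<open>r\<close>. It is empty if that rank is smaller, and nonempty if the rank is
  \<open>r\<close>, because \<open>?b\<close> then generates a partial identity with nonempty
  image.\<close>

lemma endo_form:
  assumes ph: "\<phi> \<in> endos" and r: "r < n"
    and const: "\<forall>\<alpha>\<in>C. rk \<alpha> < r \<longrightarrow> \<phi> \<alpha> = \<phi> Map.empty"
    and a0: "\<alpha>\<^sub>0 \<in> C" "rk \<alpha>\<^sub>0 = r" "\<phi> \<alpha>\<^sub>0 \<noteq> \<phi> Map.empty"
  obtains \<sigma> where "bij_betw \<sigma> N N" "r = 1 \<or> r = n - 1" "\<And>\<alpha>. \<alpha> \<in> C \<Longrightarrow> \<phi> \<alpha> = conj_by \<sigma> (core_map r \<alpha>)"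
proof -
  have "\<exists>\<sigma>. bij_betw \<sigma> N N \<and> \<phi> Map.empty = Map.empty \<and> (r = 1 \<or> r = n - 1) \<and>
      (\<forall>x\<in>N. \<phi> (idp (test_set r x)) = idp {\<sigma> x})"
  proof (rule endo_image_idp[OF ph r const a0])
    fix \<sigma> assume "bij_betw \<sigma> N N" "\<phi> Map.empty = Map.empty" "r = 1 \<or> r = n - 1"
      "\<And>x. x \<in> N \<Longrightarrow> \<phi> (idp (test_set r x)) = idp {\<sigma> x}"
    then show ?thesis by (intro exI[of _ \<sigma>]) simp
  qed
  then obtain \<sigma> where s: "bij_betw \<sigma> N N" "\<phi> Map.empty = Map.empty" "r = 1 \<or> r = n - 1"
    "\<And>x. x \<in> N \<Longrightarrow> \<phi> (idp (test_set r x)) = idp {\<sigma> x}" by blast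
  have key: "\<phi> \<alpha> (\<sigma> x) = Some (\<sigma> y) \<longleftrightarrow> core_map r \<alpha> x = Some y" if a: "\<alpha> \<in> C" and xy: "x \<in> N" "y \<in> N" for \<alpha> x y
  proof -
    note sx = test_set_props[OF s(3) xy(1)] and sy = test_set_props[OF s(3) xy(2)]
    let ?b = "idp (test_set r y) \<circ>\<^sub>m (\<alpha> \<circ>\<^sub>m idp (test_set r x))"
    have ax: "\<alpha> \<circ>\<^sub>m idp (test_set r x) \<in> C" using C_comp sx(3) a by blast
    have bC: "?b \<in> C" using C_comp[OF ax sy(3)] .
    have rb: "rk ?b \<le> r" using rk_comp_le(2)[OF ax sy(3)] sy(2) by (simp add: rk_def)
    have pb: "\<phi> ?b = idp {\<sigma> y} \<circ>\<^sub>m (\<phi> \<alpha> \<circ>\<^sub>m idp {\<sigma> x})"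
      using endosD(2)[OF ph ax sy(3)] endosD(2)[OF ph sx(3) a] s(4) xy by simp
    have "\<phi> ?b \<noteq> Map.empty \<longleftrightarrow> \<phi> \<alpha> (\<sigma> x) = Some (\<sigma> y)"
    proof -
      have "(idp {\<sigma> y} \<circ>\<^sub>m (\<phi> \<alpha> \<circ>\<^sub>m idp {\<sigma> x})) u = Some v \<longleftrightarrow> u = \<sigma> x \<and> v = \<sigma> y \<and> \<phi> \<alpha> (\<sigma> x) = Some (\<sigma> y)" for u v
        unfolding map_comp_Some_iff by auto
      then show ?thesis unfolding pb by (metis not_None_eq)
    qed
    moreover have "\<phi> ?b \<noteq> Map.empty \<longleftrightarrow> rk ?b = r"
    proof
      assume "\<phi> ?b \<noteq> Map.empty"
      then show "rk ?b = r" using const bC s(2) rb by fastforce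
    next
      assume rr: "rk ?b = r"
      obtain \<beta> \<gamma> where bg: "\<beta> \<in> C" "\<gamma> \<in> C" "idp (test_set r x) = \<gamma> \<circ>\<^sub>m (?b \<circ>\<^sub>m \<beta>)"
        using idp_factor_through[OF bC sx(1)] sx(2) rr by metis
      have "idp {\<sigma> x} = \<phi> \<gamma> \<circ>\<^sub>m (\<phi> ?b \<circ>\<^sub>m \<phi> \<beta>)"
        using endosD(2)[OF ph C_comp[OF bg(1) bC] bg(2)] endosD(2)[OF ph bg(1) bC] bg(3) s(4)[OF xy(1)] by simp
      moreover have "idp {\<sigma> x} \<noteq> Map.empty" by (metis idp_simps(1) option.distinct(1) singletonI)
      ultimately show "\<phi> ?b \<noteq> Map.empty" by auto
    qed
    ultimately show ?thesis using rk_between_test_sets[OF a s(3) xy] by blast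
  qed
  show ?thesis
  proof (rule that[OF s(1,3)], rule pmap_eqI)
    fix \<alpha> z w assume a: "\<alpha> \<in> C"
    note c = conj_by_iff[of \<sigma> "core_map r \<alpha>" z w, OF s(1) core_map_PT[OF a]]
    show "\<phi> \<alpha> z = Some w \<longleftrightarrow> conj_by \<sigma> (core_map r \<alpha>) z = Some w"
    proof
      assume h: "\<phi> \<alpha> z = Some w"
      then have "z \<in> \<sigma> ` N" "w \<in> \<sigma> ` N" using C_D_pt[OF endosD(1)[OF ph a] h] bij_betw_imp_surj_on[OF s(1)] by auto
      then obtain x y where "x \<in> N" "y \<in> N" "z = \<sigma> x" "w = \<sigma> y" by blast
      then show "conj_by \<sigma> (core_map r \<alpha>) z = Some w" unfolding c using key[OF a] h by blast
    next
      assume "conj_by \<sigma> (core_map r \<alpha>) z = Some w"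
      then show "\<phi> \<alpha> z = Some w" unfolding c using key[OF a] by blast
    qed
  qed
qed

text \<open>Residues modulo \<open>n\<close> are represented in \<open>{1..n}\<close>, with the
  point \<open>n\<close> in the role of zero. The final \<open>+ 1\<close> restores this range, so
  that \<open>aff a m n = a + 1\<close> when \<open>a < n\<close>.\<close>

definition aff :: "nat \<Rightarrow> nat \<Rightarrow> nat \<Rightarrow> nat" where "aff a m x = (a + m * x) mod n + 1"

lemma rot_N: assumes "x \<in> N" shows "rot N t x = Some ((x - 1 + t) mod n + 1)"
proof -
  have L: "sorted_list_of_set N = [1..<Suc n]" by (metis atLeastLessThanSuc_atLeastAtMost sorted_list_of_set_range)
  have "x - 1 < card N" using assms by auto
  moreover have "sorted_list_of_set N ! i = i + 1" if "i < n" for i using that unfolding L by (simp add: nth_upt del: upt_Suc)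
  moreover have "(t + (x - 1)) mod n < n" using n3 by simp
  ultimately show ?thesis using rot_nth[of N "x - 1" t] assms by (simp add: add.commute)
qed

lemma aff_N: "aff a m x \<in> N"
  using n3 mod_less_divisor[of n "a + m * x"] by (simp add: aff_def Suc_le_eq)

text \<open>The conjugate of the generating rotation is a permutation in the monoid, hence a
  rotation by some \<open>t\<close>. So \<sigma> advances by \<open>t\<close> at every cyclic step
  and is determined by its value at \<open>n\<close>.\<close>

lemma aff_of_conj_rot:
  assumes b: "bij_betw \<sigma> N N" and c: "conj_by \<sigma> (rot N 1) \<in> C"
  obtains a m where "a < n" "m \<in> totatives n" "\<And>x. x \<in> N \<Longrightarrow> \<sigma> x = aff a m x"
proof -
  have p: "rot N 1 \<in> PT" by (rule C_PT[OF rot_C])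
  have "dom (conj_by \<sigma> (rot N 1)) = N" "ran (conj_by \<sigma> (rot N 1)) = N"
    using conj_by_range(3,4)[of \<sigma> "rot N 1", OF b p] dom_rot[of N 1] ran_rot[of N 1] bij_betw_imp_surj_on[OF b] by simp_all
  then obtain t where t: "conj_by \<sigma> (rot N 1) = rot N t"
    using orientation_preserving_perm_is_rot[of N] C_D(3)[OF c] by blast
  define m where "m = t mod n"
  define a where "a = \<sigma> n - 1"
  have sN: "\<sigma> x \<in> N" if "x \<in> N" for x using that b by (auto simp: bij_betw_def)
  \<comment> \<open>\<open>x mod n + 1\<close> is the cyclic successor of \<open>x\<close>: the
    point \<open>n\<close> is followed by \<open>1\<close>.\<close>
  have step: "\<sigma> (x mod n + 1) = (\<sigma> x - 1 + m) mod n + 1" if x: "x \<in> N" for x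
  proof -
    have "Some (\<sigma> (x mod n + 1)) = conj_by \<sigma> (rot N 1) (\<sigma> x)"
      using conj_by_at[OF b x] rot_N[OF x, of 1] x by simp
    also have "\<dots> = Some ((\<sigma> x - 1 + t) mod n + 1)" unfolding t by (rule rot_N[OF sN[OF x]])
    finally show ?thesis by (simp add: m_def mod_simps)
  qed
  have "1 \<le> x \<Longrightarrow> x \<le> n \<Longrightarrow> \<sigma> x = aff a m x" for x
  proof (induction x)
    case (Suc x)
    show ?case
    proof (cases "x = 0")
      case True
      then show ?thesis using step[of n] n3 by (simp add: aff_def a_def)
    next
      case False
      then have "\<sigma> (Suc x) = (\<sigma> x - 1 + m) mod n + 1" using step[of x] Suc.prems by simp
      also have "\<dots> = aff a m (Suc x)" using Suc False by (simp add: aff_def mod_simps algebra_simps)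
      finally show ?thesis .
    qed
  qed simp
  then have s: "\<sigma> x = aff a m x" if "x \<in> N" for x using that by simp
  have an: "a < n" using sN[of n] n3 by (auto simp: a_def)
  \<comment> \<open>Surjectivity, applied to the value with residue a + 1, yields an inverse of
    \<open>m\<close> modulo \<open>n\<close>.\<close>
  have "(a + 1) mod n + 1 \<in> \<sigma> ` N" using bij_betw_imp_surj_on[OF b] aff_N[of a 1 1] by (simp add: aff_def)
  then obtain x where "x \<in> N" "aff a m x = (a + 1) mod n + 1" using s by auto
  then have "[a + m * x = a + Suc 0] (mod n)" by (simp add: aff_def cong_def)
  then have "[m * x = Suc 0] (mod n)" by (simp only: cong_add_lcancel_nat)
  then have cp: "coprime m n" using coprime_iff_invertible_nat by blast
  then have "m > 0" using n3 by (cases "m = 0") auto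
  then have "m \<in> totatives n" using cp n3 by (simp add: totatives_def m_def)
  then show ?thesis using that an s by blast
qed

lemma aff_bij: assumes m: "m \<in> totatives n" shows "bij_betw (aff a m) N N"
proof -
  have cp: "coprime m n" using m by (simp add: totatives_def)
  have "inj_on (aff a m) N"
  proof (rule inj_onI)
    fix x y assume xy: "x \<in> N" "y \<in> N" "aff a m x = aff a m y"
    then have "[a + m * x = a + m * y] (mod n)" by (simp add: aff_def cong_def)
    then have "[m * x = m * y] (mod n)" by (simp only: cong_add_lcancel_nat)
    then have "[x = y] (mod n)" using cp by (simp only: cong_mult_lcancel_nat)
    moreover have "z mod n = (if z = n then 0 else z)" if "z \<in> N" for z using that by auto
    ultimately show "x = y" using xy(1,2) by (auto simp: cong_def split: if_splits)
  qed
  moreover have "aff a m ` N \<subseteq> N" using aff_N by blast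
  ultimately show ?thesis by (simp add: bij_betw_def endo_inj_surj)
qed

lemma conj_by_aff_rot:
  assumes m: "m \<in> totatives n" shows "conj_by (aff a m) (rot N t) = rot N (m * t)"
proof (rule ext)
  fix z
  show "conj_by (aff a m) (rot N t) z = rot N (m * t) z"
  proof (cases "z \<in> N")
    case True
    then obtain x where x: "x \<in> N" "z = aff a m x" using aff_bij[OF m, of a] by (metis bij_betw_imp_surj_on imageE)
    have "[a + m * ((x - 1 + t) mod n + 1) = a + m * (x - 1 + t + 1)] (mod n)"
      by (intro cong_add cong_mult cong_refl) (simp add: cong_def mod_simps)
    also have "a + m * (x - 1 + t + 1) = a + m * x + m * t" using x by (simp add: algebra_simps)
    also have "[a + m * x + m * t = (a + m * x) mod n + m * t] (mod n)" by (simp add: cong_def mod_simps)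
    finally show ?thesis using x(2) conj_by_at[OF aff_bij[OF m] x(1), of a "rot N t"] rot_N[OF x(1)] rot_N[OF aff_N, of "m * t" a m x]
      by (simp add: aff_def cong_def)
  next
    case False
    then have "rot N (m * t) z = None" using dom_rot[of N "m * t"] by (metis domIff finite_atLeastAtMost)
    then show ?thesis using False by (simp only: conj_by_def if_False)
  qed
qed

section \<open>Dihedral and affine conjugations\<close>

lemma totative_less: "m \<in> totatives n \<Longrightarrow> m < n"
  using n3 totatives_less[of m n] by simp

lemma aff_inj:
  assumes "a < n" "a' < n" "m \<in> totatives n" "m' \<in> totatives n" "\<And>x. x \<in> N \<Longrightarrow> aff a m x = aff a' m' x"
  shows "a = a' \<and> m = m'"
proof -
  have a: "a = a'" using assms(5)[of n] assms(1,2) n3 by (simp add: aff_def)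
  have "[a + m = a + m'] (mod n)" using assms(5)[of 1] n3 a by (simp add: aff_def cong_def)
  then have "[m = m'] (mod n)" by (simp only: cong_add_lcancel_nat)
  then show ?thesis using a totative_less assms(3,4) by (simp add: cong_def)
qed

lemma conj_by_eq_shift:
  assumes b: "bij_betw \<sigma> N N" "bij_betw \<sigma>' N N" and s: "\<And>x. x \<in> N \<Longrightarrow> rot N s (\<sigma> x) = Some (\<sigma>' x)"
    and a: "\<alpha> \<in> PT"
  shows "conj_by \<sigma>' \<alpha> = rot N s \<circ>\<^sub>m (conj_by \<sigma> \<alpha> \<circ>\<^sub>m pinv (rot N s))"
proof (rule ext)
  fix z
  have ir: "inj_on (rot N s) (dom (rot N s))" by (rule inj_rot) simp
  show "conj_by \<sigma>' \<alpha> z = (rot N s \<circ>\<^sub>m (conj_by \<sigma> \<alpha> \<circ>\<^sub>m pinv (rot N s))) z"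
  proof (cases "z \<in> N")
    case True
    then obtain x where x: "x \<in> N" "z = \<sigma>' x" using b(2) by (metis bij_betw_imp_surj_on imageE)
    have "pinv (rot N s) z = Some (\<sigma> x)" using pinv_iff[OF ir] s[OF x(1)] x(2) by simp
    then show ?thesis
    proof (cases "\<alpha> x")
      case (Some y)
      then have "y \<in> N" using PT_D[OF a] by blast
      then show ?thesis using \<open>pinv (rot N s) z = Some (\<sigma> x)\<close> Some x conj_by_at[OF b(1) x(1), of \<alpha>] conj_by_at[OF b(2) x(1), of \<alpha>] s by simp
    qed (use x conj_by_at[OF b(1) x(1), of \<alpha>] conj_by_at[OF b(2) x(1), of \<alpha>] in simp)
  next
    case False
    have "dom (pinv (rot N s)) = N" using pinv_props(1)[OF ir] ran_rot[of N s] by simp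
    then have p: "pinv (rot N s) z = None" using False by (metis domIff)
    have "conj_by \<sigma>' \<alpha> z = None" using False by (simp only: conj_by_def if_False)
    then show ?thesis by (simp only: map_comp_simps(1) p)
  qed
qed

text \<open>Following \<sigma> by a rotation multiplies the conjugate by a rotation on one side and
  its inverse on the other. The translation part of an affine map can therefore be changed at
  will.\<close>

lemma conj_by_shift_C:
  assumes "bij_betw \<sigma> N N" "bij_betw \<sigma>' N N" "\<And>x. x \<in> N \<Longrightarrow> rot N s (\<sigma> x) = Some (\<sigma>' x)"
    and "\<alpha> \<in> PT" "conj_by \<sigma> \<alpha> \<in> C"
  shows "conj_by \<sigma>' \<alpha> \<in> C"
  using conj_by_eq_shift[of \<sigma> \<sigma>' s \<alpha>] assms C_comp rot_C pinv_C inj_rot by (metis finite_atLeastAtMost)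

lemma conj_by_id: "\<alpha> \<in> PT \<Longrightarrow> conj_by (\<lambda>x. x) \<alpha> = \<alpha>"
  by (rule pmap_eqI) (use conj_by_iff[of "\<lambda>x. x" \<alpha>] PT_D[of \<alpha>] in \<open>auto simp: bij_betw_def simp del: atLeastAtMost_iff\<close>)

lemma reflection_bij: "bij_betw (\<lambda>x. n + 1 - x) N N"
  by (rule bij_betw_byWitness[where f' = "\<lambda>x. n + 1 - x"]) auto

lemma conj_by_reflection_C:
  assumes a: "\<alpha> \<in> C" shows "conj_by (\<lambda>x. n + 1 - x) \<alpha> \<in> C"
proof -
  let ?\<rho> = "\<lambda>x. n + 1 - x"
  note b = reflection_bij
  note p = C_PT[OF a]
  note r = conj_by_range(1,2)[OF b p]
  obtain t where t: "cut_mono t \<alpha>" using orientation_preserving_iff_cut_mono C_D(3,4)[OF a] by blast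
  \<comment> \<open>Reversing both arguments and values keeps the order of a pair. For z = n + 1 -
    x, being below n + 2 - t means t \<le> x, which explains the new threshold.\<close>
  have "cut_mono (n + 2 - t) (conj_by ?\<rho> \<alpha>)"
    unfolding cut_mono_def
  proof (intro allI impI)
    fix z z' w w' assume h: "conj_by ?\<rho> \<alpha> z = Some w" "conj_by ?\<rho> \<alpha> z' = Some w'" "z < z'"
    obtain x y where x: "x \<in> N" "y \<in> N" "z = ?\<rho> x" "w = ?\<rho> y" "\<alpha> x = Some y" using conj_by_iff[OF b p] h(1) by blast
    obtain x' y' where x': "x' \<in> N" "y' \<in> N" "z' = ?\<rho> x'" "w' = ?\<rho> y'" "\<alpha> x' = Some y'" using conj_by_iff[OF b p] h(2) by blast
    have lt: "x' < x" using h(3) x x' by auto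
    have c: "z < n + 2 - t \<and> n + 2 - t \<le> z' \<longleftrightarrow> x' < t \<and> t \<le> x" using x x' by auto
    show "if z < n + 2 - t \<and> n + 2 - t \<le> z' then w' \<le> w else w \<le> w'"
      unfolding c using cut_monoD[OF t x'(5) x(5) lt] x(4) x'(4) by (cases "x' < t \<and> t \<le> x") auto
  qed
  then have "orientation_preserving (conj_by ?\<rho> \<alpha>)"
    using orientation_preserving_iff_cut_mono[of "conj_by ?\<rho> \<alpha>"] r(1) finite_subset by blast
  then show ?thesis using C_transfer[OF a r] conj_by_inj[OF b p] by blast
qed

lemma one_totative: "1 \<in> totatives n" and pred_totative: "n - 1 \<in> totatives n"
  using n3 coprime_diff_one_left_nat[of n] by (auto simp: totatives_def)

text \<open>\<open>aff k 1\<close> is the rotation by \<open>k + 1\<close>, and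
  \<open>aff k (n - 1)\<close> is the reflection followed by the rotation by
  \<open>k\<close>.\<close>

lemma dihedral_C:
  assumes a: "\<alpha> \<in> C" and m: "m = 1 \<or> m = n - 1" shows "conj_by (aff k m) \<alpha> \<in> C"
  using m
proof
  assume m: "m = 1"
  show ?thesis
  proof (rule conj_by_shift_C[of "\<lambda>x. x" _ "k + 1"])
    show "bij_betw (aff k m) N N" using aff_bij one_totative m by simp
    show "rot N (k + 1) x = Some (aff k m x)" if "x \<in> N" for x
      using that rot_N[OF that, of "k + 1"] by (simp add: aff_def m add.commute)
  qed (use a C_PT conj_by_id in \<open>auto simp: bij_betw_def\<close>)
next
  assume m: "m = n - 1"
  show ?thesis
  proof (rule conj_by_shift_C[of "\<lambda>x. n + 1 - x" _ k])
    show "bij_betw (aff k m) N N" using aff_bij pred_totative m by simp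
    show "rot N k (n + 1 - x) = Some (aff k m x)" if x: "x \<in> N" for x
    proof -
      have "n + 1 - x \<in> N" using x by auto
      moreover obtain y where y: "x = Suc y" using x by (cases x) auto
      moreover have "(n - 1) * x = (n - x) + n * y" using x y n3
        by (simp add: algebra_simps diff_mult_distrib)
      then have "(k + m * x) mod n = (n - x + k) mod n" unfolding m
        by (metis add.assoc add.commute mod_mult_self2)
      ultimately show ?thesis using rot_N[of "n + 1 - x" k] x by (simp add: aff_def)
    qed
  qed (use a C_PT reflection_bij conj_by_reflection_C in auto)
qed

text \<open>If \<open>1 < m < n - 1\<close>, a map fixing \<open>1\<close> and \<open>n\<close> and moving one further point is conjugated to a map
  with \<open>1, 2, m + 1\<close> sent to \<open>1, n, m + 1\<close>, which reverses orientation.\<close>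

lemma dihedral_only:
  assumes k: "k < n" and m: "m \<in> totatives n" and c: "\<And>\<alpha>. \<alpha> \<in> C \<Longrightarrow> conj_by (aff k m) \<alpha> \<in> C"
  shows "m = 1 \<or> m = n - 1"
proof (rule ccontr)
  assume "\<not> (m = 1 \<or> m = n - 1)"
  then have mm: "1 < m" "m < n - 1" using totative_less[OF m] m n3 by (auto simp: totatives_def)
  note b = aff_bij[OF m]
  have "2 \<in> N" "n \<in> N" using n3 by auto
  \<comment> \<open>The preimages of \<open>2\<close> and \<open>n\<close>: a map sending
    \<open>x\<close> to \<open>y\<close> has a conjugate sending \<open>2\<close> to
    \<open>n\<close>.\<close>
  then obtain x y where xy: "x \<in> N" "aff 0 m x = 2" "y \<in> N" "aff 0 m y = n"
    using bij_betw_imp_surj_on[OF b[of 0]] by (metis imageE)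
  have a1: "aff 0 m 1 = m + 1" and an: "aff 0 m n = 1" using mm by (auto simp: aff_def)
  have ne: "x \<noteq> 1" "x \<noteq> n" "y \<noteq> 1" "y \<noteq> n" using a1 an xy mm by auto
  define \<alpha> where "\<alpha> = (\<lambda>z. if z = 1 then Some 1 else if z = n then Some n else if z = x then Some y else None)"
  have aC: "\<alpha> \<in> C"
  proof (rule C_inj)
    show d: "dom \<alpha> \<subseteq> N" using xy n3 by (auto simp: \<alpha>_def split: if_splits)
    have al: "\<alpha> u = Some v \<longleftrightarrow> u = 1 \<and> v = 1 \<or> u = n \<and> v = n \<or> u = x \<and> v = y" for u v
      using ne n3 by (auto simp: \<alpha>_def)
    show "ran \<alpha> \<subseteq> N" using xy n3 unfolding ran_def al by auto
    show "inj_on \<alpha> (dom \<alpha>)" using ne n3 unfolding inj_pmap_iff al by auto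
    show "orientation_preserving \<alpha>"
    proof (rule orientation_preserving_mono)
      show "finite (dom \<alpha>)" using d finite_subset by blast
      fix u u' v v' assume "\<alpha> u = Some v" "\<alpha> u' = Some v'" "u < u'"
      then show "v \<le> v'" using xy ne unfolding al by auto
    qed
  qed
  have bC: "conj_by (aff 0 m) \<alpha> \<in> C"
  proof (rule conj_by_shift_C[OF b[of k] b[of 0], of "n - k"])
    fix x assume x: "x \<in> N"
    have "((k + m * x) mod n + (n - k)) mod n = (k + m * x + (n - k)) mod n" by (simp add: mod_simps)
    also have "k + m * x + (n - k) = m * x + n" using k by simp
    finally show "rot N (n - k) (aff k m x) = Some (aff 0 m x)"
      using rot_N[OF aff_N, of "n - k" k m x] by (simp add: aff_def)
  qed (use aC C_PT c in auto)
  obtain t where t: "cut_mono t (conj_by (aff 0 m) \<alpha>)"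
    using orientation_preserving_iff_cut_mono C_D(3,4)[OF bC] by blast
  have v: "conj_by (aff 0 m) \<alpha> 1 = Some 1" "conj_by (aff 0 m) \<alpha> 2 = Some n" "conj_by (aff 0 m) \<alpha> (m + 1) = Some (m + 1)"
    using conj_by_at[OF b, of n 0 \<alpha>] conj_by_at[OF b, of x 0 \<alpha>] conj_by_at[OF b, of 1 0 \<alpha>] xy a1 an ne n3
    by (simp_all add: \<alpha>_def)
  \<comment> \<open>The strict descent from \<open>n\<close> to \<open>m + 1\<close> places the cut
    between the arguments \<open>2\<close> and \<open>m + 1\<close>. The cut then also separates
    \<open>1\<close> from \<open>m + 1\<close>, whose values increase.\<close>
  have "2 < t \<and> t \<le> m + 1" using cut_monoD(2)[OF t v(2,3)] mm by fastforce
  then show False using cut_monoD(1)[OF t v(1,3)] mm by simp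
qed

section \<open>The action on complements of points\<close>

lemma img_comp: "img (\<beta> \<circ>\<^sub>m \<alpha>) S = img \<beta> (img \<alpha> S)"
  unfolding img_def map_comp_Some_iff by blast

lemma img_subset: "\<alpha> \<in> PT \<Longrightarrow> img \<alpha> S \<subseteq> N"
  using PT_subset(2)[of \<alpha>] by (auto simp: img_def ran_def)

lemma subset_card_pred:
  assumes "S \<subseteq> N" "card S = n - 1" obtains y where "y \<in> N" "S = N - {y}"
proof -
  have "card (N - S) = 1" using assms n3 finite_subset[OF assms(1)] by (simp add: card_Diff_subset)
  then obtain y where "N - S = {y}" by (rule card_1_singletonE)
  then show ?thesis using that[of y] assms(1) by blast
qed

text \<open>Images do not grow, so if the final image has n - 1 points, the intermediate one has n -
  1 points too and is again the complement of a point.\<close>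

lemma compl_map_comp:
  assumes a: "\<alpha> \<in> PT"
  shows "compl_map (\<beta> \<circ>\<^sub>m \<alpha>) = compl_map \<beta> \<circ>\<^sub>m compl_map \<alpha>"
proof (rule pmap_eqI)
  fix x z
  show "compl_map (\<beta> \<circ>\<^sub>m \<alpha>) x = Some z \<longleftrightarrow> (compl_map \<beta> \<circ>\<^sub>m compl_map \<alpha>) x = Some z"
  proof
    assume h: "compl_map (\<beta> \<circ>\<^sub>m \<alpha>) x = Some z"
    then have x: "x \<in> N" "z \<in> N" and e: "img \<beta> (img \<alpha> (N - {x})) = N - {z}" by (auto simp: compl_map_iff img_comp)
    have "n - 1 = card (N - {z})" using x by simp
    also have "\<dots> \<le> card (img \<alpha> (N - {x}))" unfolding e[symmetric]
      using card_img_le[of "img \<alpha> (N - {x})" \<beta>] card_img_le[of "N - {x}" \<alpha>] by simp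
    finally have "card (img \<alpha> (N - {x})) = n - 1" using card_img_le[of "N - {x}" \<alpha>] x by simp
    then obtain y where y: "y \<in> N" "img \<alpha> (N - {x}) = N - {y}" using subset_card_pred[OF img_subset[OF a]] by metis
    have "compl_map \<alpha> x = Some y" unfolding compl_map_iff using x y by blast
    moreover have "compl_map \<beta> y = Some z" unfolding compl_map_iff using x y e by simp
    ultimately show "(compl_map \<beta> \<circ>\<^sub>m compl_map \<alpha>) x = Some z" by simp
  next
    assume "(compl_map \<beta> \<circ>\<^sub>m compl_map \<alpha>) x = Some z"
    then obtain y where "compl_map \<alpha> x = Some y" "compl_map \<beta> y = Some z" by (auto simp: map_comp_Some_iff)
    then show "compl_map (\<beta> \<circ>\<^sub>m \<alpha>) x = Some z" unfolding compl_map_iff img_comp by simp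
  qed
qed

lemma compl_map_rot: "compl_map (rot N t) = rot N t"
proof (rule pmap_eqI)
  fix x y
  have fwd: "compl_map (rot N t) x = Some y" if h: "rot N t x = Some y" for x y
  proof -
    have xy: "x \<in> N" "y \<in> N" using rot_in[OF _ h] by auto
    have "img (rot N t) (N - {x}) = N - {y}"
    proof (rule Set.set_eqI)
      fix w
      have "w \<in> N \<longleftrightarrow> (\<exists>v. rot N t v = Some w)" using ran_rot[of N t] unfolding ran_def by blast
      moreover have "v \<in> N" if "rot N t v = Some w" for v using rot_in[OF _ that] by auto
      moreover have "v = x \<longleftrightarrow> w = y" if "rot N t v = Some w" for v
        using inj_rot[of N t] that h unfolding inj_pmap_iff by auto
      ultimately show "w \<in> img (rot N t) (N - {x}) \<longleftrightarrow> w \<in> N - {y}" unfolding img_def by blast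
    qed
    then show ?thesis using xy by (simp add: compl_map_iff)
  qed
  show "compl_map (rot N t) x = Some y \<longleftrightarrow> rot N t x = Some y"
  proof
    assume h: "compl_map (rot N t) x = Some y"
    then have "x \<in> dom (rot N t)" using dom_rot[of N t] compl_map_iff by simp
    then obtain y' where "rot N t x = Some y'" by blast
    then show "rot N t x = Some y" using fwd[of x y'] h by simp
  qed (rule fwd)
qed

lemma rk_n:
  assumes a: "\<alpha> \<in> C" and "rk \<alpha> = n" obtains t where "t < n" "\<alpha> = rot N t"
proof -
  have r: "ran \<alpha> = N" using C_D(2)[OF a] assms(2) by (intro card_subset_eq) (auto simp: rk_def)
  have "n \<le> card (dom \<alpha>)" using finite_ran_card_le(2)[OF C_D(4)[OF a]] assms(2) by (simp add: rk_def)
  then have d: "dom \<alpha> = N" using C_D(1)[OF a] by (intro card_seteq) auto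
  obtain t where "\<alpha> = rot N t" by (rule orientation_preserving_perm_is_rot[OF _ d r C_D(3)[OF a]]) simp
  then have "\<alpha> = rot N (t mod n)" using rot_mod_card[of N t] by simp
  then show ?thesis using that[of "t mod n"] n3 by simp
qed

lemma rk_rot: "rk (rot N t) = n"
  by (simp add: rk_def ran_rot)

text \<open>Two values would put the complements of two distinct points inside the range of
  \<alpha>, making it all of \<open>N\<close>. This frees the multiplier \<open>m\<close>: a map
  with at most one value preserves orientation however it is conjugated.\<close>

lemma compl_map_rank:
  assumes a: "\<alpha> \<in> C" and "rk \<alpha> < n" shows "card (ran (compl_map \<alpha>)) \<le> 1"
proof -
  have "y = y'" if h: "y \<in> ran (compl_map \<alpha>)" "y' \<in> ran (compl_map \<alpha>)" for y y'
  proof (rule ccontr)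
    assume ne: "y \<noteq> y'"
    have sub: "N - {y} \<subseteq> ran \<alpha>" if y: "y \<in> ran (compl_map \<alpha>)" for y
    proof -
      obtain x where "compl_map \<alpha> x = Some y" using y unfolding ran_def by blast
      then have "img \<alpha> (N - {x}) = N - {y}" by (simp add: compl_map_iff)
      then show ?thesis unfolding img_def ran_def by blast
    qed
    have "N \<subseteq> ran \<alpha>" using sub[OF h(1)] sub[OF h(2)] ne by blast
    then have "card N \<le> rk \<alpha>" using card_mono[OF C_D(5)[OF a]] unfolding rk_def by blast
    then show False using assms(2) by simp
  qed
  moreover have "finite (ran (compl_map \<alpha>))" using PT_subset(2)[OF compl_map_PT] finite_subset by blast
  ultimately show ?thesis by (simp add: card_le_Suc0_iff_eq)
qed

text \<open>Keeps the affine family inside the injective monoid. If \<alpha> is undefined at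
  \<open>x'\<close>, the image of \<open>N - {x}\<close> comes from only n - 2 points; otherwise the
  value at \<open>x'\<close> would be attained a second time.\<close>

lemma compl_map_inj:
  assumes i: "inj_on \<alpha> (dom \<alpha>)" shows "inj_on (compl_map \<alpha>) (dom (compl_map \<alpha>))"
  unfolding inj_pmap_iff
proof (intro allI impI, rule ccontr)
  fix x x' y assume h: "compl_map \<alpha> x = Some y" "compl_map \<alpha> x' = Some y" and ne: "x \<noteq> x'"
  have e: "img \<alpha> (N - {x}) = N - {y}" "img \<alpha> (N - {x'}) = N - {y}" and xy: "x \<in> N" "x' \<in> N" "y \<in> N"
    using h by (simp_all add: compl_map_iff)
  show False
  proof (cases "\<alpha> x'")
    case None
    then have "img \<alpha> (N - {x}) = img \<alpha> (N - {x} - {x'})" unfolding img_def by force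
    then have "card (N - {y}) \<le> card (N - {x} - {x'})" using e(1) card_img_le[of "N - {x} - {x'}" \<alpha>] by simp
    then show False using xy ne n3 by simp
  next
    case (Some w)
    then have "w \<in> img \<alpha> (N - {x})" using xy ne unfolding img_def by blast
    then have "w \<in> img \<alpha> (N - {x'})" using e by simp
    then obtain v where "v \<noteq> x'" "\<alpha> v = Some w" unfolding img_def by blast
    then show False using i Some unfolding inj_pmap_iff by blast
  qed
qed

lemma conj_by_compl_map_C:
  assumes a: "\<alpha> \<in> C" and m: "m \<in> totatives n" shows "conj_by (aff k m) (compl_map \<alpha>) \<in> C"
proof (cases "rk \<alpha> = n")
  case True
  then obtain t where "\<alpha> = rot N t" using rk_n[OF a] by metis
  then show ?thesis using conj_by_aff_rot[OF m] compl_map_rot rot_C by simp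
next
  case False
  then have "rk \<alpha> < n" using rk_le[OF a] by simp
  note b = aff_bij[OF m, of k]
  note r = conj_by_range[OF b compl_map_PT[of \<alpha>]]
  have f: "finite (ran (compl_map \<alpha>))" using PT_subset(2)[OF compl_map_PT] finite_subset by blast
  have fd: "finite (dom (conj_by (aff k m) (compl_map \<alpha>)))" using r(1) finite_subset by blast
  have "card (ran (conj_by (aff k m) (compl_map \<alpha>))) \<le> 1"
    unfolding r(4) using card_image_le[OF f, of "aff k m"] compl_map_rank[OF a \<open>rk \<alpha> < n\<close>] by simp
  then have "orientation_preserving (conj_by (aff k m) (compl_map \<alpha>))"
    using orientation_preserving_card_ran_le_1 fd by blast
  then show ?thesis using C_transfer[OF a r(1,2)] conj_by_inj[OF b compl_map_PT] compl_map_inj by blast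
qed

end

section \<open>The three families of endomorphisms\<close>

text \<open>\<open>pw \<alpha> 0\<close> is the identity on all natural numbers and lies outside the
  monoid, so membership and images under endomorphisms are stated for exponents of the form
  \<open>Suc k\<close>.\<close>

fun pw :: "pmap \<Rightarrow> nat \<Rightarrow> pmap" where
  "pw \<alpha> 0 = Some"
| "pw \<alpha> (Suc k) = \<alpha> \<circ>\<^sub>m pw \<alpha> k"

lemma map_comp_Some [simp]: "f \<circ>\<^sub>m Some = f" "Some \<circ>\<^sub>m f = f"
  by (auto simp: map_comp_def split: option.splits)

lemma pw_add: "pw \<alpha> (j + k) = pw \<alpha> j \<circ>\<^sub>m pw \<alpha> k"
  by (induction j) (simp_all add: map_comp_assoc)

lemma pw_one: "pw \<alpha> (Suc 0) = \<alpha>"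
  by simp

lemma pw_rot: "finite A \<Longrightarrow> pw (rot A s) (Suc k) = rot A (s * Suc k)"
proof (induction k)
  case (Suc k)
  then show ?case by (subst pw.simps(2)) (simp add: rot_map_comp algebra_simps)
qed simp

lemma pw_period:
  assumes "pw u (Suc n) = u" shows "pw u (Suc k + n) = pw u (Suc k)"
proof -
  have "pw u (Suc k + n) = pw u k \<circ>\<^sub>m pw u (Suc n)" unfolding pw_add[symmetric] by simp
  also have "\<dots> = pw u (k + Suc 0)" unfolding pw_add assms pw_one ..
  finally show ?thesis by simp
qed

lemma pw_period_mod:
  assumes u: "pw u (Suc n) = u" shows "pw u (Suc k + j * n) = pw u (Suc k)"
proof (induction j)
  case (Suc j)
  have "pw u (Suc k + Suc j * n) = pw u (Suc (k + j * n) + n)" by (simp add: algebra_simps)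
  also have "\<dots> = pw u (Suc k + j * n)" unfolding pw_period[OF u] by simp
  finally show ?case using Suc by simp
qed simp

context orientation_monoid
begin

definition endo_dihedral :: "nat \<times> nat \<Rightarrow> pmap \<Rightarrow> pmap" where
  "endo_dihedral = (\<lambda>(a, m). \<lambda>\<alpha>\<in>C. conj_by (aff a m) \<alpha>)"

definition endo_affine :: "nat \<times> nat \<Rightarrow> pmap \<Rightarrow> pmap" where
  "endo_affine = (\<lambda>(a, m). \<lambda>\<alpha>\<in>C. conj_by (aff a m) (compl_map \<alpha>))"

definition endo_collapsing :: "(pmap \<Rightarrow> pmap) set" where
  "endo_collapsing = {\<phi> \<in> endos. \<forall>\<alpha>\<in>C. rk \<alpha> < n \<longrightarrow> \<phi> \<alpha> = \<phi> Map.empty}"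

lemma endo_dihedral_in_endos:
  assumes "m = 1 \<or> m = n - 1" shows "endo_dihedral (a, m) \<in> endos"
proof -
  have "bij_betw (aff a m) N N" using assms aff_bij one_totative pred_totative by blast
  then show ?thesis using dihedral_C[OF _ assms] C_comp conj_by_comp[OF _ C_PT C_PT]
    by (auto simp: endos_def endo_dihedral_def)
qed

lemma endo_affine_in_endos:
  assumes "m \<in> totatives n" shows "endo_affine (a, m) \<in> endos"
  using conj_by_compl_map_C[OF _ assms] C_comp conj_by_comp[OF aff_bij[OF assms] compl_map_PT compl_map_PT] compl_map_comp[OF C_PT]
  by (auto simp: endos_def endo_affine_def)

lemma conj_by_cong:
  assumes b: "bij_betw \<sigma> N N" "bij_betw \<tau> N N" and e: "\<And>x. x \<in> N \<Longrightarrow> \<sigma> x = \<tau> x" and p: "\<alpha> \<in> PT"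
  shows "conj_by \<sigma> \<alpha> = conj_by \<tau> \<alpha>"
proof (rule pmap_eqI)
  fix z w show "conj_by \<sigma> \<alpha> z = Some w \<longleftrightarrow> conj_by \<tau> \<alpha> z = Some w"
    unfolding conj_by_iff[OF b(1) p] conj_by_iff[OF b(2) p] using e by (metis (no_types, lifting))
qed

lemma endos_cases:
  assumes ph: "\<phi> \<in> endos"
  shows "\<phi> \<in> endo_dihedral ` ({..<n} \<times> {1, n - 1}) \<union> endo_affine ` ({..<n} \<times> totatives n) \<union> endo_collapsing"
proof (cases "\<forall>\<alpha>\<in>C. rk \<alpha> < n \<longrightarrow> \<phi> \<alpha> = \<phi> Map.empty")
  case True
  then show ?thesis using ph by (simp add: endo_collapsing_def)
next
  case False
  define P where "P = (\<lambda>r. \<exists>\<alpha>\<in>C. rk \<alpha> = r \<and> \<phi> \<alpha> \<noteq> \<phi> Map.empty)"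
  define r where "r = (LEAST r. P r)"
  obtain \<beta> where be: "\<beta> \<in> C" "rk \<beta> < n" "\<phi> \<beta> \<noteq> \<phi> Map.empty" using False by blast
  then have "P (rk \<beta>)" unfolding P_def by blast
  then have Pr: "P r" and "r \<le> rk \<beta>" unfolding r_def by (auto intro: LeastI Least_le)
  then have rn: "r < n" using be by simp
  have "\<not> P k" if "k < r" for k using not_less_Least[of k P] that unfolding r_def by blast
  then have const: "\<forall>\<alpha>\<in>C. rk \<alpha> < r \<longrightarrow> \<phi> \<alpha> = \<phi> Map.empty" unfolding P_def by blast
  obtain \<alpha>\<^sub>0 where a0: "\<alpha>\<^sub>0 \<in> C" "rk \<alpha>\<^sub>0 = r" "\<phi> \<alpha>\<^sub>0 \<noteq> \<phi> Map.empty" using Pr unfolding P_def by blast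
  obtain \<sigma> where s: "bij_betw \<sigma> N N" "r = 1 \<or> r = n - 1" "\<And>\<alpha>. \<alpha> \<in> C \<Longrightarrow> \<phi> \<alpha> = conj_by \<sigma> (core_map r \<alpha>)"
    using endo_form[OF ph rn const a0] by blast
  \<comment> \<open>\<open>core_map r\<close> fixes rotations for both values of \<open>r\<close>,
    so the conjugate of the generator lies in the monoid and \<sigma> is affine in either
    case.\<close>
  have "conj_by \<sigma> (rot N 1) = \<phi> (rot N 1)" using s(3)[OF rot_C] compl_map_rot by (simp add: core_map_def)
  then have "conj_by \<sigma> (rot N 1) \<in> C" using endosD(1)[OF ph rot_C] by simp
  then obtain a m where am: "a < n" "m \<in> totatives n" "\<And>x. x \<in> N \<Longrightarrow> \<sigma> x = aff a m x"
    using aff_of_conj_rot[OF s(1)] by blast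
  have form: "\<phi> \<alpha> = conj_by (aff a m) (core_map r \<alpha>)" if "\<alpha> \<in> C" for \<alpha>
    using s(3)[OF that] conj_by_cong[OF s(1) aff_bij[OF am(2)] am(3) core_map_PT[OF that]] by simp
  have undef: "\<phi> \<alpha> = undefined" if "\<alpha> \<notin> C" for \<alpha> using ph that by (auto simp: endos_def extensional_def)
  show ?thesis
  proof (cases "r = 1")
    case True
    have f: "\<phi> \<alpha> = conj_by (aff a m) \<alpha>" if "\<alpha> \<in> C" for \<alpha> using form[OF that] True by (simp add: core_map_def)
    have "conj_by (aff a m) \<alpha> \<in> C" if "\<alpha> \<in> C" for \<alpha> using f[OF that] endosD(1)[OF ph that] by simp
    then have m: "m = 1 \<or> m = n - 1" by (rule dihedral_only[OF am(1,2)])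
    have "\<phi> = endo_dihedral (a, m)" by (rule ext) (use f undef in \<open>auto simp: endo_dihedral_def\<close>)
    then show ?thesis using am(1) m by blast
  next
    case False
    have f: "\<phi> \<alpha> = conj_by (aff a m) (compl_map \<alpha>)" if "\<alpha> \<in> C" for \<alpha> using form[OF that] False by (simp add: core_map_def)
    have "\<phi> = endo_affine (a, m)" by (rule ext) (use f undef in \<open>auto simp: endo_affine_def\<close>)
    then show ?thesis using am(1,2) by blast
  qed
qed

section \<open>Values on partial identities, which tell the families and their parameters
  apart\<close>

lemma conj_by_idp:
  assumes b: "bij_betw \<sigma> N N" and A: "A \<subseteq> N" shows "conj_by \<sigma> (idp A) = idp (\<sigma> ` A)"
proof (rule pmap_eqI)
  fix z w show "conj_by \<sigma> (idp A) z = Some w \<longleftrightarrow> idp (\<sigma> ` A) z = Some w"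
    unfolding conj_by_iff[OF b C_PT[OF idp_C[OF A]]] idp_simps(1)
  proof
    assume "\<exists>x\<in>N. \<exists>y\<in>N. z = \<sigma> x \<and> w = \<sigma> y \<and> x \<in> A \<and> y = x"
    then show "z \<in> \<sigma> ` A \<and> w = z" by blast
  next
    assume "z \<in> \<sigma> ` A \<and> w = z"
    then obtain x where x: "x \<in> A" "z = \<sigma> x" "w = \<sigma> x" by blast
    then have "x \<in> N" using A by blast
    then show "\<exists>x\<in>N. \<exists>y\<in>N. z = \<sigma> x \<and> w = \<sigma> y \<and> x \<in> A \<and> y = x" using x by blast
  qed
qed

lemma compl_map_idp: assumes x: "x \<in> N" shows "compl_map (idp (N - {x})) = idp {x}" "compl_map (idp {x}) = Map.empty"
proof -
  have i: "img (idp A) S = A \<inter> S" for A S by (auto simp: img_def)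
  show "compl_map (idp (N - {x})) = idp {x}"
  proof (rule pmap_eqI)
    fix u v
    have "(N - {x}) \<inter> (N - {u}) = N - {v} \<longleftrightarrow> u = x \<and> v = x" if "u \<in> N" "v \<in> N"
      using that x by (intro iffI; blast)
    then show "compl_map (idp (N - {x})) u = Some v \<longleftrightarrow> idp {x} u = Some v"
      unfolding compl_map_iff i idp_simps(1) singleton_iff using x by metis
  qed
  show "compl_map (idp {x}) = Map.empty"
  proof (rule pmap_eqI)
    fix u v
    have "{x} \<inter> (N - {u}) \<noteq> N - {v}" if "v \<in> N"
    proof
      assume "{x} \<inter> (N - {u}) = N - {v}"
      then have "card (N - {v}) \<le> card {x}" by (metis card_mono finite.emptyI finite_insert inf_le1)
      then show False using that n3 by simp
    qed
    then show "compl_map (idp {x}) u = Some v \<longleftrightarrow> None = Some v" unfolding compl_map_iff i by blast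
  qed
qed

lemma endo_dihedral_idp:
  "m = 1 \<or> m = n - 1 \<Longrightarrow> x \<in> N \<Longrightarrow> endo_dihedral (a, m) (idp {x}) = idp {aff a m x}"
  using conj_by_idp[of "aff a m" "{x}"] aff_bij one_totative pred_totative idp_C[of "{x}"]
  by (auto simp: endo_dihedral_def)

lemma endo_affine_idp:
  "m \<in> totatives n \<Longrightarrow> x \<in> N \<Longrightarrow> endo_affine (a, m) (idp (N - {x})) = idp {aff a m x}"
  "x \<in> N \<Longrightarrow> endo_affine (a, m) (idp {x}) = Map.empty"
proof -
  assume m: "m \<in> totatives n" and x: "x \<in> N"
  have "endo_affine (a, m) (idp (N - {x})) = conj_by (aff a m) (idp {x})"
    using idp_C[of "N - {x}"] compl_map_idp(1)[OF x] unfolding endo_affine_def by simp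
  also have "\<dots> = idp {aff a m x}" using conj_by_idp[OF aff_bij[OF m], of "{x}" a] x by simp
  finally show "endo_affine (a, m) (idp (N - {x})) = idp {aff a m x}" .
next
  assume x: "x \<in> N"
  have "endo_affine (a, m) (idp {x}) = conj_by (aff a m) Map.empty"
    using idp_C[of "{x}"] x compl_map_idp(2)[OF x] unfolding endo_affine_def by simp
  also have "\<dots> = Map.empty" by (simp add: conj_by_def fun_eq_iff)
  finally show "endo_affine (a, m) (idp {x}) = Map.empty" .
qed

lemma idp_eq_iff: "idp A = idp B \<longleftrightarrow> A = B"
  by (metis idp_simps(2))

lemma idp_empty: "idp {} = Map.empty"
  by (simp add: idp_def)

lemma card_endo_dihedral: "card (endo_dihedral ` ({..<n} \<times> {1, n - 1})) = 2 * n"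
proof -
  have "inj_on endo_dihedral ({..<n} \<times> {1, n - 1})"
  proof (rule inj_onI)
    fix p p' assume pp: "p \<in> {..<n} \<times> {1, n - 1}" "p' \<in> {..<n} \<times> {1, n - 1}" "endo_dihedral p = endo_dihedral p'"
    obtain a m a' m' where p: "p = (a, m)" "p' = (a', m')" by (cases p, cases p')
    have h: "a < n" "a' < n" "m \<in> {1, n - 1}" "m' \<in> {1, n - 1}"
      and e: "endo_dihedral (a, m) = endo_dihedral (a', m')" using pp unfolding p by simp_all
    have "aff a m x = aff a' m' x" if "x \<in> N" for x
      using endo_dihedral_idp[OF _ that, of m a] endo_dihedral_idp[OF _ that, of m' a'] h e by (auto simp: idp_eq_iff)
    moreover have "m \<in> totatives n" "m' \<in> totatives n" using h one_totative pred_totative by blast+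
    ultimately show "p = p'" using aff_inj[of a a' m m'] h(1,2) p by blast
  qed
  then show ?thesis using n3 by (simp add: card_image card_cartesian_product)
qed

lemma card_endo_affine: "card (endo_affine ` ({..<n} \<times> totatives n)) = n * totient n"
proof -
  have "inj_on endo_affine ({..<n} \<times> totatives n)"
  proof (rule inj_onI)
    fix p p' assume pp: "p \<in> {..<n} \<times> totatives n" "p' \<in> {..<n} \<times> totatives n" "endo_affine p = endo_affine p'"
    obtain a m a' m' where p: "p = (a, m)" "p' = (a', m')" by (cases p, cases p')
    have h: "a < n" "a' < n" "m \<in> totatives n" "m' \<in> totatives n"
      and e: "endo_affine (a, m) = endo_affine (a', m')" using pp unfolding p by simp_all
    have "aff a m x = aff a' m' x" if "x \<in> N" for x
      using endo_affine_idp(1)[OF h(3) that, of a] endo_affine_idp(1)[OF h(4) that, of a'] e by (auto simp: idp_eq_iff)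
    then show "p = p'" using aff_inj[of a a' m m'] h p by blast
  qed
  then show ?thesis by (simp add: card_image card_cartesian_product totient_def)
qed

text \<open>The possible pairs of values at \<open>rot N 1\<close> and at \<open>Map.empty\<close>.
  The conditions transcribe the relations of the generating rotation and the zero.\<close>

definition collapse_data :: "(pmap \<times> pmap) set" where
  "collapse_data = {(u, f). u \<in> C \<and> f \<in> C \<and> pw u (Suc n) = u \<and> f \<circ>\<^sub>m f = f \<and> f \<circ>\<^sub>m u = f \<and> u \<circ>\<^sub>m f = f}"

lemma pw_C: "\<alpha> \<in> C \<Longrightarrow> pw \<alpha> (Suc k) \<in> C"
  by (induction k) (auto intro: C_comp simp del: pw.simps(2) simp: pw.simps(2)[of _ "Suc _"] pw_one)

lemma endo_pw: "\<phi> \<in> endos \<Longrightarrow> \<alpha> \<in> C \<Longrightarrow> \<phi> (pw \<alpha> (Suc k)) = pw (\<phi> \<alpha>) (Suc k)"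
proof (induction k)
  case (Suc k)
  then show ?case using endosD(2)[OF Suc.prems(1) pw_C[OF Suc.prems(2)] Suc.prems(2)] by simp
qed simp

lemma pw_rot_1: "pw (rot N 1) (Suc k) = rot N (Suc k)"
  by (subst pw_rot) simp_all

lemma rot_add_n: "rot N (k + n) = rot N k"
  using rot_mod_card[of N "k + n"] rot_mod_card[of N k] by simp

definition rot_index :: "pmap \<Rightarrow> nat" where
  "rot_index \<alpha> = (THE t. t < n \<and> \<alpha> = rot N t)"

lemma rot_index_rot: "t < n \<Longrightarrow> rot_index (rot N t) = t"
  unfolding rot_index_def using rot_eq_iff[of N] by (intro the_equality) auto

text \<open>The exponent is shifted by \<open>n\<close> because \<open>pw u 0\<close> is the identity, whereas the unit must go to \<open>pw u n\<close>.\<close>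

definition collapse :: "pmap \<times> pmap \<Rightarrow> pmap \<Rightarrow> pmap" where
  "collapse = (\<lambda>(u, f). \<lambda>\<alpha>\<in>C. if rk \<alpha> = n then pw u (rot_index \<alpha> + n) else f)"

text \<open>Allows any exponent in place of the reduced index, so that products of rotations need no
  reduction modulo \<open>n\<close>; positive powers of \<open>u\<close> have period
  \<open>n\<close>.\<close>

lemma collapse_rot:
  assumes "pw u (Suc n) = u" shows "collapse (u, f) (rot N t) = pw u (t + n)"
proof -
  have "rot N t = rot N (t mod n)" using rot_mod_card[of N t] by simp
  then have "rot_index (rot N t) = t mod n" using rot_index_rot[of "t mod n"] n3 by simp
  then have "collapse (u, f) (rot N t) = pw u (t mod n + n)" using rot_C rk_rot by (simp add: collapse_def)
  also have "\<dots> = pw u (Suc (t mod n + n - 1) + t div n * n)"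
    using pw_period_mod[OF assms, of "t mod n + n - 1" "t div n"] n3 by simp
  also have "Suc (t mod n + n - 1) + t div n * n = t + n" using n3 by simp
  finally show ?thesis .
qed

lemma collapse_small: "\<alpha> \<in> C \<Longrightarrow> rk \<alpha> < n \<Longrightarrow> collapse (u, f) \<alpha> = f"
  by (simp add: collapse_def)

lemma pw_absorb:
  assumes "f \<circ>\<^sub>m u = f" "u \<circ>\<^sub>m f = f" shows "f \<circ>\<^sub>m pw u k = f" "pw u k \<circ>\<^sub>m f = f"
proof -
  have c: "pw u k \<circ>\<^sub>m u = u \<circ>\<^sub>m pw u k" for k by (induction k) (simp_all add: map_comp_assoc)
  show "f \<circ>\<^sub>m pw u k = f" by (induction k) (simp_all flip: map_comp_assoc add: assms)
  show "pw u k \<circ>\<^sub>m f = f" by (induction k) (simp_all add: map_comp_assoc assms)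
qed

lemma collapse_in: assumes uf: "(u, f) \<in> collapse_data" shows "collapse (u, f) \<in> endo_collapsing"
proof -
  have u: "u \<in> C" "pw u (Suc n) = u" and f: "f \<in> C" "f \<circ>\<^sub>m f = f" "f \<circ>\<^sub>m u = f" "u \<circ>\<^sub>m f = f"
    using uf by (auto simp: collapse_data_def)
  let ?c = "collapse (u, f)"
  have cases: "(\<exists>t. \<alpha> = rot N t) \<or> rk \<alpha> < n" if "\<alpha> \<in> C" for \<alpha> using rk_n[OF that] rk_le[OF that] by (metis le_neq_implies_less)
  have mem: "?c \<alpha> \<in> C" if "\<alpha> \<in> C" for \<alpha>
    using cases[OF that]
  proof
    assume "\<exists>t. \<alpha> = rot N t"
    then obtain t where "?c \<alpha> = pw u (Suc (t + n - 1))" using collapse_rot[OF u(2), of f] n3 by force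
    then show ?thesis using pw_C[OF u(1)] by simp
  qed (use collapse_small[OF that] f in simp)
  have hom: "?c (\<beta> \<circ>\<^sub>m \<alpha>) = ?c \<beta> \<circ>\<^sub>m ?c \<alpha>" if ab: "\<alpha> \<in> C" "\<beta> \<in> C" for \<alpha> \<beta>
  proof (cases "rk \<alpha> < n \<or> rk \<beta> < n")
    case True
    then have "rk (\<beta> \<circ>\<^sub>m \<alpha>) < n" using rk_comp_le[OF ab] by linarith
    then have l: "?c (\<beta> \<circ>\<^sub>m \<alpha>) = f" using collapse_small C_comp[OF ab] by blast
    have "?c \<alpha> = f \<and> (?c \<beta> = f \<or> (\<exists>k. ?c \<beta> = pw u k)) \<or> ?c \<beta> = f \<and> (\<exists>k. ?c \<alpha> = pw u k)"
      using True cases[OF ab(1)] cases[OF ab(2)] collapse_small[OF ab(1)] collapse_small[OF ab(2)] collapse_rot[OF u(2), of f] by metis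
    then show ?thesis unfolding l using f(2) pw_absorb[OF f(3,4)] by metis
  next
    case False
    then obtain s t where st: "\<alpha> = rot N s" "\<beta> = rot N t" using cases ab by blast
    have "?c (\<beta> \<circ>\<^sub>m \<alpha>) = pw u (s + t + n)" unfolding st rot_map_comp[OF finite_atLeastAtMost] by (rule collapse_rot[OF u(2)])
    also have "\<dots> = pw u (Suc (s + t + n - 1) + n)" using pw_period[OF u(2), of "s + t + n - 1"] n3 by simp
    also have "Suc (s + t + n - 1) + n = (t + n) + (s + n)" using n3 by simp
    also have "pw u \<dots> = ?c \<beta> \<circ>\<^sub>m ?c \<alpha>" unfolding st collapse_rot[OF u(2)] by (rule pw_add)
    finally show ?thesis .
  qed
  have "?c \<in> extensional C" by (simp add: collapse_def)
  then have "?c \<in> endos" using mem hom by (simp add: endos_def)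
  moreover have "?c Map.empty = f" using collapse_small[OF empty_C] n3 by (simp add: rk_def)
  ultimately show ?thesis using collapse_small by (simp add: endo_collapsing_def)
qed

text \<open>Elements of rank \<open>n\<close> are powers of \<open>rot N 1\<close>, and all others
  share the value at \<open>Map.empty\<close>, so these two values determine a collapsing
  endomorphism.\<close>

lemma endo_collapsing_bij: "bij_betw collapse collapse_data endo_collapsing"
proof -
  show ?thesis
  proof (rule bij_betw_byWitness[where f' = "\<lambda>\<phi>. (\<phi> (rot N 1), \<phi> Map.empty)"])
    show "collapse ` collapse_data \<subseteq> endo_collapsing" using collapse_in by (auto simp: image_subset_iff)
    show "\<forall>p\<in>collapse_data. (collapse p (rot N 1), collapse p Map.empty) = p"
    proof
      fix p assume p: "p \<in> collapse_data"
      obtain u f where uf: "p = (u, f)" by (cases p)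
      have u: "pw u (Suc n) = u" using p uf by (auto simp: collapse_data_def)
      have "collapse p (rot N 1) = u" unfolding uf collapse_rot[OF u] using u by (simp del: pw.simps)
      moreover have "collapse p Map.empty = f" unfolding uf using collapse_small[OF empty_C] n3 by (simp add: rk_def)
      ultimately show "(collapse p (rot N 1), collapse p Map.empty) = p" using uf by simp
    qed
    have mem: "(\<phi> (rot N 1), \<phi> Map.empty) \<in> collapse_data" if "\<phi> \<in> endo_collapsing" for \<phi>
    proof -
      have ph: "\<phi> \<in> endos" using that by (simp add: endo_collapsing_def)
      have "pw (\<phi> (rot N 1)) (Suc n) = \<phi> (rot N (Suc n))" using endo_pw[OF ph rot_C, of 1 n] pw_rot_1 by simp
      also have "rot N (Suc n) = rot N 1" using rot_add_n[of 1] by simp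
      finally have "pw (\<phi> (rot N 1)) (Suc n) = \<phi> (rot N 1)" .
      then show ?thesis using endosD(1)[OF ph rot_C] endosD(1)[OF ph empty_C] endosD(2)[OF ph empty_C empty_C]
          endosD(2)[OF ph empty_C rot_C, of 1] endosD(2)[OF ph rot_C empty_C, of 1] by (simp add: collapse_data_def del: pw.simps)
    qed
    then show "(\<lambda>\<phi>. (\<phi> (rot N 1), \<phi> Map.empty)) ` endo_collapsing \<subseteq> collapse_data" by blast
    show "\<forall>\<phi>\<in>endo_collapsing. collapse (\<phi> (rot N 1), \<phi> Map.empty) = \<phi>"
    proof
      fix \<phi> assume c: "\<phi> \<in> endo_collapsing"
      then have ph: "\<phi> \<in> endos" by (simp add: endo_collapsing_def)
      have u: "pw (\<phi> (rot N 1)) (Suc n) = \<phi> (rot N 1)" using mem[OF c] by (simp add: collapse_data_def del: pw.simps)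
      show "collapse (\<phi> (rot N 1), \<phi> Map.empty) = \<phi>"
      proof
        fix \<alpha>
        show "collapse (\<phi> (rot N 1), \<phi> Map.empty) \<alpha> = \<phi> \<alpha>"
        proof (cases "\<alpha> \<in> C")
          case a: True
          show ?thesis
          proof (cases "rk \<alpha> = n")
            case True
            then obtain t where t: "\<alpha> = rot N t" using rk_n[OF a] by metis
            have "\<phi> \<alpha> = \<phi> (pw (rot N 1) (Suc (t + n - 1)))"
              unfolding pw_rot_1 using t rot_add_n[of t] n3 by simp
            also have "\<dots> = pw (\<phi> (rot N 1)) (t + n)" unfolding endo_pw[OF ph rot_C] using n3 by simp
            finally show ?thesis unfolding t collapse_rot[OF u] by simp
          next
            case False
            then have "rk \<alpha> < n" using rk_le[OF a] by simp
            then show ?thesis using c a by (simp add: collapse_small endo_collapsing_def)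
          qed
        next
          case False
          then show ?thesis using ph by (simp add: collapse_def endos_def extensional_def)
        qed
      qed
    qed
  qed
qed

lemma finite_C: "finite C"
proof -
  have "C \<subseteq> (\<Union>A\<in>Pow N. {\<alpha>. dom \<alpha> = A \<and> ran \<alpha> \<subseteq> N})" using C_D(1,2) by blast
  moreover have "finite (\<Union>A\<in>Pow N. {\<alpha> :: nat \<rightharpoonup> nat. dom \<alpha> = A \<and> ran \<alpha> \<subseteq> N})"
    by (intro finite_UN_I finite_set_of_finite_maps) (auto intro: finite_subset)
  ultimately show ?thesis by (rule finite_subset)
qed

lemma finite_collapse_data: "finite collapse_data"
  by (rule finite_subset[of _ "C \<times> C"]) (auto simp: collapse_data_def finite_C)

text \<open>Three test elements show that the families are disjoint. The affine family kills
  \<open>idp {1}\<close> but not \<open>idp (N - {1})\<close>; the dihedral one keeps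
  \<open>idp {1}\<close> nonempty and separates it from \<open>idp {2}\<close>; the collapsing one
  is constant on all three.\<close>

lemma card_endos: "card endos = 2 * n + n * totient n + card collapse_data"
proof -
  let ?D = "endo_dihedral ` ({..<n} \<times> {1, n - 1})" and ?A = "endo_affine ` ({..<n} \<times> totatives n)"
  have e: "endos = (?D \<union> ?A) \<union> endo_collapsing"
    using endos_cases endo_dihedral_in_endos endo_affine_in_endos by (auto simp: endo_collapsing_def)
  have N12: "1 \<in> N" "2 \<in> N" using n3 by auto
  have ne: "idp {x} \<noteq> Map.empty" for x using idp_eq_iff[of "{x}" "{}"] idp_empty by simp
  have r: "rk (idp {1}) < n" "rk (idp {2}) < n" "rk (idp (N - {1})) < n" "idp {1} \<in> C" "idp {2} \<in> C" "idp (N - {1}) \<in> C"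
    using n3 by (auto simp: rk_def intro!: idp_C)
  have d: "\<phi> (idp {1}) = idp {aff a m 1}" if "\<phi> = endo_dihedral (a, m)" "m \<in> {1, n - 1}" for \<phi> a m
    using that endo_dihedral_idp[OF _ N12(1), of m a] by auto
  have d2: "\<phi> (idp {2}) = idp {aff a m 2}" if "\<phi> = endo_dihedral (a, m)" "m \<in> {1, n - 1}" for \<phi> a m
    using that endo_dihedral_idp[OF _ N12(2), of m a] by auto
  have DA: "?D \<inter> ?A = {}"
  proof (rule ccontr)
    assume "?D \<inter> ?A \<noteq> {}"
    then obtain a m a' m' where "endo_dihedral (a, m) = endo_affine (a', m')" "m \<in> {1, n - 1}" by blast
    then show False using d[OF refl, of m a] endo_affine_idp(2)[OF N12(1), of a' m'] ne by simp
  qed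
  have "(?D \<union> ?A) \<inter> endo_collapsing = {}"
  proof (rule ccontr)
    assume "(?D \<union> ?A) \<inter> endo_collapsing \<noteq> {}"
    then obtain \<phi> where ph: "\<phi> \<in> ?D \<union> ?A" "\<phi> \<in> endo_collapsing" by blast
    then have c: "\<phi> (idp {1}) = \<phi> (idp {2})" "\<phi> (idp {1}) = \<phi> (idp (N - {1}))" using r by (auto simp: endo_collapsing_def)
    from ph(1) show False
    proof
      assume "\<phi> \<in> ?D"
      then obtain a m where am: "\<phi> = endo_dihedral (a, m)" "m \<in> {1, n - 1}" by blast
      then have "aff a m 1 = aff a m 2" using c(1) d[OF am] d2[OF am] by (simp add: idp_eq_iff)
      moreover have "inj_on (aff a m) N" using am(2) aff_bij one_totative pred_totative by (auto simp: bij_betw_def)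
      ultimately show False using N12 by (auto dest: inj_onD)
    next
      assume "\<phi> \<in> ?A"
      then obtain a m where am: "\<phi> = endo_affine (a, m)" "m \<in> totatives n" by blast
      then show False using c(2) endo_affine_idp(1)[OF am(2) N12(1), of a] endo_affine_idp(2)[OF N12(1), of a m] ne by simp
    qed
  qed
  moreover have "finite endo_collapsing"
    using endo_collapsing_bij finite_collapse_data bij_betw_finite by blast
  moreover have "card endo_collapsing = card collapse_data" using endo_collapsing_bij bij_betw_same_card by metis
  ultimately show ?thesis unfolding e
    using DA card_endo_dihedral card_endo_affine
    by (simp add: card_Un_disjoint)
qed

end

section \<open>Endomorphisms collapsing the singular elements\<close>

text \<open>Translates the condition in \<open>eps\<close>: the right-hand side says that a rotation
  by \<open>t\<close> of \<open>k\<close> points becomes trivial after \<open>m\<close>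
  repetitions.\<close>

lemma div_gcd_dvd_iff:
  assumes "0 < (k::nat)" shows "k div gcd t k dvd m \<longleftrightarrow> k dvd t * m"
proof -
  let ?g = "gcd t k"
  have g: "?g > 0" using assms by simp
  obtain t' k' where tk: "t = t' * ?g" "k = k' * ?g" "coprime t' k'"
    using gcd_coprime_exists[of t k] g by auto
  have "k div ?g = k'" using tk(2) g by (metis nonzero_mult_div_cancel_right not_gr_zero)
  moreover have "k dvd t * m \<longleftrightarrow> k' * ?g dvd (t' * m) * ?g" using tk(1,2) by (metis mult.assoc mult.commute)
  moreover have "\<dots> \<longleftrightarrow> k' dvd t' * m" using g by simp
  moreover have "\<dots> \<longleftrightarrow> k' dvd m" using tk(3) by (simp add: coprime_commute coprime_dvd_mult_right_iff)
  ultimately show ?thesis by simp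
qed

lemma comp_idem_left_iff:
  fixes e f :: pmap
  assumes "e \<circ>\<^sub>m e = e" shows "e \<circ>\<^sub>m f = f \<longleftrightarrow> ran f \<subseteq> ran e"
proof
  assume "e \<circ>\<^sub>m f = f" then show "ran f \<subseteq> ran e" using ran_map_comp_subset[of e f] by simp
next
  assume s: "ran f \<subseteq> ran e"
  have "e y = Some y" if "f x = Some y" for x y
    using idempotent_fixes_ran[OF assms] s ranI[of f, OF that] by blast
  then show "e \<circ>\<^sub>m f = f" by (intro pmap_eqI) (unfold map_comp_Some_iff, metis option.inject)
qed

lemma pw_idem: "e \<circ>\<^sub>m e = e \<Longrightarrow> pw e (Suc k) = e"
  by (induction k) simp_all

lemma pw_commute: "pw u j \<circ>\<^sub>m pw u k = pw u k \<circ>\<^sub>m pw u j"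
  by (metis add.commute pw_add)

context orientation_monoid
begin

definition idempotents :: "pmap set" where
  "idempotents = {e. e \<in> C \<and> e \<circ>\<^sub>m e = e}"

definition below :: "pmap \<Rightarrow> pmap set" where
  "below e = {f \<in> idempotents. f \<circ>\<^sub>m e = f \<and> e \<circ>\<^sub>m f = f}"

definition rotations :: "pmap \<Rightarrow> pmap set" where
  "rotations e = {u \<in> C. pw u (Suc n) = u \<and> u \<circ>\<^sub>m u \<noteq> u \<and> pw u n = e}"

definition eps_set :: "nat \<Rightarrow> nat set" where
  "eps_set k = {t \<in> {1..<k}. (k div gcd t k) dvd n}"

lemma idempotents_D:
  assumes e: "e \<in> idempotents"
  shows "e \<in> C" "e \<circ>\<^sub>m e = e" "ran e \<subseteq> N" "finite (ran e)" "e \<circ>\<^sub>m idp (ran e) = idp (ran e)"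
proof -
  show 1: "e \<in> C" "e \<circ>\<^sub>m e = e" using e by (auto simp: idempotents_def)
  show "ran e \<subseteq> N" "finite (ran e)" using C_D[OF 1(1)] by auto
  show "e \<circ>\<^sub>m idp (ran e) = idp (ran e)" using comp_idem_left_iff[OF 1(2)] by simp
qed

lemma rot_idem_cancel:
  assumes e: "e \<in> idempotents" shows "(rot (ran e) s \<circ>\<^sub>m e) \<circ>\<^sub>m idp (ran e) = rot (ran e) s"
proof -
  have "(rot (ran e) s \<circ>\<^sub>m e) \<circ>\<^sub>m idp (ran e) = rot (ran e) s \<circ>\<^sub>m rot (ran e) 0"
    unfolding map_comp_assoc idempotents_D(5)[OF e] rot_0[OF idempotents_D(4)[OF e]] ..
  then show ?thesis by (simp add: rot_map_comp[OF idempotents_D(4)[OF e]])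
qed

lemma pw_rot_idem:
  assumes e: "e \<in> idempotents" shows "pw (rot (ran e) t \<circ>\<^sub>m e) (Suc j) = rot (ran e) (t * Suc j) \<circ>\<^sub>m e"
proof (induction j)
  case (Suc j)
  have er: "e \<circ>\<^sub>m rot (ran e) s = rot (ran e) s" for s
    using comp_idem_left_iff[OF idempotents_D(2)[OF e], of "rot (ran e) s"] ran_rot[OF idempotents_D(4)[OF e]] by simp
  have "pw (rot (ran e) t \<circ>\<^sub>m e) (Suc (Suc j)) = rot (ran e) t \<circ>\<^sub>m ((e \<circ>\<^sub>m rot (ran e) (t * Suc j)) \<circ>\<^sub>m e)"
    using Suc by (simp add: map_comp_assoc)
  also have "\<dots> = rot (ran e) (t * Suc (Suc j)) \<circ>\<^sub>m e"
    unfolding er map_comp_assoc[symmetric] rot_map_comp[OF idempotents_D(4)[OF e]] by (simp add: algebra_simps)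
  finally show ?case .
qed simp

lemma rot_eq_mod:
  assumes "finite A" "A \<noteq> {}" shows "rot A s = rot A t \<longleftrightarrow> s mod card A = t mod card A"
  using rot_eq_iff[of A "s mod card A" "t mod card A"] assms by (simp add: rot_mod_card card_gt_0_iff)

text \<open>Since u = u e, the map \<open>u\<close> is determined by its restriction to the range of
  \<open>e\<close>. That restriction is a permutation because u^n = e is the identity there, hence
  it is a rotation. Its step is nonzero because \<open>u\<close> is not idempotent, and u^n = e is
  the divisibility condition of \<open>eps_set\<close>.\<close>

lemma rotations_bij:
  assumes e: "e \<in> idempotents"
  shows "bij_betw (\<lambda>t. rot (ran e) t \<circ>\<^sub>m e) (eps_set (rk e)) (rotations e)"
proof -
  let ?A = "ran e"
  note fA = idempotents_D(4)[OF e]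
  have nS: "n = Suc (n - 1)" using n3 by simp
  have inj: "inj_on (\<lambda>t. rot ?A t \<circ>\<^sub>m e) (eps_set (rk e))"
  proof (rule inj_onI)
    fix s t assume st: "s \<in> eps_set (rk e)" "t \<in> eps_set (rk e)" "rot ?A s \<circ>\<^sub>m e = rot ?A t \<circ>\<^sub>m e"
    then have "rot ?A s = rot ?A t" using rot_idem_cancel[OF e] by metis
    then show "s = t" using rot_eq_iff[OF fA] st(1,2) by (auto simp: eps_set_def rk_def)
  qed
  have fwd: "rot ?A t \<circ>\<^sub>m e \<in> rotations e" if t: "t \<in> eps_set (rk e)" for t
  proof -
    have k: "0 < card ?A" "0 < t" "t < card ?A" and d: "card ?A dvd t * n"
      using t div_gcd_dvd_iff[of "card ?A" t n] by (auto simp: eps_set_def rk_def)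
    have ne: "?A \<noteq> {}" using k by auto
    have rC: "rot ?A t \<in> C"
      using inj_rot[OF fA, of t] idempotents_D(3)[OF e] by (intro C_inj) (auto simp: dom_rot[OF fA] ran_rot[OF fA] orientation_preserving_rot[OF fA])
    have "rot ?A (t * Suc n) = rot ?A t" unfolding rot_eq_mod[OF fA ne] using d by (auto simp: mod_simps elim!: dvdE)
    then have 1: "pw (rot ?A t \<circ>\<^sub>m e) (Suc n) = rot ?A t \<circ>\<^sub>m e" unfolding pw_rot_idem[OF e] by simp
    have "rot ?A (t * n) = rot ?A 0" unfolding rot_eq_mod[OF fA ne] using d by simp
    then have 2: "pw (rot ?A t \<circ>\<^sub>m e) n = e"
      using pw_rot_idem[OF e, of t "n - 1"] nS rot_0[OF fA] idp_ran_comp[of e] by simp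
    have 3: "(rot ?A t \<circ>\<^sub>m e) \<circ>\<^sub>m (rot ?A t \<circ>\<^sub>m e) \<noteq> rot ?A t \<circ>\<^sub>m e"
    proof
      assume "(rot ?A t \<circ>\<^sub>m e) \<circ>\<^sub>m (rot ?A t \<circ>\<^sub>m e) = rot ?A t \<circ>\<^sub>m e"
      then have "pw (rot ?A t \<circ>\<^sub>m e) n = rot ?A t \<circ>\<^sub>m e" using pw_idem nS by metis
      then have "rot ?A t \<circ>\<^sub>m e = rot ?A 0 \<circ>\<^sub>m e" using 2 rot_0[OF fA] idp_ran_comp[of e] by simp
      then have "rot ?A t = rot ?A 0" using rot_idem_cancel[OF e] by metis
      then show False using rot_eq_iff[OF fA k(3,1)] k(2) by simp
    qed
    show ?thesis using 1 2 3 C_comp[OF idempotents_D(1)[OF e] rC] by (simp add: rotations_def del: pw.simps)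
  qed
  have bwd: "\<exists>t\<in>eps_set (rk e). u = rot ?A t \<circ>\<^sub>m e" if u: "u \<in> rotations e" for u
  proof -
    have uC: "u \<in> C" and p: "pw u (Suc n) = u" and ni: "u \<circ>\<^sub>m u \<noteq> u" and pe: "pw u n = e"
      using u by (auto simp: rotations_def simp del: pw.simps)
    have ue: "u \<circ>\<^sub>m e = u" using p pe by simp
    have eu: "e \<circ>\<^sub>m u = u" using pw_commute[of u n 1] pe ue by simp
    have ru: "ran u \<subseteq> ?A" using comp_idem_left_iff[OF idempotents_D(2)[OF e]] eu by simp
    have ne: "?A \<noteq> {}"
    proof
      assume "?A = {}"
      then have "ran u = {}" using ru by simp
      then have "u = Map.empty" using rk_0[OF uC] by (simp add: rk_def)
      then show False using ni by simp
    qed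
    define w where "w = u \<circ>\<^sub>m idp ?A"
    have fix_e: "e a = Some a" if "a \<in> ?A" for a using idempotent_fixes_ran[OF idempotents_D(2)[OF e] that] .
    have w: "w a = Some b \<longleftrightarrow> a \<in> ?A \<and> u a = Some b" for a b by (auto simp: w_def map_comp_Some_iff)
    have dw: "dom w = ?A"
    proof (rule Set.set_eqI)
      fix a
      have "\<exists>b. u a = Some b" if "a \<in> ?A"
      proof -
        have "(pw u (n - 1) \<circ>\<^sub>m u) a = Some a" using fix_e[OF that] pe nS pw_add[of u "n - 1" 1] by simp
        then show ?thesis by (auto simp: map_comp_Some_iff)
      qed
      then show "a \<in> dom w \<longleftrightarrow> a \<in> ?A" using w by blast
    qed
    have rw: "ran w = ?A"
    proof
      show "ran w \<subseteq> ?A" using ru ran_map_comp_subset[of u "idp ?A"] by (simp add: w_def)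
      show "?A \<subseteq> ran w"
      proof
        fix a assume a: "a \<in> ?A"
        have "(u \<circ>\<^sub>m (e \<circ>\<^sub>m pw u (n - 1))) a = Some a"
        proof -
          have "u \<circ>\<^sub>m (e \<circ>\<^sub>m pw u (n - 1)) = e \<circ>\<^sub>m (u \<circ>\<^sub>m pw u (n - 1))"
            using ue eu map_comp_assoc by metis
          also have "u \<circ>\<^sub>m pw u (n - 1) = e" using pe nS by (metis pw.simps(2))
          finally show ?thesis using idempotents_D(2)[OF e] fix_e[OF a] by simp
        qed
        then obtain b where b: "(e \<circ>\<^sub>m pw u (n - 1)) a = Some b" "u b = Some a" unfolding map_comp_Some_iff[of u] by blast
        then have "b \<in> ran (e \<circ>\<^sub>m pw u (n - 1))" by (intro ranI)
        then have "b \<in> ?A" using ran_map_comp_subset[of e "pw u (n - 1)"] by blast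
        then have "w b = Some a" using w b by blast
        then show "a \<in> ran w" by (rule ranI)
      qed
    qed
    have "w \<in> C" unfolding w_def by (rule C_comp[OF idp_C[OF idempotents_D(3)[OF e]] uC])
    then obtain t' where t': "w = rot ?A t'" using orientation_preserving_perm_is_rot[OF fA dw rw] C_D(3) by blast
    define t where "t = t' mod card ?A"
    have wt: "w = rot ?A t" using t' rot_mod_card[OF fA] by (simp add: t_def)
    have uw: "u = w \<circ>\<^sub>m e" using ue idp_ran_comp[of e] by (simp add: w_def map_comp_assoc)
    have tk: "t < card ?A" using ne fA by (simp add: t_def card_gt_0_iff)
    have "t \<noteq> 0"
    proof
      assume "t = 0"
      then have "u = e" using uw wt rot_0[OF fA] idp_ran_comp[of e] by simp
      then show False using ni idempotents_D(2)[OF e] by simp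
    qed
    have "rot ?A (t * n) \<circ>\<^sub>m e = rot ?A 0 \<circ>\<^sub>m e"
      using pw_rot_idem[OF e, of t "n - 1"] nS rot_0[OF fA] idp_ran_comp[of e] uw wt pe by simp
    then have "rot ?A (t * n) = rot ?A 0" using rot_idem_cancel[OF e] by metis
    then have "card ?A dvd t * n" using rot_eq_mod[OF fA ne] by (simp add: dvd_eq_mod_eq_0)
    then have "t \<in> eps_set (rk e)" using tk \<open>t \<noteq> 0\<close> div_gcd_dvd_iff[of "card ?A" t n] by (simp add: eps_set_def rk_def)
    then show ?thesis using uw wt by blast
  qed
  show ?thesis unfolding bij_betw_def using inj fwd bwd by blast
qed

lemma card_rotations: "e \<in> idempotents \<Longrightarrow> card (rotations e) = eps n (rk e)"
  using bij_betw_same_card[OF rotations_bij] by (simp add: eps_set_def eps_def)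

text \<open>From u f = f, every value of \<open>f\<close> is a fixed point of \<open>u\<close>, so
  it lies in the range of \<open>e\<close>, where \<open>u\<close> is a rotation by a nonzero
  step.\<close>

lemma rotation_fixes_nothing:
  assumes e: "e \<in> idempotents" and u: "u \<in> rotations e" and f: "f \<circ>\<^sub>m u = f" "u \<circ>\<^sub>m f = f"
  shows "f = Map.empty"
proof (rule ccontr)
  assume "f \<noteq> Map.empty"
  then obtain x y where y: "f x = Some y" by (metis not_None_eq)
  obtain t where t: "t \<in> eps_set (rk e)" "u = rot (ran e) t \<circ>\<^sub>m e"
    using rotations_bij[OF e] u unfolding bij_betw_def by blast
  have uy: "u y = Some y" using y f(2) by (metis map_comp_simps(2))
  then have "y \<in> ran (rot (ran e) t)" using t(2) ran_map_comp_subset[of "rot (ran e) t" e] ranI[of u y y] by blast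
  then have "y \<in> ran e" using ran_rot[OF idempotents_D(4)[OF e]] by simp
  then have "rot (ran e) t y = Some y" using idempotent_fixes_ran[OF idempotents_D(2)[OF e]] uy t(2) by (metis map_comp_simps(2))
  then have "t = 0" using rot_fixed_point[OF idempotents_D(4)[OF e]] t(1) by (auto simp: eps_set_def rk_def)
  then show False using t(1) by (simp add: eps_set_def)
qed

lemma collapse_data_eq: "collapse_data = (SIGMA e:idempotents. below e) \<union> ((\<Union>e\<in>idempotents. rotations e) \<times> {Map.empty})"
proof (rule Set.set_eqI)
  fix p :: "pmap \<times> pmap"
  obtain u f where uf: "p = (u, f)" by (cases p)
  show "p \<in> collapse_data \<longleftrightarrow> p \<in> (SIGMA e:idempotents. below e) \<union> ((\<Union>e\<in>idempotents. rotations e) \<times> {Map.empty})"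
  proof
    assume p: "p \<in> collapse_data"
    then have h: "u \<in> C" "f \<in> C" "pw u (Suc n) = u" "f \<circ>\<^sub>m f = f" "f \<circ>\<^sub>m u = f" "u \<circ>\<^sub>m f = f"
      by (auto simp: collapse_data_def uf simp del: pw.simps)
    show "p \<in> (SIGMA e:idempotents. below e) \<union> ((\<Union>e\<in>idempotents. rotations e) \<times> {Map.empty})"
    proof (cases "u \<circ>\<^sub>m u = u")
      case True
      then show ?thesis using h by (simp add: uf idempotents_def below_def)
    next
      case False
      \<comment> \<open>Positive powers of \<open>u\<close> have period \<open>n\<close>, so the
        exponents 2n and n give the same power.\<close>
      have "pw u n \<circ>\<^sub>m pw u n = pw u n"
        using pw_period[OF h(3), of "n - 1"] n3 by (simp flip: pw_add)
      moreover have "pw u n \<in> C" using pw_C[OF h(1), of "n - 1"] n3 by simp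
      ultimately have e: "pw u n \<in> idempotents" by (simp add: idempotents_def)
      moreover have "u \<in> rotations (pw u n)" using h False by (simp add: rotations_def del: pw.simps)
      ultimately show ?thesis using rotation_fixes_nothing[OF e _ h(5,6)] uf by blast
    qed
  next
    assume "p \<in> (SIGMA e:idempotents. below e) \<union> ((\<Union>e\<in>idempotents. rotations e) \<times> {Map.empty})"
    then show "p \<in> collapse_data"
    proof
      assume "p \<in> (SIGMA e:idempotents. below e)"
      then show ?thesis using pw_idem by (auto simp: uf collapse_data_def idempotents_def below_def simp del: pw.simps)
    next
      assume "p \<in> (\<Union>e\<in>idempotents. rotations e) \<times> {Map.empty}"
      then show ?thesis by (auto simp: uf collapse_data_def rotations_def empty_C simp del: pw.simps)
    qed
  qed
qed

lemma finite_idempotents: "finite idempotents"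
  unfolding idempotents_def using finite_C by simp

lemma card_collapse_data: "card collapse_data = (\<Sum>e\<in>idempotents. card (below e) + eps n (rk e))"
proof -
  have fb: "finite (below e)" for e unfolding below_def using finite_idempotents by simp
  have fr: "finite (rotations e)" for e unfolding rotations_def using finite_C by simp
  have "(SIGMA e:idempotents. below e) \<inter> ((\<Union>e\<in>idempotents. rotations e) \<times> {Map.empty}) = {}"
    by (auto simp: idempotents_def rotations_def)
  then have "card collapse_data = card (SIGMA e:idempotents. below e) + card (\<Union>e\<in>idempotents. rotations e)"
    unfolding collapse_data_eq using finite_idempotents fb fr by (subst card_Un_disjoint) (auto simp: card_cartesian_product)
  also have "card (\<Union>e\<in>idempotents. rotations e) = (\<Sum>e\<in>idempotents. card (rotations e))"
  proof (rule card_UN_disjoint)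
    show "\<forall>e\<in>idempotents. finite (rotations e)" using fr by blast
  qed (auto simp: finite_idempotents rotations_def)
  finally show ?thesis using finite_idempotents fb card_rotations by (simp add: sum.distrib)
qed

end

section \<open>Monotone idempotents with fixed ends\<close>

text \<open>Models the part of an idempotent between its smallest fixed point \<open>p\<close> and
  its largest fixed point \<open>q\<close>; no cut can occur there.\<close>

definition mono_idem :: "nat \<Rightarrow> nat \<Rightarrow> nat \<Rightarrow> pmap set" where
  "mono_idem p q k = {\<beta>. dom \<beta> = {p..q} \<and> ran \<beta> \<subseteq> {p..q} \<and> (\<forall>y\<in>ran \<beta>. \<beta> y = Some y) \<and>
     (\<forall>x y a b. \<beta> x = Some a \<longrightarrow> \<beta> y = Some b \<longrightarrow> x < y \<longrightarrow> a \<le> b) \<and>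
     \<beta> p = Some p \<and> \<beta> q = Some q \<and> card (ran \<beta>) = k}"

lemma mono_idemD:
  assumes "\<beta> \<in> mono_idem p q k"
  shows "dom \<beta> = {p..q}" "ran \<beta> \<subseteq> {p..q}" "\<And>y. y \<in> ran \<beta> \<Longrightarrow> \<beta> y = Some y"
    "\<And>x y a b. \<beta> x = Some a \<Longrightarrow> \<beta> y = Some b \<Longrightarrow> x \<le> y \<Longrightarrow> a \<le> b"
    "\<beta> p = Some p" "\<beta> q = Some q" "card (ran \<beta>) = k" "finite (ran \<beta>)" "p \<le> q"
    "\<And>x y. \<beta> x = Some y \<Longrightarrow> p \<le> x \<and> x \<le> q \<and> p \<le> y \<and> y \<le> q"
proof -
  show 1: "dom \<beta> = {p..q}" "ran \<beta> \<subseteq> {p..q}" "\<And>y. y \<in> ran \<beta> \<Longrightarrow> \<beta> y = Some y"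
    "\<beta> p = Some p" "\<beta> q = Some q" "card (ran \<beta>) = k" using assms by (auto simp: mono_idem_def)
  show "finite (ran \<beta>)" using 1(2) finite_subset by blast
  show "p \<le> q" using 1(1,4) by (metis atLeastAtMost_iff domI)
  show "a \<le> b" if "\<beta> x = Some a" "\<beta> y = Some b" "x \<le> y" for x y a b
  proof (cases "x = y")
    case False
    then have "x < y" using that by simp
    then show ?thesis using assms that unfolding mono_idem_def by blast
  qed (use that in simp)
  show "p \<le> x \<and> x \<le> q \<and> p \<le> y \<and> y \<le> q" if "\<beta> x = Some y" for x y
    using 1(1,2) domI[of \<beta>, OF that] ranI[of \<beta>, OF that] by auto
qed

lemma finite_mono_idem: "finite (mono_idem p q k)"
  by (rule finite_subset[OF _ finite_set_of_finite_maps[of "{p..q}" "{p..q}"]]) (auto simp: mono_idem_def)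

text \<open>Here \<open>p'\<close> is the second smallest fixed point and \<open>s\<close> the first point mapped to it.\<close>

definition glue :: "nat \<Rightarrow> nat \<times> nat \<times> pmap \<Rightarrow> pmap" where
  "glue p = (\<lambda>(p', s, \<beta>) x. if p \<le> x \<and> x < s then Some p else if s \<le> x \<and> x < p' then Some p' else \<beta> x)"

definition unglue :: "nat \<Rightarrow> pmap \<Rightarrow> nat \<times> nat \<times> pmap" where
  "unglue p \<gamma> = (let p' = Min (ran \<gamma> - {p}) in (p', LEAST x. \<gamma> x = Some p', \<gamma> |` {p'..}))"

text \<open>Splits off the first inner gap. The assumption on \<open>k\<close> provides a second
  fixed point \<open>p'\<close>, and \<open>s\<close> runs through the \<open>p' - p\<close> places
  where the values can change from \<open>p\<close> to \<open>p'\<close>.\<close>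

lemma glue_bij:
  assumes k: "1 \<le> k"
  shows "bij_betw (glue p) (SIGMA p':{p<..q}. {p<..p'} \<times> mono_idem p' q k) (mono_idem p q (Suc k))"
proof (rule bij_betw_byWitness[where f' = "unglue p"])
  let ?S = "SIGMA p':{p<..q}. {p<..p'} \<times> mono_idem p' q k"
  have fwd: "glue p (p', s, \<beta>) \<in> mono_idem p q (Suc k) \<and> unglue p (glue p (p', s, \<beta>)) = (p', s, \<beta>)"
    if h: "p < p'" "p' \<le> q" "p < s" "s \<le> p'" "\<beta> \<in> mono_idem p' q k" for p' s \<beta>
  proof -
    note b = mono_idemD[OF h(5)]
    let ?g = "glue p (p', s, \<beta>)"
    have val: "?g x = Some v \<longleftrightarrow> p \<le> x \<and> x < s \<and> v = p \<or> s \<le> x \<and> x < p' \<and> v = p' \<or> p' \<le> x \<and> \<beta> x = Some v" for x v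
      using h b(10)[of x v] by (auto simp: glue_def)
    have ran: "ran ?g = insert p (ran \<beta>)"
    proof (rule Set.set_eqI)
      fix v
      have "?g p = Some p" using val h by simp
      moreover have "\<beta> p' = Some p'" by (rule b(5))
      moreover have "\<beta> x = Some v \<Longrightarrow> p' \<le> x" for x using b(10) by blast
      ultimately show "v \<in> ran ?g \<longleftrightarrow> v \<in> insert p (ran \<beta>)" unfolding ran_def mem_Collect_eq val insert_iff using h by blast
    qed
    have pn: "p \<notin> ran \<beta>" using b(2) h(1) by auto
    have dom: "dom ?g = {p..q}"
    proof (rule Set.set_eqI)
      fix x
      have "x \<in> {p'..q} \<longleftrightarrow> (\<exists>v. \<beta> x = Some v)" using b(1) by blast
      then show "x \<in> dom ?g \<longleftrightarrow> x \<in> {p..q}" unfolding dom_def mem_Collect_eq not_None_eq val ex_disj_distrib using h by auto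
    qed
    have "?g \<in> mono_idem p q (Suc k)"
      unfolding mono_idem_def mem_Collect_eq
    proof (intro conjI allI impI ballI)
      show "ran ?g \<subseteq> {p..q}" unfolding ran using b(2,9) h by auto
      show "?g y = Some y" if "y \<in> ran ?g" for y
        using that b(3)[of y] b(2) h unfolding ran val by auto
      show "u \<le> v" if "?g x = Some u" "?g y = Some v" "x < y" for x y u v
        using that(1,2) unfolding val using that(3) h b(4)[of x u y v] b(10)[of x u] b(10)[of y v] by auto
      show "?g p = Some p" using val h by simp
      show "?g q = Some q" using val h b(6) by simp
      show "card (ran ?g) = Suc k" unfolding ran using b(7,8) pn by simp
    qed (rule dom)
    moreover have "unglue p ?g = (p', s, \<beta>)"
    proof -
      have "ran ?g - {p} = ran \<beta>" using ran pn by blast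
      moreover have "Min (ran \<beta>) = p'"
        by (rule Min_eqI) (use b(2,8) ranI[of \<beta>, OF b(5)] in auto)
      moreover have "(LEAST x. ?g x = Some p') = s"
      proof (rule Least_equality)
        show "?g s = Some p'" using val h b(5) by auto
        show "s \<le> x" if "?g x = Some p'" for x using that h unfolding val by auto
      qed
      moreover have "?g |` {p'..} = \<beta>"
      proof (rule pmap_eqI)
        fix x v show "(?g |` {p'..}) x = Some v \<longleftrightarrow> \<beta> x = Some v"
          using val[of x v] b(10)[of x v] h by (auto simp: restrict_map_def)
      qed
      ultimately show ?thesis unfolding unglue_def by simp
    qed
    ultimately show ?thesis by blast
  qed
  show "\<forall>a\<in>?S. unglue p (glue p a) = a" using fwd by auto
  show "glue p ` ?S \<subseteq> mono_idem p q (Suc k)" using fwd by auto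
  have bwd: "unglue p \<gamma> \<in> ?S \<and> glue p (unglue p \<gamma>) = \<gamma>" if g: "\<gamma> \<in> mono_idem p q (Suc k)" for \<gamma>
  proof -
    note b = mono_idemD[OF g]
    define R where "R = ran \<gamma> - {p}"
    define p' where "p' = Min R"
    define s where "s = (LEAST x. \<gamma> x = Some p')"
    define \<beta> where "\<beta> = \<gamma> |` {p'..}"
    have cR: "card R = k" and fR: "finite R" using b(7,8) ranI[of \<gamma>, OF b(5)] by (simp_all add: R_def)
    then have "R \<noteq> {}" using k by auto
    then have pR: "p' \<in> R" and minR: "\<And>v. v \<in> R \<Longrightarrow> p' \<le> v" using fR by (simp_all add: p'_def)
    have p': "\<gamma> p' = Some p'" "p < p'" "p' \<le> q"
      using pR b(2,3) unfolding R_def by (blast, force, force)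
    have s: "\<gamma> s = Some p'" "\<And>x. \<gamma> x = Some p' \<Longrightarrow> s \<le> x"
      using LeastI[of "\<lambda>x. \<gamma> x = Some p'", OF p'(1)] Least_le[of "\<lambda>x. \<gamma> x = Some p'"]
      unfolding s_def by blast+
    have sp: "s \<le> p'" "p < s"
    proof -
      show "s \<le> p'" using s(2) p'(1) by blast
      have "p \<le> s" using b(10)[OF s(1)] by simp
      moreover have "s \<noteq> p" using s(1) b(5) p'(2) by auto
      ultimately show "p < s" by simp
    qed
    have val: "\<beta> x = Some v \<longleftrightarrow> p' \<le> x \<and> \<gamma> x = Some v" for x v by (auto simp: \<beta>_def restrict_map_def)
    have rb: "ran \<beta> = R"
    proof (rule Set.set_eqI)
      fix v show "v \<in> ran \<beta> \<longleftrightarrow> v \<in> R"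
      proof
        assume "v \<in> ran \<beta>"
        then obtain x where x: "p' \<le> x" "\<gamma> x = Some v" unfolding ran_def mem_Collect_eq val by blast
        then have "p' \<le> v" using b(4)[OF p'(1) x(2)] by simp
        then show "v \<in> R" using x(2) p'(2) by (auto simp: R_def ran_def)
      next
        assume v: "v \<in> R"
        then have "\<beta> v = Some v" using b(3) minR by (simp add: val R_def)
        then show "v \<in> ran \<beta>" by (rule ranI)
      qed
    qed
    have "\<beta> \<in> mono_idem p' q k"
      unfolding mono_idem_def mem_Collect_eq
    proof (intro conjI allI impI ballI)
      show "dom \<beta> = {p'..q}" using b(1) p' by (auto simp: \<beta>_def)
      show "ran \<beta> \<subseteq> {p'..q}" unfolding rb
      proof
        fix v assume v: "v \<in> R"
        then have "v \<in> {p..q}" using b(2) by (auto simp: R_def)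
        then show "v \<in> {p'..q}" using minR[OF v] by simp
      qed
      show "\<beta> y = Some y" if "y \<in> ran \<beta>" for y using that minR b(3) unfolding rb val by (simp add: R_def)
      show "u \<le> v" if "\<beta> x = Some u" "\<beta> y = Some v" "x < y" for x y u v
        using that b(4)[of x u y v] by (simp add: val)
      show "\<beta> p' = Some p'" "\<beta> q = Some q" using p' b(6) by (simp_all add: val)
      show "card (ran \<beta>) = k" unfolding rb by (rule cR)
    qed
    moreover have "glue p (p', s, \<beta>) = \<gamma>"
    proof (rule ext)
      fix x
      consider "x < p" | "p \<le> x" "x < s" | "s \<le> x" "x < p'" | "p' \<le> x" by linarith
      then show "glue p (p', s, \<beta>) x = \<gamma> x"
      proof cases
        case 1
        then have "\<gamma> x = None" using b(1) by (metis atLeastAtMost_iff domIff not_le)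
        then show ?thesis using 1 sp p' by (simp add: glue_def \<beta>_def)
      next
        case 2
        have "x \<in> dom \<gamma>" using 2 sp p' b(1) by simp
        then obtain v where v: "\<gamma> x = Some v" by blast
        have "v \<le> p'" using b(4)[OF v p'(1)] 2 sp by simp
        moreover have "v \<noteq> p'" using s(2)[of x] v 2 by auto
        ultimately have "v \<notin> R" using minR by fastforce
        then have "v = p" using ranI[of \<gamma>, OF v] by (simp add: R_def)
        then show ?thesis using 2 v by (simp add: glue_def)
      next
        case 3
        have "x \<in> dom \<gamma>" using 3 sp p' b(1) by simp
        then obtain v where v: "\<gamma> x = Some v" by blast
        have "v \<le> p'" "p' \<le> v" using b(4)[OF v p'(1)] b(4)[OF s(1) v] 3 by simp_all
        then show ?thesis using 3 v by (simp add: glue_def)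
      next
        case 4
        then show ?thesis using sp by (simp add: glue_def \<beta>_def)
      qed
    qed
    moreover have "unglue p \<gamma> = (p', s, \<beta>)"
      unfolding unglue_def Let_def p'_def s_def \<beta>_def R_def ..
    ultimately show ?thesis using p' sp by simp
  qed
  show "\<forall>a'\<in>mono_idem p q (Suc k). glue p (unglue p a') = a'" using bwd by blast
  show "unglue p ` mono_idem p q (Suc k) \<subseteq> ?S" using bwd by blast
qed

lemma card_mono_idem_Suc:
  assumes "1 \<le> k" shows "card (mono_idem p q (Suc k)) = (\<Sum>p'\<in>{p<..q}. (p' - p) * card (mono_idem p' q k))"
  unfolding bij_betw_same_card[OF glue_bij[OF assms], symmetric]
  by (subst card_SigmaI) (auto simp: finite_mono_idem card_cartesian_product)

lemma card_mono_idem_1: "card (mono_idem p q 1) = (if p = q then 1 else 0)"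
proof -
  have 1: "p = q" if "\<beta> \<in> mono_idem p q 1" for \<beta>
  proof -
    note b = mono_idemD[OF that]
    have "p \<in> ran \<beta>" "q \<in> ran \<beta>" using ranI[of \<beta>, OF b(5)] ranI[of \<beta>, OF b(6)] by simp_all
    then show "p = q" using b(7) by (metis card_1_singletonE singletonD)
  qed
  have "mono_idem p p 1 = {idp {p}}"
  proof (rule Set.set_eqI)
    fix \<beta> show "\<beta> \<in> mono_idem p p 1 \<longleftrightarrow> \<beta> \<in> {idp {p}}"
    proof
      assume "\<beta> \<in> mono_idem p p 1"
      note b = mono_idemD[OF this]
      have "\<beta> = idp {p}" by (rule pmap_eqI) (use b(5,10) in force)
      then show "\<beta> \<in> {idp {p}}" by simp
    qed (auto simp: mono_idem_def)
  qed
  moreover have "p \<noteq> q \<Longrightarrow> mono_idem p q 1 = {}" using 1 by blast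
  ultimately show ?thesis by auto
qed

text \<open>A convolution with the weights 1, 2, 3, ... has the partial sums of \<open>a\<close> as
  its increments, so two summations of binomials along a diagonal evaluate it.\<close>

lemma sum_linear_weight_Suc:
  fixes a :: "nat \<Rightarrow> nat"
  shows "(\<Sum>g=1..Suc d. g * a (Suc d - g)) = (\<Sum>g=1..d. g * a (d - g)) + (\<Sum>i\<le>d. a i)"
proof -
  have "(\<Sum>g=1..Suc d. g * a (Suc d - g)) = (\<Sum>g=0..d. Suc g * a (d - g))"
    by (simp only: One_nat_def sum.shift_bounds_cl_Suc_ivl diff_Suc_Suc)
  also have "\<dots> = (\<Sum>g=0..d. g * a (d - g)) + (\<Sum>g=0..d. a (d - g))" by (simp add: sum.distrib)
  also have "(\<Sum>g=0..d. g * a (d - g)) = (\<Sum>g=1..d. g * a (d - g))" by (simp add: sum.atLeast_Suc_atMost)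
  also have "(\<Sum>g=0..d. a (d - g)) = (\<Sum>i\<le>d. a i)"
    using sum.nat_diff_reindex[of a "Suc d"] by (simp add: atLeast0AtMost lessThan_Suc_atMost)
  finally show ?thesis .
qed

lemma sum_choose_shift: "1 \<le> r \<Longrightarrow> (\<Sum>i\<le>d. (i + r - 1) choose (2 * r - 1)) = (d + r) choose (2 * r)"
proof (induction d)
  case 0
  then show ?case by (cases "r = 1") (auto simp: binomial_eq_0)
next
  case (Suc d)
  obtain r' where "r = Suc r'" using Suc.prems by (cases r) auto
  then show ?case using Suc by simp
qed

lemma sum_linear_choose: "1 \<le> r \<Longrightarrow> (\<Sum>g=1..d. g * ((d - g + r - 1) choose (2 * r - 1))) = (d + r) choose (2 * r + 1)"
proof (induction d)
  case 0
  then show ?case by (simp add: binomial_eq_0)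
next
  case (Suc d)
  show ?case
    using sum_linear_weight_Suc[of "\<lambda>i. (i + r - 1) choose (2 * r - 1)" d] sum_choose_shift[of r d] Suc
    by simp
qed

lemma sum_greaterThan_reindex:
  fixes f :: "nat \<Rightarrow> nat" shows "p \<le> q \<Longrightarrow> (\<Sum>p'\<in>{p<..q}. f p') = (\<Sum>g=1..q - p. f (p + g))"
  by (rule sum.reindex_bij_witness[where i = "\<lambda>g. p + g" and j = "\<lambda>p'. p' - p"]) auto

text \<open>There are \<open>r\<close> inner gaps, and a gap of length g admits g cuts. The count is
  therefore the sum, over the ordered ways of writing \<open>q - p\<close> as \<open>r\<close>
  positive parts, of the product of the parts; the recursion removes the first part.\<close>

lemma card_mono_idem:
  assumes "1 \<le> r" shows "card (mono_idem p q (Suc r)) = (if p \<le> q then (q - p + r - 1) choose (2 * r - 1) else 0)"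
  using assms
proof (induction r arbitrary: p rule: nat_induct_at_least)
  case base
  show ?case
  proof (cases "p \<le> q")
    case True
    have "card (mono_idem p q (Suc 1)) = (\<Sum>p'\<in>{p<..q}. (p' - p) * (if p' = q then 1 else 0))"
      unfolding card_mono_idem_Suc[OF order.refl] card_mono_idem_1 ..
    also have "\<dots> = (if q \<in> {p<..q} then q - p else 0)" by (simp add: sum.delta if_distrib cong: if_cong)
    finally show ?thesis using True by auto
  qed (simp add: card_mono_idem_Suc)
next
  case (Suc r)
  show ?case
  proof (cases "p \<le> q")
    case True
    have "card (mono_idem p q (Suc (Suc r))) = (\<Sum>g=1..q - p. g * ((q - p - g + r - 1) choose (2 * r - 1)))"
      unfolding card_mono_idem_Suc[of "Suc r", simplified] Suc.IH sum_greaterThan_reindex[OF True]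
      by (rule sum.cong) (auto simp: diff_diff_add)
    then show ?thesis using sum_linear_choose[OF Suc.hyps, of "q - p"] True by simp
  qed (simp add: card_mono_idem_Suc)
qed

section \<open>Orientation-preserving idempotents on a chain\<close>

text \<open>A partial idempotent is a full one on its domain, so counting partial idempotents
  becomes a sum over domains.\<close>

definition full_idems :: "nat set \<Rightarrow> pmap set" where
  "full_idems B = {\<alpha>. dom \<alpha> = B \<and> ran \<alpha> \<subseteq> B \<and> (\<forall>y\<in>ran \<alpha>. \<alpha> y = Some y) \<and> orientation_preserving \<alpha>}"

lemma full_idemsD:
  assumes "\<alpha> \<in> full_idems B"
  shows "dom \<alpha> = B" "ran \<alpha> \<subseteq> B" "\<And>y. y \<in> ran \<alpha> \<Longrightarrow> \<alpha> y = Some y" "orientation_preserving \<alpha>"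
    "\<And>x y. \<alpha> x = Some y \<Longrightarrow> x \<in> B \<and> y \<in> B \<and> y \<in> ran \<alpha>" "\<And>x. x \<in> B \<Longrightarrow> \<exists>y. \<alpha> x = Some y"
proof -
  show 1: "dom \<alpha> = B" "ran \<alpha> \<subseteq> B" "\<And>y. y \<in> ran \<alpha> \<Longrightarrow> \<alpha> y = Some y" "orientation_preserving \<alpha>"
    using assms by (auto simp: full_idems_def)
  show "x \<in> B \<and> y \<in> B \<and> y \<in> ran \<alpha>" if "\<alpha> x = Some y" for x y
    using domI[of \<alpha>, OF that] ranI[of \<alpha>, OF that] 1(1,2) by blast
  show "\<exists>y. \<alpha> x = Some y" if "x \<in> B" for x using that 1(1) by blast
qed

lemma finite_full_idems: "finite B \<Longrightarrow> finite (full_idems B)"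
  by (rule finite_subset[OF _ finite_set_of_finite_maps[of B B]]) (auto simp: full_idems_def)

text \<open>Conjugation by the increasing bijection from \<open>A\<close> onto \<open>B\<close> is
  injective and preserves rank, idempotency and orientation. The reverse inequality follows by
  exchanging the two sets.\<close>

lemma card_full_idems_le:
  assumes "finite A" "finite B" "card A = card B"
  shows "card {\<alpha> \<in> full_idems A. card (ran \<alpha>) = k} \<le> card {\<alpha> \<in> full_idems B. card (ran \<alpha>) = k}"
proof -
  obtain \<gamma> where g: "dom \<gamma> = A" "ran \<gamma> = B" "inj_on \<gamma> (dom \<gamma>)"
    and m: "\<And>x y a b. \<gamma> x = Some a \<Longrightarrow> \<gamma> y = Some b \<Longrightarrow> x < y \<longleftrightarrow> a < b"
    using ex_order_iso[OF assms] by blast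
  note gp = pinv_props[OF g(3)] and gi = pinv_iff[OF g(3)]
  have og: "orientation_preserving \<gamma>" by (rule orientation_preserving_mono) (use g(1) assms(1) m less_imp_le in auto)
  have ogi: "orientation_preserving (pinv \<gamma>)" by (rule orientation_preserving_pinv[OF _ g(3) og]) (use g assms in simp)
  let ?t = "\<lambda>\<alpha>. \<gamma> \<circ>\<^sub>m (\<alpha> \<circ>\<^sub>m pinv \<gamma>)"
  show ?thesis
  proof (rule card_inj_on_le[of ?t])
    show "finite {\<alpha> \<in> full_idems B. card (ran \<alpha>) = k}" using finite_full_idems[OF assms(2)] by simp
    show "inj_on ?t {\<alpha> \<in> full_idems A. card (ran \<alpha>) = k}"
    proof (rule inj_onI)
      have r: "pinv \<gamma> \<circ>\<^sub>m (?t \<alpha> \<circ>\<^sub>m \<gamma>) = \<alpha>" if "\<alpha> \<in> full_idems A" for \<alpha>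
      proof -
        note a = full_idemsD[OF that]
        have "pinv \<gamma> \<circ>\<^sub>m (?t \<alpha> \<circ>\<^sub>m \<gamma>) = (pinv \<gamma> \<circ>\<^sub>m \<gamma>) \<circ>\<^sub>m (\<alpha> \<circ>\<^sub>m (pinv \<gamma> \<circ>\<^sub>m \<gamma>))" by (simp add: map_comp_assoc)
        also have "\<dots> = \<alpha>" unfolding gp(4) g(1)
        proof (rule pmap_eqI)
          fix x y
          have "\<alpha> x = Some y \<Longrightarrow> x \<in> A \<and> y \<in> A" using a(5)[of x y] by simp
          then show "(idp A \<circ>\<^sub>m (\<alpha> \<circ>\<^sub>m idp A)) x = Some y \<longleftrightarrow> \<alpha> x = Some y"
            by (auto simp: map_comp_Some_iff)
        qed
        finally show ?thesis .
      qed
      fix \<alpha> \<beta> assume h: "\<alpha> \<in> {\<alpha> \<in> full_idems A. card (ran \<alpha>) = k}" "\<beta> \<in> {\<alpha> \<in> full_idems A. card (ran \<alpha>) = k}" "?t \<alpha> = ?t \<beta>"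
      have m: "\<alpha> \<in> full_idems A" "\<beta> \<in> full_idems A" using h(1,2) by blast+
      show "\<alpha> = \<beta>" using r[OF m(1)] r[OF m(2)] unfolding h(3) by (rule trans[OF sym])
    qed
    have "?t \<alpha> \<in> full_idems B \<and> card (ran (?t \<alpha>)) = card (ran \<alpha>)" if al: "\<alpha> \<in> full_idems A" for \<alpha>
    proof -
      note a = full_idemsD[OF al]
      have gA: "\<exists>v. \<gamma> y = Some v" if "y \<in> A" for y using that g(1) by blast
      have gB: "\<exists>v. \<gamma> v = Some y" if "y \<in> B" for y using that g(2) by (auto simp: ran_def)
      have gAB: "x \<in> A \<and> y \<in> B" if "\<gamma> x = Some y" for x y using domI[of \<gamma>, OF that] ranI[of \<gamma>, OF that] g by simp
      have val: "?t \<alpha> x = Some y \<longleftrightarrow> (\<exists>u v. \<gamma> u = Some x \<and> \<alpha> u = Some v \<and> \<gamma> v = Some y)" for x y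
        unfolding map_comp_Some_iff gi by blast
      have dom: "dom (?t \<alpha>) = B"
      proof (rule Set.set_eqI)
        fix x show "x \<in> dom (?t \<alpha>) \<longleftrightarrow> x \<in> B"
        proof
          assume "x \<in> dom (?t \<alpha>)"
          then obtain y where "?t \<alpha> x = Some y" by blast
          then show "x \<in> B" unfolding val using gAB by blast
        next
          assume "x \<in> B"
          then obtain u v w where "\<gamma> u = Some x" "\<alpha> u = Some v" "\<gamma> v = Some w" using gB gAB a(5,6) gA by metis
          then have "?t \<alpha> x = Some w" unfolding val by blast
          then show "x \<in> dom (?t \<alpha>)" by blast
        qed
      qed
      have ran: "ran (?t \<alpha>) = (\<lambda>v. the (\<gamma> v)) ` ran \<alpha>"
      proof (rule Set.set_eqI)
        fix y show "y \<in> ran (?t \<alpha>) \<longleftrightarrow> y \<in> (\<lambda>v. the (\<gamma> v)) ` ran \<alpha>"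
        proof
          assume "y \<in> ran (?t \<alpha>)"
          then obtain x u v where "\<alpha> u = Some v" "\<gamma> v = Some y" unfolding ran_def mem_Collect_eq val by blast
          then show "y \<in> (\<lambda>v. the (\<gamma> v)) ` ran \<alpha>" using ranI[of \<alpha> u v] by force
        next
          assume "y \<in> (\<lambda>v. the (\<gamma> v)) ` ran \<alpha>"
          then obtain v where v: "v \<in> ran \<alpha>" "y = the (\<gamma> v)" by blast
          then obtain w where w: "\<gamma> v = Some w" using a(2) gA by blast
          have "?t \<alpha> w = Some y" unfolding val using w v a(3)[OF v(1)] by auto
          then show "y \<in> ran (?t \<alpha>)" by (rule ranI)
        qed
      qed
      have "inj_on (\<lambda>v. the (\<gamma> v)) (ran \<alpha>)"
        by (rule inj_onI) (use g(3) gA a(2) in \<open>metis inj_pmap_iff option.sel subsetD\<close>)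
      then have "card (ran (?t \<alpha>)) = card (ran \<alpha>)" unfolding ran by (rule card_image)
      moreover have "?t \<alpha> y = Some y" if y: "y \<in> ran (?t \<alpha>)" for y
      proof -
        obtain v where v: "v \<in> ran \<alpha>" "y = the (\<gamma> v)" using y unfolding ran by blast
        then obtain w where w: "\<gamma> v = Some w" using a(2) gA by blast
        then show ?thesis unfolding val using v a(3)[OF v(1)] by auto
      qed
      moreover have "ran (?t \<alpha>) \<subseteq> B" using ran_map_comp_subset[of \<gamma> "\<alpha> \<circ>\<^sub>m pinv \<gamma>"] g(2) by simp
      moreover have "orientation_preserving (?t \<alpha>)"
      proof -
        have f: "finite (dom (pinv \<gamma>))" "finite (dom \<alpha>)" "finite (dom \<gamma>)" using gp(1) g a(1) assms by simp_all
        have "orientation_preserving (\<alpha> \<circ>\<^sub>m pinv \<gamma>)" by (rule orientation_preserving_map_comp[OF f(1,2) ogi a(4)])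
        moreover have "finite (dom (\<alpha> \<circ>\<^sub>m pinv \<gamma>))" using f(1) dom_map_comp_subset finite_subset by metis
        ultimately show ?thesis using orientation_preserving_map_comp f(3) og by blast
      qed
      ultimately show ?thesis using dom by (simp add: full_idems_def)
    qed
    then show "?t ` {\<alpha> \<in> full_idems A. card (ran \<alpha>) = k} \<subseteq> {\<alpha> \<in> full_idems B. card (ran \<alpha>) = k}" by auto
  qed
qed

lemma card_full_idems_eq:
  assumes "finite A" "finite B" "card A = card B"
  shows "card {\<alpha> \<in> full_idems A. card (ran \<alpha>) = k} = card {\<alpha> \<in> full_idems B. card (ran \<alpha>) = k}"
  using card_full_idems_le[of A B k] card_full_idems_le[of B A k] assms by simp

text \<open>Reading the points outside \<open>{p..q}\<close> cyclically from \<open>q + 1\<close>, the first \<open>c\<close> of them go to \<open>q\<close> and the others to \<open>p\<close>.\<close>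

definition wrap :: "nat \<Rightarrow> nat \<Rightarrow> nat \<Rightarrow> pmap \<times> nat \<Rightarrow> pmap" where
  "wrap l p q = (\<lambda>(\<beta>, c) x. if l \<le> x then None else if p \<le> x \<and> x \<le> q then \<beta> x
     else if (if q < x then x - q - 1 else l - 1 - q + x) < c then Some q else Some p)"

definition spanning_idempotents :: "nat \<Rightarrow> nat \<Rightarrow> nat \<Rightarrow> nat \<Rightarrow> pmap set" where
  "spanning_idempotents l p q k =
     {\<alpha> \<in> full_idems {..<l}. p \<in> ran \<alpha> \<and> q \<in> ran \<alpha> \<and> ran \<alpha> \<subseteq> {p..q} \<and> card (ran \<alpha>) = k}"

text \<open>The fixed points \<open>p\<close> and \<open>q\<close> are in increasing order, so the
  cut lies outside and the map is monotone between them. The other l - (q - p) - 1 points form one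
  cyclic gap, and the number \<open>c\<close> of them going to \<open>q\<close> has l - (q - p)
  possible values.\<close>

lemma wrap_bij:
  assumes pq: "p < q" "q < l"
  shows "bij_betw (wrap l p q) (mono_idem p q k \<times> {..<l - (q - p)}) (spanning_idempotents l p q k)"
proof -
  have inside: "wrap l p q (\<beta>, c) x = \<beta> x" if "p \<le> x" "x \<le> q" for \<beta> c x
    using that pq by (simp add: wrap_def)
  have inj: "inj_on (wrap l p q) (mono_idem p q k \<times> {..<l - (q - p)})"
  proof (rule inj_onI)
    fix a a' assume h: "a \<in> mono_idem p q k \<times> {..<l - (q - p)}" "a' \<in> mono_idem p q k \<times> {..<l - (q - p)}"
      "wrap l p q a = wrap l p q a'"
    obtain \<beta> c \<beta>' c' where a: "a = (\<beta>, c)" "a' = (\<beta>', c')" by (cases a, cases a')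
    have b: "\<beta> \<in> mono_idem p q k" "\<beta>' \<in> mono_idem p q k" and c: "c < l - (q - p)" "c' < l - (q - p)"
      and e: "wrap l p q (\<beta>, c) x = wrap l p q (\<beta>', c') x" for x using h unfolding a by auto
    have "\<beta> x = \<beta>' x" for x
    proof (cases "p \<le> x \<and> x \<le> q")
      case True
      then show ?thesis using e[of x] inside by simp
    next
      case False
      then have "\<beta> x = None" "\<beta>' x = None" using mono_idemD(1)[OF b(1)] mono_idemD(1)[OF b(2)] by (metis atLeastAtMost_iff domIff)+
      then show ?thesis by simp
    qed
    moreover have "c = c'"
    proof -
      \<comment> \<open>The outer point of cyclic index \<open>d\<close> goes to \<open>p\<close>
        under \<open>d\<close> but to \<open>q\<close> under the larger \<open>d'\<close>. This
        point lies beyond \<open>q\<close> or below \<open>p\<close>, which gives the two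
        cases.\<close>
      have False if cc: "d < d'" "d' < l - (q - p)" and e': "\<And>x. wrap l p q (\<beta>1, d) x = wrap l p q (\<beta>2, d') x" for d d' \<beta>1 \<beta>2
      proof (cases "d < l - 1 - q")
        case True
        then show False using e'[of "q + 1 + d"] cc pq by (auto simp: wrap_def split: if_splits)
      next
        case False
        then show False using e'[of "d - (l - 1 - q)"] cc pq by (auto simp: wrap_def split: if_splits)
      qed
      from this[of c c' \<beta> \<beta>'] this[of c' c \<beta>' \<beta>] show ?thesis using c e by (metis nat_neq_iff)
    qed
    ultimately show "a = a'" using a by auto
  qed
  have fwd: "wrap l p q (\<beta>, c) \<in> spanning_idempotents l p q k" if b: "\<beta> \<in> mono_idem p q k" and c: "c < l - (q - p)" for \<beta> c
  proof -
    note m = mono_idemD[OF b]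
    let ?w = "wrap l p q (\<beta>, c)"
    define idx where "idx x = (if q < x then x - q - 1 else l - 1 - q + x)" for x
    have val: "?w x = Some v \<longleftrightarrow> x < l \<and> (p \<le> x \<and> x \<le> q \<and> \<beta> x = Some v \<or> \<not> (p \<le> x \<and> x \<le> q) \<and> v = (if idx x < c then q else p))" for x v
      by (auto simp: wrap_def idx_def)
    have out: "p \<le> v \<and> v \<le> q" if "?w x = Some v" for x v
      using that m(10)[of x v] pq unfolding val by (auto split: if_splits)
    have dom: "dom ?w = {..<l}"
    proof (rule Set.set_eqI)
      fix x
      have "x \<in> {p..q} \<longleftrightarrow> (\<exists>v. \<beta> x = Some v)" using m(1) by blast
      then show "x \<in> dom ?w \<longleftrightarrow> x \<in> {..<l}" unfolding dom_def mem_Collect_eq not_None_eq val by auto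
    qed
    have ran: "ran ?w = ran \<beta>"
    proof (rule Set.set_eqI)
      fix v
      have "p \<in> ran \<beta>" "q \<in> ran \<beta>" using ranI[of \<beta>, OF m(5)] ranI[of \<beta>, OF m(6)] by simp_all
      moreover have "v \<in> ran \<beta> \<Longrightarrow> ?w v = Some v" unfolding val using m(2,3) pq by auto
      ultimately show "v \<in> ran ?w \<longleftrightarrow> v \<in> ran \<beta>"
      proof -
        assume pr: "p \<in> ran \<beta>" "q \<in> ran \<beta>" and vv: "v \<in> ran \<beta> \<Longrightarrow> ?w v = Some v"
        show ?thesis
        proof
          assume "v \<in> ran ?w"
          then obtain x where "?w x = Some v" unfolding ran_def by blast
          then have "\<beta> x = Some v \<or> v = q \<or> v = p" unfolding val by (metis)
          then show "v \<in> ran \<beta>" using pr ranI[of \<beta> x v] by blast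
        next
          assume "v \<in> ran \<beta>"
          then show "v \<in> ran ?w" using ranI[of ?w v v] vv by blast
        qed
      qed
    qed
    \<comment> \<open>The cut follows the first \<open>c\<close> outer points and falls beyond
      \<open>q\<close> or, after wrapping round, below \<open>p\<close>. For c = l - 1 - q it is
      \<open>l\<close>, and no pair is reversed.\<close>
    define t where "t = (if c \<le> l - 1 - q then q + 1 + c else c - (l - 1 - q))"
    have "cut_mono t ?w" unfolding cut_mono_def
    proof (intro allI impI)
      fix x y a d assume h: "?w x = Some a" "?w y = Some d" "x < y"
      have bb: "p \<le> x \<Longrightarrow> y \<le> q \<Longrightarrow> a \<le> d" using h m(4)[of x a y d] unfolding val by auto
      have oo: "p \<le> a" "a \<le> q" "p \<le> d" "d \<le> q" using out h(1,2) by auto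
      have xl: "x < l" "y < l" using h(1,2) unfolding val by auto
      show "if x < t \<and> t \<le> y then d \<le> a else a \<le> d"
      proof (cases "c \<le> l - 1 - q")
        case True
        then have t: "t = q + 1 + c" by (simp add: t_def)
        have "x < p \<Longrightarrow> a = p" using h(1) True pq unfolding val idx_def by (auto split: if_splits)
        moreover have "q < x \<Longrightarrow> a = (if x < t then q else p)" using h(1) pq unfolding val idx_def t by (auto split: if_splits)
        moreover have "q < y \<Longrightarrow> d = (if y < t then q else p)" using h(2) pq unfolding val idx_def t by (auto split: if_splits)
        moreover have "y < p \<Longrightarrow> d = p" using h(2) True pq unfolding val idx_def by (auto split: if_splits)
        ultimately show ?thesis using bb oo h(3) t by (auto split: if_splits) linarith+
      next
        case False
        then have t: "t = c - (l - 1 - q)" "0 < t" "t \<le> p" using c pq by (auto simp: t_def)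
        have "x < p \<Longrightarrow> a = (if x < t then q else p)" using h(1) False pq unfolding val idx_def t by (auto split: if_splits)
        moreover have "q < x \<Longrightarrow> a = q" using h(1) pq False xl unfolding val idx_def t by (auto split: if_splits)
        moreover have "q < y \<Longrightarrow> d = q" using h(2) pq False xl unfolding val idx_def t by (auto split: if_splits)
        moreover have "y < p \<Longrightarrow> d = (if y < t then q else p)" using h(2) False pq unfolding val idx_def t by (auto split: if_splits)
        ultimately show ?thesis using bb oo h(3) t by (auto split: if_splits) linarith+
      qed
    qed
    then have op: "orientation_preserving ?w" using orientation_preserving_iff_cut_mono[of ?w] dom by auto
    have fixed: "?w y = Some y" if "y \<in> ran ?w" for y using that m(2,3) pq unfolding ran val by auto
    have "ran ?w \<subseteq> {..<l}" unfolding ran using m(2) pq by auto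
    then show ?thesis unfolding spanning_idempotents_def full_idems_def mem_Collect_eq
      using dom fixed op m(2,7) ranI[of \<beta>, OF m(5)] ranI[of \<beta>, OF m(6)] ran by auto
  qed
  have bwd: "\<exists>\<beta>\<in>mono_idem p q k. \<exists>c<l - (q - p). \<alpha> = wrap l p q (\<beta>, c)" if al: "\<alpha> \<in> spanning_idempotents l p q k" for \<alpha>
  proof -
    have ai: "\<alpha> \<in> full_idems {..<l}" and pr: "p \<in> ran \<alpha>" "q \<in> ran \<alpha>" "ran \<alpha> \<subseteq> {p..q}" "card (ran \<alpha>) = k"
      using al by (auto simp: spanning_idempotents_def)
    note a = full_idemsD[OF ai]
    obtain t where t: "cut_mono t \<alpha>" using orientation_preserving_iff_cut_mono[of \<alpha>] a(1,4) by auto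
    have fp: "\<alpha> p = Some p" "\<alpha> q = Some q" using a(3) pr by auto
    have bd: "p \<le> v \<and> v \<le> q" if "\<alpha> x = Some v" for x v using a(5)[OF that] pr(3) by auto
    have tpq: "t \<le> p \<or> q < t"
    proof (rule ccontr)
      assume "\<not> (t \<le> p \<or> q < t)"
      then have "q \<le> p" using cut_monoD(1)[OF t fp pq(1)] by simp
      then show False using pq by simp
    qed
    define \<beta> where "\<beta> = \<alpha> |` {p..q}"
    have val: "\<beta> x = Some v \<longleftrightarrow> p \<le> x \<and> x \<le> q \<and> \<alpha> x = Some v" for x v by (auto simp: \<beta>_def restrict_map_def)
    have rb: "ran \<beta> = ran \<alpha>"
    proof
      show "ran \<beta> \<subseteq> ran \<alpha>" unfolding ran_def val by blast
      show "ran \<alpha> \<subseteq> ran \<beta>"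
      proof
        fix v assume v: "v \<in> ran \<alpha>"
        then have "\<beta> v = Some v" using a(3)[OF v] pr(3) unfolding val by auto
        then show "v \<in> ran \<beta>" by (rule ranI)
      qed
    qed
    have bm: "\<beta> \<in> mono_idem p q k" unfolding mono_idem_def mem_Collect_eq
    proof (intro conjI allI impI ballI)
      show "dom \<beta> = {p..q}" using a(1) pq by (auto simp: \<beta>_def)
      show "ran \<beta> \<subseteq> {p..q}" "card (ran \<beta>) = k" using rb pr by simp_all
      show "\<beta> y = Some y" if "y \<in> ran \<beta>" for y using that a(3) pr(3) unfolding rb val by auto
      show "u \<le> v" if "\<beta> x = Some u" "\<beta> y = Some v" "x < y" for x y u v
        using that cut_monoD(2)[OF t, of x u y v] tpq unfolding val by linarith
      show "\<beta> p = Some p" "\<beta> q = Some q" using fp pq unfolding val by auto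
    qed
    \<comment> \<open>A threshold \<open>t \<le> p\<close> is reached only after all l - 1 - q
      points beyond \<open>q\<close>; \<open>min\<close> handles a threshold past the end of the
      chain.\<close>
    define c where "c = (if t \<le> p then l - 1 - q + t else min t l - q - 1)"
    have cl: "c < l - (q - p)" using tpq pq by (auto simp: c_def)
    have "\<alpha> = wrap l p q (\<beta>, c)"
    proof (rule ext)
      fix x
      show "\<alpha> x = wrap l p q (\<beta>, c) x"
      proof (cases "x < l")
        case False
        then have "\<alpha> x = None" using a(1) by (metis domIff lessThan_iff)
        then show ?thesis using False by (simp add: wrap_def)
      next
        case xl: True
        then obtain v where v: "\<alpha> x = Some v" using a(6) by auto
        have vb: "p \<le> v" "v \<le> q" using bd[OF v] by auto
        consider "p \<le> x" "x \<le> q" | "q < x" | "x < p" by linarith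
        then show ?thesis
        proof cases
          case 1
          then show ?thesis using xl by (simp add: wrap_def \<beta>_def)
        next
          case 2
          show ?thesis
          proof (cases "t \<le> p \<or> x < t")
            case True
            then have "q \<le> v" using cut_monoD(2)[OF t fp(2) v 2] pq by auto
            then have "v = q" using vb by simp
            moreover have "x - q - 1 < c" using True 2 xl pq tpq by (auto simp: c_def)
            ultimately show ?thesis using v 2 xl pq by (simp add: wrap_def)
          next
            case False
            then have "v \<le> p" using cut_monoD(1)[OF t fp(1) v] 2 pq tpq by auto
            then have "v = p" using vb by simp
            moreover have "\<not> x - q - 1 < c" using False 2 xl pq tpq by (auto simp: c_def)
            ultimately show ?thesis using v 2 xl pq by (simp add: wrap_def)
          qed
        next
          case 3
          show ?thesis
          proof (cases "t \<le> p \<and> x < t")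
            case True
            then have "q \<le> v" using cut_monoD(1)[OF t v fp(2)] 3 pq by auto
            then have "v = q" using vb by simp
            moreover have "l - 1 - q + x < c" using True by (auto simp: c_def)
            ultimately show ?thesis using v 3 xl pq by (simp add: wrap_def)
          next
            case False
            then have "v \<le> p" using cut_monoD(2)[OF t v fp(1)] 3 pq tpq by auto
            then have "v = p" using vb by simp
            moreover have "\<not> l - 1 - q + x < c" using False 3 xl pq tpq by (auto simp: c_def)
            ultimately show ?thesis using v 3 xl pq by (simp add: wrap_def)
          qed
        qed
      qed
    qed
    then show ?thesis using bm cl by blast
  qed
  show ?thesis unfolding bij_betw_def
  proof
    show "wrap l p q ` (mono_idem p q k \<times> {..<l - (q - p)}) = spanning_idempotents l p q k"
      using fwd bwd by (auto simp: image_iff) (metis lessThan_iff)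
  qed (rule inj)
qed

section \<open>Numbers of idempotents\<close>

definition num_idem :: "nat \<Rightarrow> nat \<Rightarrow> nat" where
  "num_idem l k = card {\<alpha> \<in> full_idems {..<l}. card (ran \<alpha>) = k}"

lemma card_full_idems_rank:
  "finite B \<Longrightarrow> card {\<alpha> \<in> full_idems B. card (ran \<alpha>) = k} = num_idem (card B) k"
  unfolding num_idem_def by (rule card_full_idems_eq) auto

lemma rank_full_idempotent_le:
  assumes "finite B" "\<alpha> \<in> full_idems B" shows "card (ran \<alpha>) \<le> card B"
  using full_idemsD(2)[OF assms(2)] card_mono[OF assms(1)] by blast

lemma num_idem_0: "num_idem l 0 = (if l = 0 then 1 else 0)"
proof (cases "l = 0")
  case True
  have "full_idems {} = {Map.empty}"
    by (auto simp: full_idems_def intro: orientation_preserving_mono)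
  then have "{\<alpha> \<in> full_idems {..<l}. card (ran \<alpha>) = 0} = {Map.empty}" using True by auto
  then show ?thesis using True by (simp add: num_idem_def)
next
  case False
  have "card (ran \<alpha>) \<noteq> 0" if "\<alpha> \<in> full_idems {..<l}" for \<alpha>
  proof -
    note a = full_idemsD[OF that]
    obtain y where "\<alpha> 0 = Some y" using a(6)[of 0] False by auto
    then have "y \<in> ran \<alpha>" by (rule ranI)
    moreover have "finite (ran \<alpha>)" using a(2) finite_subset by blast
    ultimately show ?thesis by auto
  qed
  then have e: "{\<alpha> \<in> full_idems {..<l}. card (ran \<alpha>) = 0} = {}" by blast
  show ?thesis using False unfolding num_idem_def e by simp
qed

lemma num_idem_1: "num_idem l 1 = l"
proof -
  define c where "c v = (\<lambda>x. if x < l then Some v else None)" for v :: nat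
  have cv: "c v x = Some w \<longleftrightarrow> x < l \<and> w = v" for v x w by (auto simp: c_def)
  have "bij_betw c {..<l} {\<alpha> \<in> full_idems {..<l}. card (ran \<alpha>) = 1}"
    unfolding bij_betw_def
  proof
    show "inj_on c {..<l}" by (rule inj_onI) (metis cv lessThan_iff)
    show "c ` {..<l} = {\<alpha> \<in> full_idems {..<l}. card (ran \<alpha>) = 1}"
    proof (intro equalityI subsetI)
      fix \<alpha> assume "\<alpha> \<in> c ` {..<l}"
      then obtain v where v: "v < l" "\<alpha> = c v" by blast
      have r: "ran \<alpha> = {v}" unfolding ran_def v(2) cv using v(1) by auto
      have d: "dom \<alpha> = {..<l}" by (auto simp: v(2) c_def split: if_splits)
      have "orientation_preserving \<alpha>" by (rule orientation_preserving_card_ran_le_1) (simp_all add: d r)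
      then show "\<alpha> \<in> {\<alpha> \<in> full_idems {..<l}. card (ran \<alpha>) = 1}"
        using r d v cv by (auto simp: full_idems_def)
    next
      fix \<alpha> assume "\<alpha> \<in> {\<alpha> \<in> full_idems {..<l}. card (ran \<alpha>) = 1}"
      then have al: "\<alpha> \<in> full_idems {..<l}" and "card (ran \<alpha>) = 1" by auto
      then obtain v where v: "ran \<alpha> = {v}" by (metis card_1_singletonE)
      note a = full_idemsD[OF al]
      have "\<alpha> = c v"
      proof (rule pmap_eqI)
        fix x y
        have "\<alpha> x = Some y \<Longrightarrow> x < l \<and> y = v" using a(5)[of x y] v by simp
        moreover have "\<alpha> x = Some v" if "x < l" using a(6)[of x] a(5)[of x] v that by fastforce
        ultimately show "\<alpha> x = Some y \<longleftrightarrow> c v x = Some y" unfolding cv by blast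
      qed
      then show "\<alpha> \<in> c ` {..<l}" using a(2) v by auto
    qed
  qed
  then have "num_idem l 1 = card {..<l}" unfolding num_idem_def using bij_betw_same_card by metis
  then show ?thesis by simp
qed

lemma finite_spanning: "finite (spanning_idempotents l p q k)"
  unfolding spanning_idempotents_def using finite_full_idems[of "{..<l}"] by simp

lemma spanning_ends:
  assumes "\<alpha> \<in> spanning_idempotents l p q k" shows "p = Min (ran \<alpha>)" "q = Max (ran \<alpha>)"
proof -
  have h: "p \<in> ran \<alpha>" "q \<in> ran \<alpha>" "ran \<alpha> \<subseteq> {p..q}" using assms by (auto simp: spanning_idempotents_def)
  then have f: "finite (ran \<alpha>)" using finite_subset by blast
  show "p = Min (ran \<alpha>)" using h f by (intro Min_eqI[symmetric]) auto
  show "q = Max (ran \<alpha>)" using h f by (intro Max_eqI[symmetric]) auto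
qed

text \<open>Let \<open>d\<close> be the distance between the extreme fixed points. One factor
  \<open>l - d\<close> counts the positions of the smaller one, the other the cuts in the outer gap,
  and the binomial counts the monotone part in between.\<close>

lemma num_idem_weighted:
  assumes r: "1 \<le> r"
  shows "num_idem l (Suc r) = (\<Sum>d\<in>{1..<l}. (l - d)\<^sup>2 * ((d + r - 1) choose (2 * r - 1)))"
proof -
  define P where "P = (SIGMA q:{..<l}. {..<q})"
  have "{\<alpha> \<in> full_idems {..<l}. card (ran \<alpha>) = Suc r} = (\<Union>(q, p)\<in>P. spanning_idempotents l p q (Suc r))"
  proof (intro equalityI subsetI)
    fix \<alpha> assume "\<alpha> \<in> {\<alpha> \<in> full_idems {..<l}. card (ran \<alpha>) = Suc r}"
    then have al: "\<alpha> \<in> full_idems {..<l}" and c: "card (ran \<alpha>) = Suc r" by auto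
    have s: "ran \<alpha> \<subseteq> {..<l}" using full_idemsD(2)[OF al] .
    have f: "finite (ran \<alpha>)" and ne: "ran \<alpha> \<noteq> {}" using c by (auto intro: card_ge_0_finite)
    let ?p = "Min (ran \<alpha>)" and ?q = "Max (ran \<alpha>)"
    have pq: "?p \<in> ran \<alpha>" "?q \<in> ran \<alpha>" using f ne by simp_all
    have sub: "ran \<alpha> \<subseteq> {?p..?q}" using f by auto
    have "?p \<noteq> ?q"
    proof
      assume "?p = ?q"
      then have "card (ran \<alpha>) \<le> card {?p}" using sub by (intro card_mono) auto
      then show False using c r by simp
    qed
    then have "?p < ?q" using sub pq(1) by (metis atLeastAtMost_iff le_neq_implies_less subsetD)
    then have "(?q, ?p) \<in> P" using s pq by (auto simp: P_def)
    moreover have "\<alpha> \<in> spanning_idempotents l ?p ?q (Suc r)" using al c pq sub by (simp add: spanning_idempotents_def)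
    ultimately show "\<alpha> \<in> (\<Union>(q, p)\<in>P. spanning_idempotents l p q (Suc r))" by blast
  qed (auto simp: spanning_idempotents_def)
  then have "num_idem l (Suc r) = card (\<Union>(q, p)\<in>P. spanning_idempotents l p q (Suc r))" by (simp add: num_idem_def)
  also have "\<dots> = (\<Sum>(q, p)\<in>P. card (spanning_idempotents l p q (Suc r)))"
    unfolding case_prod_unfold
  proof (rule card_UN_disjoint)
    show "finite P" by (simp add: P_def)
    show "\<forall>x\<in>P. finite (spanning_idempotents l (snd x) (fst x) (Suc r))" using finite_spanning by blast
    show "\<forall>x\<in>P. \<forall>y\<in>P. x \<noteq> y \<longrightarrow> spanning_idempotents l (snd x) (fst x) (Suc r) \<inter> spanning_idempotents l (snd y) (fst y) (Suc r) = {}"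
      using spanning_ends by (metis disjoint_iff prod_eqI)
  qed
  also have "\<dots> = (\<Sum>(q, p)\<in>P. ((q - p + r - 1) choose (2 * r - 1)) * (l - (q - p)))"
  proof (rule sum.cong[OF refl], clarify)
    fix q p assume "(q, p) \<in> P"
    then have pq: "p < q" "q < l" by (auto simp: P_def)
    show "card (spanning_idempotents l p q (Suc r)) = ((q - p + r - 1) choose (2 * r - 1)) * (l - (q - p))"
      using bij_betw_same_card[OF wrap_bij[OF pq, of "Suc r"]] card_mono_idem[OF r, of p q] pq
      by (simp add: card_cartesian_product)
  qed
  also have "\<dots> = (\<Sum>(d, p)\<in>(SIGMA d:{1..<l}. {..<l - d}). ((d + r - 1) choose (2 * r - 1)) * (l - d))"
    by (rule sum.reindex_bij_witness[where i = "\<lambda>(d, p). (p + d, p)" and j = "\<lambda>(q, p). (q - p, p)"]) (auto simp: P_def)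
  also have "\<dots> = (\<Sum>d\<in>{1..<l}. \<Sum>p<l - d. ((d + r - 1) choose (2 * r - 1)) * (l - d))"
    by (subst sum.Sigma) auto
  finally show ?thesis by (simp add: power2_eq_square mult_ac)
qed

text \<open>Substitutes j = l - d. The terms with j > l - k + 1 vanish, since then \<open>k\<close>
  fixed points do not fit into the remaining interval.\<close>

lemma num_idem_eq:
  assumes k: "2 \<le> k" "k \<le> l"
  shows "num_idem l k = (\<Sum>j = 1..l - k + 1. j\<^sup>2 * ((l - j + k - 2) choose (2 * k - 3)))"
proof -
  obtain r where r: "k = Suc r" "1 \<le> r" using k by (cases k) auto
  have "num_idem l k = (\<Sum>d\<in>{1..<l}. (l - d)\<^sup>2 * ((d + r - 1) choose (2 * r - 1)))"
    unfolding r(1) by (rule num_idem_weighted[OF r(2)])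
  also have "\<dots> = (\<Sum>j\<in>{1..<l}. j\<^sup>2 * ((l - j + r - 1) choose (2 * r - 1)))"
    by (rule sum.reindex_bij_witness[where i = "\<lambda>j. l - j" and j = "\<lambda>d. l - d"]) auto
  also have "\<dots> = (\<Sum>j = 1..l - k + 1. j\<^sup>2 * ((l - j + r - 1) choose (2 * r - 1)))"
  proof (rule sum.mono_neutral_right)
    show "{1..l - k + 1} \<subseteq> {1..<l}" using r k by auto
    show "\<forall>j\<in>{1..<l} - {1..l - k + 1}. j\<^sup>2 * ((l - j + r - 1) choose (2 * r - 1)) = 0"
    proof
      fix j assume "j \<in> {1..<l} - {1..l - k + 1}"
      then have "l - j + r - 1 < 2 * r - 1" using r k by auto
      then show "j\<^sup>2 * ((l - j + r - 1) choose (2 * r - 1)) = 0" by (simp add: binomial_eq_0)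
    qed
  qed simp
  finally show ?thesis using r by simp
qed

text \<open>These are the Fibonacci numbers of index \<open>2 d\<close> and \<open>2 d + 1\<close>.\<close>

definition fib_even :: "nat \<Rightarrow> nat" where "fib_even d = (\<Sum>r\<le>d. (d + r) choose (2 * r + 1))"
definition fib_odd :: "nat \<Rightarrow> nat" where "fib_odd d = (\<Sum>r\<le>d. (d + r) choose (2 * r))"

text \<open>Pascal's rule on every summand. Together with \<open>fib_odd_Suc\<close> this is the
  Fibonacci recurrence.\<close>

lemma fib_even_Suc: "fib_even (Suc d) = fib_even d + fib_odd d"
proof -
  have "fib_even (Suc d) = (\<Sum>r\<le>Suc d. ((d + r) choose (2 * r)) + ((d + r) choose (2 * r + 1)))"
    by (simp add: fib_even_def del: sum.atMost_Suc)
  then show ?thesis by (simp add: fib_even_def fib_odd_def sum.distrib)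
qed

lemma fib_odd_Suc: "fib_odd (Suc d) = fib_odd d + fib_even (Suc d)"
proof -
  have e: "fib_even (Suc d) = (\<Sum>r\<le>d. (Suc d + r) choose (2 * r + 1))" by (simp add: fib_even_def)
  have "fib_odd d = (\<Sum>r\<le>Suc d. (d + r) choose (2 * r))" by (simp add: fib_odd_def)
  also have "\<dots> = 1 + (\<Sum>r\<le>d. (Suc d + r) choose (2 * r + 2))"
    by (subst sum.atMost_Suc_shift) simp
  finally have o: "fib_odd d = 1 + (\<Sum>r\<le>d. (Suc d + r) choose (2 * r + 2))" .
  have "fib_odd (Suc d) = 1 + (\<Sum>r\<le>d. (Suc (Suc d + r)) choose (Suc (2 * r + 1)))"
    unfolding fib_odd_def by (subst sum.atMost_Suc_shift) simp
  also have "\<dots> = 1 + (\<Sum>r\<le>d. (Suc d + r) choose (2 * r + 2)) + (\<Sum>r\<le>d. (Suc d + r) choose (2 * r + 1))"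
    unfolding binomial_Suc_Suc sum.distrib by simp
  finally show ?thesis using o e by simp
qed

lemma fib_0: "fib_even 0 = 0" "fib_odd 0 = 1"
  by (simp_all add: fib_even_def fib_odd_def)

text \<open>The identity x^(2l) = F(2l) x + F(2l-1), with F(2l-1) written as F(2l+1) -
  F(2l).\<close>

lemma golden_even_power:
  fixes x :: real assumes "x\<^sup>2 = x + 1"
  shows "x ^ (2 * l) = real (fib_even l) * x + real (fib_odd l) - real (fib_even l)"
proof (induction l)
  case (Suc l)
  have "x ^ (2 * Suc l) = x ^ (2 * l) * x\<^sup>2" by (simp add: power_add power2_eq_square)
  also have "\<dots> = (real (fib_even l) * x + real (fib_odd l) - real (fib_even l)) * (x + 1)" unfolding Suc assms ..
  also have "\<dots> = real (fib_even l) * x\<^sup>2 + real (fib_odd l) * x + real (fib_odd l) - real (fib_even l)"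
    by (simp add: algebra_simps power2_eq_square)
  also have "\<dots> = real (fib_even (Suc l)) * x + real (fib_odd (Suc l)) - real (fib_even (Suc l))"
    unfolding assms by (simp add: fib_even_Suc fib_odd_Suc algebra_simps)
  finally show ?case .
qed (simp add: fib_0)

text \<open>The Lucas number of index 2l: the two instances of \<open>golden_even_power\<close> are
  added, and tau + theta = 1.\<close>

lemma lucas_even: "tau ^ (2 * l) + theta ^ (2 * l) = 2 * real (fib_odd l) - real (fib_even l)"
proof -
  have "tau\<^sup>2 = tau + 1" "theta\<^sup>2 = theta + 1" "tau + theta = 1"
    by (simp_all add: tau_def theta_def power2_eq_square field_simps)
  moreover from this(3) have "real (fib_even l) * tau + real (fib_even l) * theta = real (fib_even l)"
    by (metis distrib_left mult.right_neutral)
  ultimately show ?thesis using golden_even_power[of tau l] golden_even_power[of theta l] by linarith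
qed

lemma sum_fib_even: "(\<Sum>d\<le>l. real (fib_even d)) = real (fib_odd l) - 1"
  by (induction l) (simp_all add: fib_0 fib_odd_Suc)

lemma sum_linear_fib_even: "(\<Sum>d\<le>l. (real l - real d) * real (fib_even d)) = real (fib_even l) - real l"
proof (induction l)
  case (Suc l)
  have "(\<Sum>d\<le>Suc l. (real (Suc l) - real d) * real (fib_even d)) = (\<Sum>d\<le>l. (real l - real d) * real (fib_even d) + real (fib_even d))"
    by (simp add: algebra_simps)
  also have "\<dots> = real (fib_even (Suc l)) - real (Suc l)"
    unfolding sum.distrib Suc sum_fib_even by (simp add: fib_even_Suc)
  finally show ?case .
qed (simp add: fib_0)

text \<open>Expanding (l + 1 - d)^2 around l - d reduces the increment to the two preceding sums.
  This is where the terms - l^2 and - 2 of the final formula arise.\<close>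

lemma sum_square_fib_even:
  "(\<Sum>d\<le>l. (real l - real d)\<^sup>2 * real (fib_even d)) = 2 * real (fib_odd l) - real (fib_even l) - (real l)\<^sup>2 - 2"
proof (induction l)
  case (Suc l)
  have "(\<Sum>d\<le>Suc l. (real (Suc l) - real d)\<^sup>2 * real (fib_even d)) =
      (\<Sum>d\<le>l. (real l - real d)\<^sup>2 * real (fib_even d) + 2 * ((real l - real d) * real (fib_even d)) + real (fib_even d))"
    by (simp add: algebra_simps power2_eq_square)
  also have "\<dots> = 2 * real (fib_odd (Suc l)) - real (fib_even (Suc l)) - (real (Suc l))\<^sup>2 - 2"
    unfolding sum.distrib Suc sum_fib_even sum_distrib_left[symmetric] sum_linear_fib_even
    by (simp add: fib_even_Suc fib_odd_Suc power2_eq_square algebra_simps)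
  finally show ?case .
qed (simp add: fib_0)

text \<open>Adds up the ranks, with k = r + 2. The binomials vanish from r = d on, so the upper
  limit \<open>l\<close> cuts off nothing.\<close>

lemma fib_even_truncated:
  assumes "d < l" shows "(\<Sum>k = 2..l. (d + k - 2) choose (2 * k - 3)) = fib_even d"
proof -
  have "(\<Sum>k = 2..l. (d + k - 2) choose (2 * k - 3)) = (\<Sum>r<l - 1. (d + r) choose (2 * r + 1))"
    by (rule sum.reindex_bij_witness[where i = "\<lambda>r. r + 2" and j = "\<lambda>k. k - 2"])
       (auto simp: Suc_diff_Suc numeral_2_eq_2 numeral_3_eq_3)
  also have "\<dots> = (\<Sum>r<d. (d + r) choose (2 * r + 1))"
    by (rule sum.mono_neutral_right) (use assms in \<open>auto simp: binomial_eq_0\<close>)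
  also have "\<dots> = fib_even d" unfolding fib_even_def
    by (rule sum.mono_neutral_left) (auto simp: binomial_eq_0)
  finally show ?thesis .
qed

definition total_idem :: "nat \<Rightarrow> nat" where "total_idem l = (\<Sum>k\<le>l. num_idem l k)"

text \<open>The empty map. The closed formula of \<open>total_idem_eq\<close> would give 0 here, so
  the empty domain is counted separately.\<close>

lemma total_idem_0: "total_idem 0 = 1"
  by (simp add: total_idem_def num_idem_0)

lemma total_idem_eq:
  assumes "1 \<le> l"
  shows "real (total_idem l) = tau ^ (2 * l) + theta ^ (2 * l) - real l ^ 2 + real l - 2"
proof -
  have "{..l} = insert 0 (insert 1 {2..l})" using assms by auto
  then have "total_idem l = l + (\<Sum>k = 2..l. num_idem l k)"
    unfolding total_idem_def using assms num_idem_0[of l] num_idem_1[of l] by simp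
  also have "(\<Sum>k = 2..l. num_idem l k) = (\<Sum>k = 2..l. \<Sum>d\<in>{1..<l}. (l - d)\<^sup>2 * ((d + k - 2) choose (2 * k - 3)))"
  proof (rule sum.cong[OF refl])
    fix k assume "k \<in> {2..l}"
    then obtain r where r: "k = Suc r" "1 \<le> r" by (cases k) auto
    then have e: "2 * k - 3 = 2 * r - 1" "\<And>d. d + k - 2 = d + r - 1" by auto
    show "num_idem l k = (\<Sum>d\<in>{1..<l}. (l - d)\<^sup>2 * ((d + k - 2) choose (2 * k - 3)))"
      unfolding e unfolding r(1) by (rule num_idem_weighted[OF r(2)])
  qed
  also have "\<dots> = (\<Sum>d\<in>{1..<l}. (l - d)\<^sup>2 * (\<Sum>k = 2..l. (d + k - 2) choose (2 * k - 3)))"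
    by (subst sum.swap) (simp add: sum_distrib_left)
  also have "\<dots> = (\<Sum>d\<in>{1..<l}. (l - d)\<^sup>2 * fib_even d)"
    by (rule sum.cong[OF refl]) (simp add: fib_even_truncated)
  finally have "real (total_idem l) = real l + (\<Sum>d\<in>{1..<l}. real ((l - d)\<^sup>2 * fib_even d))" by simp
  also have "(\<Sum>d\<in>{1..<l}. real ((l - d)\<^sup>2 * fib_even d)) = (\<Sum>d\<in>{1..<l}. (real l - real d)\<^sup>2 * real (fib_even d))"
    by (rule sum.cong[OF refl]) (simp add: of_nat_diff)
  also have "\<dots> = (\<Sum>d\<le>l. (real l - real d)\<^sup>2 * real (fib_even d))"
  proof (rule sum.mono_neutral_left)
    show "\<forall>i\<in>{..l} - {1..<l}. (real l - real i)\<^sup>2 * real (fib_even i) = 0"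
    proof
      fix i assume "i \<in> {..l} - {1..<l}"
      then have "i = 0 \<or> i = l" by auto
      then show "(real l - real i)\<^sup>2 * real (fib_even i) = 0" by (auto simp: fib_0)
    qed
  qed auto
  finally show ?thesis unfolding sum_square_fib_even using lucas_even[of l] by simp
qed

lemma card_full_idems:
  assumes "finite B" shows "card (full_idems B) = total_idem (card B)"
proof -
  have "card (full_idems B) = (\<Sum>k\<le>card B. card {\<alpha> \<in> full_idems B. card (ran \<alpha>) = k})"
    using sum.group[of "full_idems B" "{..card B}" "\<lambda>\<alpha>. card (ran \<alpha>)" "\<lambda>_. 1::nat"]
      finite_full_idems[OF assms] rank_full_idempotent_le[OF assms] by (auto simp: image_subset_iff)
  then show ?thesis unfolding total_idem_def card_full_idems_rank[OF assms] .
qed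

section \<open>The total count\<close>

lemma sum_over_subsets:
  fixes g :: "nat \<Rightarrow> 'a::comm_semiring_1"
  assumes "finite A" shows "(\<Sum>B\<in>Pow A. g (card B)) = (\<Sum>k\<le>card A. of_nat (card A choose k) * g k)"
proof -
  have "(\<Sum>B\<in>Pow A. g (card B)) = (\<Sum>k\<le>card A. \<Sum>B\<in>{B\<in>Pow A. card B = k}. g (card B))"
    using assms by (intro sum.group[symmetric]) (auto intro: card_mono)
  also have "\<dots> = (\<Sum>k\<le>card A. of_nat (card A choose k) * g k)"
  proof (rule sum.cong[OF refl])
    fix k
    have "card {B\<in>Pow A. card B = k} = card A choose k" using n_subsets[OF assms, of k] by (simp add: Pow_def)
    then show "(\<Sum>B\<in>{B\<in>Pow A. card B = k}. g (card B)) = of_nat (card A choose k) * g k" by simp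
  qed
  finally show ?thesis .
qed

lemma eps_less_2: "eps n 0 = 0" "eps n 1 = 0"
  by (simp_all add: eps_def)

lemma sum_choose_power_2: "(\<Sum>k\<le>n. (n choose k) * 2 ^ k) = (3::nat) ^ n"
  using binomial[of 2 1 n] by simp

text \<open>The number of all partial idempotents, the empty map included, supported on a chain of
  \<open>k\<close> points, sorted by the size of the domain.\<close>

definition num_below :: "nat \<Rightarrow> nat" where "num_below k = (\<Sum>l\<le>k. (k choose l) * total_idem l)"

context orientation_monoid
begin

lemma idp_idempotent: "A \<subseteq> N \<Longrightarrow> idp A \<in> idempotents"
  using idp_C by (simp add: idempotents_def idp_comp)

text \<open>Injective idempotents are partial identities, so the pairs of an idempotent and one
  below it are pairs of nested subsets of \<open>N\<close>. Each point has three possible positions,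
  whence the power of 3.\<close>

lemma card_collapse_data_injective:
  assumes C: "C = carrier (POPI n)"
  shows "card collapse_data = 3 ^ n + (\<Sum>k = 2..n. (n choose k) * eps n k)"
proof -
  have id: "e = idp (dom e)" if e: "e \<in> idempotents" for e
  proof (rule pmap_eqI)
    fix x y
    have i: "inj_on e (dom e)" using idempotents_D(1)[OF e] C by (simp add: POPI_def)
    have "z = x" if h: "e x = Some z" for z
    proof -
      have "e z = Some z" using idempotent_fixes_ran[OF idempotents_D(2)[OF e]] ranI[of e, OF h] by blast
      then show "z = x" using i h unfolding inj_pmap_iff by blast
    qed
    then show "e x = Some y \<longleftrightarrow> idp (dom e) x = Some y" by (auto simp: dom_def)
  qed
  have "inj_on idp X" for X by (rule inj_onI) (simp add: idp_eq_iff)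
  then have inj: "inj_on idp X" for X .
  have I: "idempotents = idp ` Pow N"
  proof
    show "idempotents \<subseteq> idp ` Pow N" using id C_D(1) idempotents_D(1) by blast
    show "idp ` Pow N \<subseteq> idempotents" using idp_idempotent by blast
  qed
  have b: "card (below (idp A)) = 2 ^ card A" if A: "A \<subseteq> N" for A
  proof -
    have "below (idp A) = idp ` Pow A"
    proof (intro equalityI subsetI)
      fix f assume f: "f \<in> below (idp A)"
      then have "f \<in> idempotents" "f \<circ>\<^sub>m idp A = f" by (auto simp: below_def)
      then have "dom f \<subseteq> A" using dom_map_comp_subset[of f "idp A"] by simp
      then show "f \<in> idp ` Pow A" using id[OF \<open>f \<in> idempotents\<close>] by blast
    next
      fix f assume "f \<in> idp ` Pow A"
      then obtain B where B: "B \<subseteq> A" "f = idp B" by blast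
      then have "B \<inter> A = B" "A \<inter> B = B" "B \<subseteq> N" using A by auto
      then show "f \<in> below (idp A)" using idp_idempotent B(2) by (simp add: below_def idp_comp)
    qed
    then show ?thesis using card_image[OF inj] card_Pow[of A] finite_subset[OF A] by simp
  qed
  have "card collapse_data = (\<Sum>A\<in>Pow N. card (below (idp A)) + eps n (rk (idp A)))"
    unfolding card_collapse_data I sum.reindex[OF inj] by simp
  also have "\<dots> = (\<Sum>A\<in>Pow N. 2 ^ card A + eps n (card A))"
    by (rule sum.cong[OF refl]) (simp add: b rk_def)
  also have "\<dots> = (\<Sum>k\<le>n. (n choose k) * (2 ^ k + eps n k))"
    using sum_over_subsets[of N "\<lambda>k. 2 ^ k + eps n k"] by simp
  also have "\<dots> = 3 ^ n + (\<Sum>k\<le>n. (n choose k) * eps n k)"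
    using sum_choose_power_2[of n] by (simp add: distrib_left sum.distrib)
  also have "(\<Sum>k\<le>n. (n choose k) * eps n k) = (\<Sum>k = 2..n. (n choose k) * eps n k)"
  proof (rule sum.mono_neutral_right)
    show "\<forall>i\<in>{..n} - {2..n}. (n choose i) * eps n i = 0"
    proof
      fix i assume "i \<in> {..n} - {2..n}"
      then have "i = 0 \<or> i = 1" by auto
      then show "(n choose i) * eps n i = 0" using eps_less_2[of n] by auto
    qed
  qed auto
  finally show ?thesis .
qed

text \<open>Because an idempotent fixes its range, the range lies in the domain, so the map is a
  full idempotent there.\<close>

lemma UN_full_idems:
  assumes C: "C = carrier (POP n)" and A: "A \<subseteq> N"
  shows "(\<Union>B\<in>Pow A. full_idems B) = {f \<in> idempotents. dom f \<subseteq> A \<and> ran f \<subseteq> A}"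
proof (intro equalityI subsetI)
  fix f assume "f \<in> (\<Union>B\<in>Pow A. full_idems B)"
  then obtain B where B: "B \<subseteq> A" "f \<in> full_idems B" by blast
  note f = full_idemsD[OF B(2)]
  have s: "dom f \<subseteq> A" "ran f \<subseteq> A" using f(1,2) B(1) by auto
  have "f \<in> C" using s A f(4) by (auto simp: C POP_def partial_transformations_def)
  moreover have "f \<circ>\<^sub>m f = f"
  proof (rule pmap_eqI)
    fix x y
    have "f v = Some v" if "f x = Some v" for v using f(3) ranI[of f, OF that] by blast
    then show "(f \<circ>\<^sub>m f) x = Some y \<longleftrightarrow> f x = Some y" unfolding map_comp_Some_iff by force
  qed
  ultimately show "f \<in> {f \<in> idempotents. dom f \<subseteq> A \<and> ran f \<subseteq> A}" using s by (simp add: idempotents_def)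
next
  fix f assume "f \<in> {f \<in> idempotents. dom f \<subseteq> A \<and> ran f \<subseteq> A}"
  then have f: "f \<in> idempotents" "dom f \<subseteq> A" by auto
  have x: "f y = Some y" if "y \<in> ran f" for y using idempotent_fixes_ran[OF idempotents_D(2)[OF f(1)] that] .
  then have "ran f \<subseteq> dom f" by blast
  then have "f \<in> full_idems (dom f)" using x C_D(3)[OF idempotents_D(1)[OF f(1)]] by (simp add: full_idems_def)
  then show "f \<in> (\<Union>B\<in>Pow A. full_idems B)" using f(2) by blast
qed

lemma sum_full_idems:
  assumes C: "C = carrier (POP n)" and A: "A \<subseteq> N"
  shows "(\<Sum>f\<in>{f \<in> idempotents. dom f \<subseteq> A \<and> ran f \<subseteq> A}. g f) = (\<Sum>B\<in>Pow A. \<Sum>f\<in>full_idems B. g f)"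
proof -
  have fA: "finite A" using A finite_subset by blast
  show ?thesis unfolding UN_full_idems[OF assms, symmetric]
  proof (rule sum.UNION_disjoint)
    show "\<forall>B\<in>Pow A. finite (full_idems B)" using finite_full_idems fA finite_subset by blast
    show "\<forall>B\<in>Pow A. \<forall>B'\<in>Pow A. B \<noteq> B' \<longrightarrow> full_idems B \<inter> full_idems B' = {}"
      by (auto simp: full_idems_def)
  qed (use fA in simp)
qed

text \<open>An idempotent \<open>f\<close> below \<open>e\<close> has its range in that of
  \<open>e\<close>, and f = f e recovers it from its restriction to that range. The restrictions are
  all partial idempotents supported there, so their number depends on the rank alone.\<close>

lemma card_below:
  assumes C: "C = carrier (POP n)" and e: "e \<in> idempotents"
  shows "card (below e) = num_below (rk e)"
proof -
  let ?A = "ran e"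
  note ee = idempotents_D(2)[OF e]
  have fA: "finite ?A" and AN: "?A \<subseteq> N" using idempotents_D[OF e] by auto
  let ?F = "{f \<in> idempotents. dom f \<subseteq> ?A \<and> ran f \<subseteq> ?A}"
  have "bij_betw (\<lambda>f. f \<circ>\<^sub>m idp ?A) (below e) ?F"
  proof (rule bij_betw_byWitness[where f' = "\<lambda>f. f \<circ>\<^sub>m e"])
    show "\<forall>f\<in>below e. (f \<circ>\<^sub>m idp ?A) \<circ>\<^sub>m e = f"
    proof
      fix f assume "f \<in> below e"
      then show "(f \<circ>\<^sub>m idp ?A) \<circ>\<^sub>m e = f" by (simp add: map_comp_assoc idp_ran_comp below_def)
    qed
    have dom: "f \<circ>\<^sub>m idp ?A = f" if "dom f \<subseteq> ?A" for f :: pmap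
    proof (rule pmap_eqI)
      fix x y have "f x = Some y \<Longrightarrow> x \<in> ?A" using that by blast
      then show "(f \<circ>\<^sub>m idp ?A) x = Some y \<longleftrightarrow> f x = Some y" by (auto simp: map_comp_Some_iff)
    qed
    show "\<forall>f\<in>?F. (f \<circ>\<^sub>m e) \<circ>\<^sub>m idp ?A = f"
      using dom idempotents_D(5)[OF e] by (simp add: map_comp_assoc)
    show "(\<lambda>f. f \<circ>\<^sub>m idp ?A) ` below e \<subseteq> ?F"
    proof (rule image_subsetI)
      fix f assume f: "f \<in> below e"
      then have fi: "f \<in> idempotents" "f \<circ>\<^sub>m f = f" "f \<circ>\<^sub>m e = f" "e \<circ>\<^sub>m f = f" by (auto simp: below_def idempotents_def)
      have r: "ran f \<subseteq> ?A" using comp_idem_left_iff[OF ee] fi(4) by simp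
      then have a: "idp ?A \<circ>\<^sub>m f = f" using comp_idem_left_iff[of "idp ?A" f] by (simp add: idp_comp)
      have "f \<circ>\<^sub>m idp ?A \<in> C" using C_comp idp_C[OF AN] idempotents_D(1)[OF fi(1)] by blast
      moreover have "(f \<circ>\<^sub>m idp ?A) \<circ>\<^sub>m (f \<circ>\<^sub>m idp ?A) = f \<circ>\<^sub>m idp ?A" using a fi(2) map_comp_assoc by metis
      moreover have "dom (f \<circ>\<^sub>m idp ?A) \<subseteq> ?A" using dom_map_comp_subset[of f "idp ?A"] by simp
      moreover have "ran (f \<circ>\<^sub>m idp ?A) \<subseteq> ?A" using ran_map_comp_subset[of f "idp ?A"] r by simp
      ultimately show "f \<circ>\<^sub>m idp ?A \<in> ?F" by (simp add: idempotents_def)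
    qed
    show "(\<lambda>f. f \<circ>\<^sub>m e) ` ?F \<subseteq> below e"
    proof (rule image_subsetI)
      fix f assume f: "f \<in> ?F"
      then have r: "f \<in> idempotents" "ran f \<subseteq> ?A" by auto
      have ef: "e \<circ>\<^sub>m f = f" using comp_idem_left_iff[OF ee] r(2) by simp
      have "f \<circ>\<^sub>m e \<in> C" using C_comp idempotents_D(1)[OF r(1)] idempotents_D(1)[OF e] by blast
      moreover have "(f \<circ>\<^sub>m e) \<circ>\<^sub>m (f \<circ>\<^sub>m e) = f \<circ>\<^sub>m e" using ef idempotents_D(2)[OF r(1)] map_comp_assoc by metis
      moreover have "(f \<circ>\<^sub>m e) \<circ>\<^sub>m e = f \<circ>\<^sub>m e" using ee by (simp add: map_comp_assoc)
      moreover have "e \<circ>\<^sub>m (f \<circ>\<^sub>m e) = f \<circ>\<^sub>m e" using ef by (simp flip: map_comp_assoc)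
      ultimately show "f \<circ>\<^sub>m e \<in> below e" by (simp add: below_def idempotents_def)
    qed
  qed
  then have "card (below e) = card ?F" by (rule bij_betw_same_card)
  also have "\<dots> = (\<Sum>B\<in>Pow ?A. card (full_idems B))"
    using sum_full_idems[OF C AN, of "\<lambda>_. 1::nat"] by simp
  also have "\<dots> = (\<Sum>B\<in>Pow ?A. total_idem (card B))"
    by (rule sum.cong[OF refl]) (use card_full_idems fA finite_subset in blast)
  also have "\<dots> = num_below (rk e)"
    using sum_over_subsets[OF fA, of total_idem] by (simp add: num_below_def rk_def)
  finally show ?thesis .
qed

lemma card_collapse_data_all:
  assumes C: "C = carrier (POP n)"
  shows "card collapse_data = (\<Sum>i\<le>n. (n choose i) * (\<Sum>k\<le>i. num_idem i k * (num_below k + eps n k)))"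
proof -
  let ?g = "\<lambda>k. num_below k + eps n k"
  have I: "idempotents = {f \<in> idempotents. dom f \<subseteq> N \<and> ran f \<subseteq> N}"
    using C_D(1,2) idempotents_D(1) by blast
  have inner: "(\<Sum>e\<in>full_idems B. ?g (rk e)) = (\<Sum>k\<le>card B. num_idem (card B) k * ?g k)" if B: "finite B" for B
  proof -
    have "(\<Sum>e\<in>full_idems B. ?g (rk e)) = (\<Sum>k\<le>card B. \<Sum>e\<in>{e \<in> full_idems B. rk e = k}. ?g (rk e))"
      using finite_full_idems[OF B] rank_full_idempotent_le[OF B]
      by (intro sum.group[symmetric]) (auto simp: rk_def)
    also have "\<dots> = (\<Sum>k\<le>card B. num_idem (card B) k * ?g k)"
    proof (rule sum.cong[OF refl])
      fix k
      show "(\<Sum>e\<in>{e \<in> full_idems B. rk e = k}. ?g (rk e)) = num_idem (card B) k * ?g k"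
        using card_full_idems_rank[OF B, of k] by (simp add: rk_def)
    qed
    finally show ?thesis .
  qed
  have "card collapse_data = (\<Sum>e\<in>idempotents. ?g (rk e))"
    unfolding card_collapse_data by (rule sum.cong[OF refl]) (simp add: card_below[OF C])
  also have "\<dots> = (\<Sum>B\<in>Pow N. \<Sum>e\<in>full_idems B. ?g (rk e))"
    by (subst I) (rule sum_full_idems[OF C order.refl])
  also have "\<dots> = (\<Sum>B\<in>Pow N. \<Sum>k\<le>card B. num_idem (card B) k * ?g k)"
    by (rule sum.cong[OF refl]) (use inner finite_subset in blast)
  also have "\<dots> = (\<Sum>i\<le>n. (n choose i) * (\<Sum>k\<le>i. num_idem i k * ?g k))"
    using sum_over_subsets[of N "\<lambda>i. \<Sum>k\<le>i. num_idem i k * ?g k"] by simp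
  finally show ?thesis .
qed

end

text \<open>Counts the nonempty partial idempotents on \<open>k\<close> points; the empty map is the
  separate \<open>1\<close> in \<open>num_below_eq\<close>.\<close>

definition idem_sum :: "nat \<Rightarrow> real" where
  "idem_sum k = (\<Sum>l = 1..k. real (k choose l) * (tau ^ (2 * l) + theta ^ (2 * l) - real l ^ 2 + real l - 2))"

lemma num_below_eq: "real (num_below k) = 1 + idem_sum k"
proof -
  have "{..k} = insert 0 {1..k}" by auto
  then have "real (num_below k) = 1 + (\<Sum>l = 1..k. real (k choose l) * real (total_idem l))"
    by (simp add: num_below_def total_idem_0)
  also have "(\<Sum>l = 1..k. real (k choose l) * real (total_idem l)) = idem_sum k"
    unfolding idem_sum_def by (rule sum.cong[OF refl]) (simp add: total_idem_eq)
  finally show ?thesis .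
qed

lemma idem_sum_less_2: "idem_sum 0 = 0" "idem_sum 1 = 1"
  using lucas_even[of "Suc 0"] by (simp_all add: idem_sum_def fib_even_Suc fib_odd_Suc fib_0)

text \<open>The constant part of the weight counts all partial idempotents. In the part with
  \<open>X\<close>, rank 0 drops out and rank 1 contributes the sum of i (n choose i), which is n
  2^(n-1). For the ranks k \<ge> 2, the sums over \<open>i\<close> and \<open>k\<close> are
  exchanged.\<close>

lemma sum_idempotent_weights:
  fixes X :: "nat \<Rightarrow> real"
  assumes X: "X 0 = 0" "X 1 = 1"
  shows "(\<Sum>i\<le>n. real (n choose i) * (\<Sum>k\<le>i. real (num_idem i k) * (1 + X k))) =
    1 + idem_sum n + real n * 2 ^ (n - 1) +
    (\<Sum>k = 2..n. \<Sum>i = k..n. real (n choose i) *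
       (\<Sum>j = 1..i - k + 1. real j ^ 2 * real ((i - j + k - 2) choose (2 * k - 3)) * X k))"
proof -
  have inner: "(\<Sum>k\<le>i. real (num_idem i k) * (1 + X k)) =
      real (total_idem i) + real i + (\<Sum>k = 2..i. real (num_idem i k) * X k)" for i
  proof -
    have "(\<Sum>k\<le>i. real (num_idem i k) * X k) = real i + (\<Sum>k = 2..i. real (num_idem i k) * X k)"
    proof (cases "i = 0")
      case False
      then have "{..i} = insert 0 (insert 1 {2..i})" by auto
      then show ?thesis using X num_idem_1[of i] by simp
    qed (simp add: X)
    then show ?thesis by (simp add: total_idem_def distrib_left sum.distrib)
  qed
  have total: "(\<Sum>i\<le>n. real (n choose i) * real (total_idem i)) = 1 + idem_sum n"
    using num_below_eq[of n] by (simp add: num_below_def)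
  have linear: "(\<Sum>i\<le>n. real (n choose i) * real i) = real n * 2 ^ (n - 1)"
    using arg_cong[OF choose_linear_sum[of n], of real] by (simp add: mult.commute)
  have "(\<Sum>i\<le>n. real (n choose i) * (\<Sum>k = 2..i. real (num_idem i k) * X k)) =
      (\<Sum>i\<in>{..n}. \<Sum>k\<in>{k \<in> {2..n}. k \<le> i}. real (n choose i) * (real (num_idem i k) * X k))"
    unfolding sum_distrib_left by (intro sum.cong refl) auto
  also have "\<dots> = (\<Sum>k\<in>{2..n}. \<Sum>i\<in>{i \<in> {..n}. k \<le> i}. real (n choose i) * (real (num_idem i k) * X k))"
    by (rule sum.swap_restrict) simp_all
  also have "\<dots> = (\<Sum>k = 2..n. \<Sum>i = k..n. real (n choose i) *
      (\<Sum>j = 1..i - k + 1. real j ^ 2 * real ((i - j + k - 2) choose (2 * k - 3)) * X k))"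
  proof (intro sum.cong)
    fix k i assume "k \<in> {2..n}" "i \<in> {k..n}"
    then have "num_idem i k = (\<Sum>j = 1..i - k + 1. j\<^sup>2 * ((i - j + k - 2) choose (2 * k - 3)))"
      by (intro num_idem_eq) auto
    then show "real (n choose i) * (real (num_idem i k) * X k) = real (n choose i) *
        (\<Sum>j = 1..i - k + 1. real j ^ 2 * real ((i - j + k - 2) choose (2 * k - 3)) * X k)"
      by (simp only: of_nat_sum of_nat_mult of_nat_power sum_distrib_right)
  qed auto
  finally show ?thesis unfolding inner unfolding distrib_left sum.distrib total linear by (simp only:)
qed

lemma hom_POP: "semigroup_endos (POP n) = {\<phi> \<in> extensional (carrier (POP n)). (\<forall>\<alpha>\<in>carrier (POP n). \<phi> \<alpha> \<in> carrier (POP n)) \<and>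
    (\<forall>\<alpha>\<in>carrier (POP n). \<forall>\<beta>\<in>carrier (POP n). \<phi> (\<beta> \<circ>\<^sub>m \<alpha>) = \<phi> \<beta> \<circ>\<^sub>m \<phi> \<alpha>)}"
  by (auto simp: semigroup_endos_def hom_def POP_def)

lemma hom_POPI: "semigroup_endos (POPI n) = {\<phi> \<in> extensional (carrier (POPI n)). (\<forall>\<alpha>\<in>carrier (POPI n). \<phi> \<alpha> \<in> carrier (POPI n)) \<and>
    (\<forall>\<alpha>\<in>carrier (POPI n). \<forall>\<beta>\<in>carrier (POPI n). \<phi> (\<beta> \<circ>\<^sub>m \<alpha>) = \<phi> \<beta> \<circ>\<^sub>m \<phi> \<alpha>)}"
  by (auto simp: semigroup_endos_def hom_def POPI_def POP_def)

theorem theorem3p5: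
  fixes n :: nat
  assumes "n \<ge> 3"
  shows "card (semigroup_endos (POPI n)) =
           2 * n + n * totient n + 3 ^ n + (\<Sum>k = 2..n. (n choose k) * eps n k)
       \<and> real (card (semigroup_endos (POP n))) =
           1 + 2 * real n + real n * real (totient n) + real n * 2 ^ (n - 1)
           + (\<Sum>k = 1..n. real (n choose k) *
                (tau ^ (2 * k) + theta ^ (2 * k) - real k ^ 2 + real k - 2))
           + (\<Sum>k = 2..n. \<Sum>i = k..n. real (n choose i) *
                (\<Sum>j = 1..i - k + 1. real j ^ 2 * real ((i - j + k - 2) choose (2 * k - 3)) *
                  (real (eps n k) +
                    (\<Sum>l = 1..k. real (k choose l) *
                      (tau ^ (2 * l) + theta ^ (2 * l) - real l ^ 2 + real l - 2)))))"
    (is "?popi \<and> _ = ?pop")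
proof -
  interpret I: orientation_monoid n "carrier (POPI n)" using assms by unfold_locales auto
  have popi: ?popi
    using I.card_endos I.card_collapse_data_injective[OF refl] unfolding I.endos_def hom_POPI by simp
  interpret P: orientation_monoid n "carrier (POP n)" using assms by unfold_locales auto
  \<comment> \<open>The full weight of an idempotent of rank \<open>k\<close> is
    \<open>1 + ?X k\<close>: one for the empty map below it, \<open>idem_sum k\<close> for the
    nonempty idempotents below it, and \<open>eps n k\<close> for the nontrivial rotations of its
    range.\<close>
  let ?X = "\<lambda>k. real (eps n k) + idem_sum k"
  have "real (card P.collapse_data) = (\<Sum>i\<le>n. real (n choose i) * (\<Sum>k\<le>i. real (num_idem i k) * (1 + ?X k)))"
    unfolding P.card_collapse_data_all[OF refl] by (simp add: num_below_eq add_ac)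
  also have "\<dots> = 1 + idem_sum n + real n * 2 ^ (n - 1) +
      (\<Sum>k = 2..n. \<Sum>i = k..n. real (n choose i) *
       (\<Sum>j = 1..i - k + 1. real j ^ 2 * real ((i - j + k - 2) choose (2 * k - 3)) * ?X k))"
    by (rule sum_idempotent_weights) (use eps_less_2[of n] idem_sum_less_2 in simp_all)
  finally have "real (card P.collapse_data) = 1 + idem_sum n + real n * 2 ^ (n - 1) +
      (\<Sum>k = 2..n. \<Sum>i = k..n. real (n choose i) *
       (\<Sum>j = 1..i - k + 1. real j ^ 2 * real ((i - j + k - 2) choose (2 * k - 3)) * ?X k))" .
  moreover have "card (semigroup_endos (POP n)) = 2 * n + n * totient n + card P.collapse_data"
    using P.card_endos unfolding P.endos_def hom_POP .
  ultimately have "real (card (semigroup_endos (POP n))) = ?pop" unfolding idem_sum_def by simp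
  with popi show ?thesis ..
qed

end
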